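(* Every compact $\Phi_{(3)}$-superstrongly unstable ($\Phi_{(3)}$-SSU) manifold $M$ is $6$-connected, i.e. $\pi_1(M)=\cdots=\pi_6(M)=0$.
   Context: A Riemannian manifold $M^m$ is $\Phi_{(3)}$-SSU if there is an isometric immersion of $M$ in some $\mathbb R^q$ with second fundamental form $B$ such that for every $x\in M$ and every unit tangent vector $v\in T_xM$, $$F_{\Phi_{(3)},x}(v)=\sum_{i=1}^m\big(6\langle B(v,e_i),B(v,e_i)\rangle-\langle B(v,v),B(e_i,e_i)\rangle\big)<0,$$ where $\{e_1,\dots,e_m\}$ is a local orthonormal frame near $x$. Manifolds are smooth, connected, without boundary and of positive dimension. *)

theory Defs
  imports "HOL-Analysis.Analysis" "HOL-Algebra.Elementary_Groups"
begin

section \<open>Smooth maps between Euclidean spaces\<close>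

text \<open>
  \<open>Ck_on k S f\<close> is used only for open \<open>S\<close>. Since the domain is finite-dimensional there, continuity
  of all iterated directional derivatives of order up to \<open>k\<close> is the usual class \<open>C^k\<close>.
\<close>

primrec Ck_on ::
  "nat \<Rightarrow> 'v::real_normed_vector set \<Rightarrow> ('v \<Rightarrow> 'w::real_normed_vector) \<Rightarrow> bool" where
  "Ck_on 0 S f \<longleftrightarrow> continuous_on S f"
| "Ck_on (Suc k) S f \<longleftrightarrow>
     (\<forall>x\<in>S. f differentiable (at x)) \<and>
     (\<forall>v. Ck_on k S (\<lambda>x. frechet_derivative f (at x) v))"

definition smooth_on ::
  "'v::real_normed_vector set \<Rightarrow> ('v \<Rightarrow> 'w::real_normed_vector) \<Rightarrow> bool" where
  "smooth_on S f \<longleftrightarrow> (\<forall>k. Ck_on k S f)"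


section \<open>Smooth manifolds and Riemannian metrics\<close>

type_synonym ('a, 'm) chart = "'a set \<times> ('a \<Rightarrow> real ^ 'm)"

abbreviation chart_dom :: "('a, 'm) chart \<Rightarrow> 'a set" where
  "chart_dom c \<equiv> fst c"

abbreviation chart_map :: "('a, 'm) chart \<Rightarrow> 'a \<Rightarrow> real ^ 'm" where
  "chart_map c \<equiv> snd c"

definition chart_image :: "('a, 'm) chart \<Rightarrow> (real ^ 'm) set" where
  "chart_image c = chart_map c ` chart_dom c"

definition chart_inv :: "('a, 'm) chart \<Rightarrow> real ^ 'm \<Rightarrow> 'a" where
  "chart_inv c = inv_into (chart_dom c) (chart_map c)"

definition is_chart :: "'a topology \<Rightarrow> ('a, 'm::finite) chart \<Rightarrow> bool" where
  "is_chart X c \<longleftrightarrow>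
     openin X (chart_dom c) \<and> open (chart_image c) \<and>
     homeomorphic_map (subtopology X (chart_dom c)) (top_of_set (chart_image c)) (chart_map c)"

definition transition ::
  "('a, 'm::finite) chart \<Rightarrow> ('a, 'm) chart \<Rightarrow> real ^ 'm \<Rightarrow> real ^ 'm" where
  "transition c d = chart_map d \<circ> chart_inv c"

text \<open>
  Without boundary and of dimension \<open>CARD('m)\<close>, which is positive. The atlas need not be maximal:
  the notions below do not depend on the choice of an atlas within a smooth structure.
\<close>

definition smooth_manifold :: "'a topology \<Rightarrow> ('a, 'm::finite) chart set \<Rightarrow> bool" where
  "smooth_manifold X \<A> \<longleftrightarrow>
     Hausdorff_space X \<and> second_countable X \<and>
     (\<forall>c\<in>\<A>. is_chart X c) \<and>
     (\<Union>c\<in>\<A>. chart_dom c) = topspace X \<and>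
     (\<forall>c\<in>\<A>. \<forall>d\<in>\<A>. smooth_on (chart_map c ` (chart_dom c \<inter> chart_dom d)) (transition c d))"

text \<open>
  A tangent vector at \<open>x\<close> is written as its coordinate vector in a chart \<open>c\<close> around \<open>x\<close>; the
  coordinate vector of the same tangent vector in a chart \<open>d\<close> is its image under the derivative
  of \<open>transition c d\<close>. Thus \<open>g c x u v\<close> is the metric at \<open>x\<close> on the vectors with \<open>c\<close>-coordinates
  \<open>u\<close> and \<open>v\<close>.
\<close>

type_synonym ('a, 'm) metric_field =
  "('a, 'm) chart \<Rightarrow> 'a \<Rightarrow> real ^ 'm \<Rightarrow> real ^ 'm \<Rightarrow> real"

definition riemannian_metric ::
  "('a, 'm::finite) chart set \<Rightarrow> ('a, 'm) metric_field \<Rightarrow> bool" where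
  "riemannian_metric \<A> g \<longleftrightarrow>
     (\<forall>c\<in>\<A>. \<forall>x\<in>chart_dom c.
        bilinear (g c x) \<and> (\<forall>u v. g c x u v = g c x v u) \<and> (\<forall>u. u \<noteq> 0 \<longrightarrow> g c x u u > 0)) \<and>
     (\<forall>c\<in>\<A>. \<forall>u v. smooth_on (chart_image c) (\<lambda>p. g c (chart_inv c p) u v)) \<and>
     (\<forall>c\<in>\<A>. \<forall>d\<in>\<A>. \<forall>x\<in>chart_dom c \<inter> chart_dom d. \<forall>u v.
        g c x u v =
        g d x (frechet_derivative (transition c d) (at (chart_map c x)) u)
              (frechet_derivative (transition c d) (at (chart_map c x)) v))"

definition riemannian_manifold ::
  "'a topology \<Rightarrow> ('a, 'm::finite) chart set \<Rightarrow> ('a, 'm) metric_field \<Rightarrow> bool" where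
  "riemannian_manifold X \<A> g \<longleftrightarrow>
     smooth_manifold X \<A> \<and> connected_space X \<and> topspace X \<noteq> {} \<and> riemannian_metric \<A> g"


section \<open>Isometric immersions and the second fundamental form\<close>

text \<open>The derivative at \<open>x\<close> of \<open>F\<close> in direction of the vector with \<open>c\<close>-coordinates \<open>u\<close>.\<close>

definition chart_diff ::
  "('a \<Rightarrow> 'w::real_normed_vector) \<Rightarrow> ('a, 'm::finite) chart \<Rightarrow> 'a \<Rightarrow> real ^ 'm \<Rightarrow> 'w" where
  "chart_diff F c x u = frechet_derivative (F \<circ> chart_inv c) (at (chart_map c x)) u"

definition isometric_immersion ::
  "('a, 'm::finite) chart set \<Rightarrow> ('a, 'm) metric_field \<Rightarrow> ('a \<Rightarrow> real ^ 'q::finite) \<Rightarrow> bool" where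
  "isometric_immersion \<A> g F \<longleftrightarrow>
     (\<forall>c\<in>\<A>. smooth_on (chart_image c) (F \<circ> chart_inv c)) \<and>
     (\<forall>c\<in>\<A>. \<forall>x\<in>chart_dom c.
        inj (chart_diff F c x) \<and>
        (\<forall>u v. chart_diff F c x u \<bullet> chart_diff F c x v = g c x u v))"

definition normal_part :: "'w::real_inner set \<Rightarrow> 'w \<Rightarrow> 'w" where
  "normal_part T w = (THE n. w - n \<in> T \<and> (\<forall>t\<in>T. orthogonal n t))"

text \<open>
  The second fundamental form is \<open>B(U, V) = (D\<^sub>U (dF V))\<^sup>\<bottom>\<close>, with \<open>D\<close> the flat connection of the
  ambient space. It is tensorial, so \<open>V\<close> may be extended to the vector field with constant
  coordinates in the chart; then \<open>dF V\<close> is the function \<open>y \<mapsto> chart_diff F c y v\<close>.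
\<close>

definition second_fundamental_form ::
  "('a \<Rightarrow> real ^ 'q::finite) \<Rightarrow> ('a, 'm::finite) chart \<Rightarrow> 'a \<Rightarrow>
     real ^ 'm \<Rightarrow> real ^ 'm \<Rightarrow> real ^ 'q" where
  "second_fundamental_form F c x u v =
     normal_part (range (chart_diff F c x)) (chart_diff (\<lambda>y. chart_diff F c y v) c x u)"


section \<open>The superstrong instability condition\<close>

definition orthonormal_frame_at ::
  "('a, 'm::finite) metric_field \<Rightarrow> ('a, 'm) chart \<Rightarrow> 'a \<Rightarrow> ('m \<Rightarrow> real ^ 'm) \<Rightarrow> bool" where
  "orthonormal_frame_at g c x e \<longleftrightarrow> (\<forall>i j. g c x (e i) (e j) = (if i = j then 1 else 0))"

definition F_Phi3 ::
  "('a \<Rightarrow> real ^ 'q::finite) \<Rightarrow> ('a, 'm::finite) chart \<Rightarrow> 'a \<Rightarrow> ('m \<Rightarrow> real ^ 'm) \<Rightarrow>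
     real ^ 'm \<Rightarrow> real" where
  "F_Phi3 F c x e v =
     (let B = second_fundamental_form F c x
      in \<Sum>i\<in>UNIV. 6 * (B v (e i) \<bullet> B v (e i)) - B v v \<bullet> B (e i) (e i))"

text \<open>
  Only the values of the frame at \<open>x\<close> enter, and the sum does not depend on the frame. The
  dimension \<open>q\<close> of the ambient space is the type argument; \<open>Phi3_SSU TYPE('q) \<dots>\<close> as a premise with
  \<open>'q\<close> not occurring in the conclusion says that the condition holds for some \<open>q\<close>.
\<close>

definition Phi3_SSU ::
  "'q::finite itself \<Rightarrow> 'a topology \<Rightarrow> ('a, 'm::finite) chart set \<Rightarrow> ('a, 'm) metric_field \<Rightarrow> bool"
  where
  "Phi3_SSU _ X \<A> g \<longleftrightarrow>
     riemannian_manifold X \<A> g \<and>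
     (\<exists>F :: 'a \<Rightarrow> real ^ 'q.
        isometric_immersion \<A> g F \<and>
        (\<forall>c\<in>\<A>. \<forall>x\<in>chart_dom c. \<forall>e v.
           orthonormal_frame_at g c x e \<and> g c x v v = 1 \<longrightarrow> F_Phi3 F c x e v < 0))"


section \<open>Homotopy groups\<close>

text \<open>
  The cube \<open>[0,1]^k\<close> consists of extensional functions on \<open>{..<k}\<close>; \<open>homotopy_group k X x0\<close> is
  meant for \<open>k > 0\<close>. Its elements are the homotopy classes, relative to the boundary, of maps of
  the cube sending the boundary to \<open>x0\<close>, and two maps are multiplied by juxtaposition in the
  coordinate \<open>0\<close>.
\<close>

definition cube :: "nat \<Rightarrow> (nat \<Rightarrow> real) topology" where
  "cube k = product_topology (\<lambda>_. top_of_set {0..1}) {..<k}"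

definition cube_boundary :: "nat \<Rightarrow> (nat \<Rightarrow> real) set" where
  "cube_boundary k = {t \<in> topspace (cube k). \<exists>i<k. t i = 0 \<or> t i = 1}"

definition cube_map :: "nat \<Rightarrow> 'a topology \<Rightarrow> 'a \<Rightarrow> ((nat \<Rightarrow> real) \<Rightarrow> 'a) set" where
  "cube_map k X x0 = {f. continuous_map (cube k) X f \<and> (\<forall>t\<in>cube_boundary k. f t = x0)}"

definition cube_homotopic ::
  "nat \<Rightarrow> 'a topology \<Rightarrow> 'a \<Rightarrow> (((nat \<Rightarrow> real) \<Rightarrow> 'a) \<times> ((nat \<Rightarrow> real) \<Rightarrow> 'a)) set" where
  "cube_homotopic k X x0 =
     {(f, h). homotopic_with (\<lambda>f. \<forall>t\<in>cube_boundary k. f t = x0) (cube k) X f h}"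

definition cube_concat ::
  "((nat \<Rightarrow> real) \<Rightarrow> 'a) \<Rightarrow> ((nat \<Rightarrow> real) \<Rightarrow> 'a) \<Rightarrow> (nat \<Rightarrow> real) \<Rightarrow> 'a" where
  "cube_concat f h t =
     (if t 0 \<le> 1/2 then f (t(0 := 2 * t 0)) else h (t(0 := 2 * t 0 - 1)))"

definition homotopy_group ::
  "nat \<Rightarrow> 'a topology \<Rightarrow> 'a \<Rightarrow> ((nat \<Rightarrow> real) \<Rightarrow> 'a) set monoid" where
  "homotopy_group k X x0 =
     \<lparr> carrier = cube_map k X x0 // cube_homotopic k X x0,
       mult = (\<lambda>P Q. cube_homotopic k X x0 `` {cube_concat f h |f h. f \<in> P \<and> h \<in> Q}),
       one = cube_homotopic k X x0 `` {\<lambda>_. x0} \<rparr>"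

definition n_connected :: "nat \<Rightarrow> 'a topology \<Rightarrow> bool" where
  "n_connected n X \<longleftrightarrow>
     topspace X \<noteq> {} \<and> path_connected_space X \<and>
     (\<forall>x\<in>topspace X. \<forall>k\<in>{1..n}. trivial_group (homotopy_group k X x))"

end

theory Submission
  imports Defs
begin

text \<open>
  Let \<open>F\<close> be the given immersion of \<open>M\<close> into Euclidean space, \<open>B\<close> its second fundamental form and \<open>H\<close> the
  trace of \<open>B\<close>. For \<open>w\<close> close to \<open>F x\<close> let \<open>\<rho> x w\<close> be the point of \<open>M\<close> near \<open>x\<close> whose image is nearest to
  \<open>w\<close>. Translating by a small vector \<open>j\<close> and projecting back gives a move \<open>x \<mapsto> \<rho> x (F x + j)\<close> of \<open>M\<close>, which
  is homotopic to the identity. Take the vectors \<open>j = \<plusminus> t b\<close> for an orthonormal basis of vectors \<open>b\<close>. In a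
  chart \<open>F \<circ> \<rho>\<close> is the nearest-point retraction onto the immersed patch, and the traces of its derivatives
  that matter are expressed by \<open>B\<close>. For a unit tangent vector \<open>v\<close> and an orthonormal frame \<open>e\<close>, the second
  derivatives at \<open>t = 0\<close> of the \<open>p\<close>-th powers of the lengths of \<open>v\<close> after the moves along \<open>b\<close> sum to
  \<open>p (2 (\<Sum>i. |B v (e i)|\<^sup>2) + (p - 2) |B v v|\<^sup>2 - B v v \<bullet> H)\<close>, by \<open>second_variation\<close>. At \<open>p = 6\<close> this is at
  most \<open>p\<close> times the expression that the instability condition makes negative, because
  \<open>|B v v|\<^sup>2 \<le> (\<Sum>i. |B v (e i)|\<^sup>2)\<close>. By compactness some \<open>p > 6\<close> and some step \<open>t\<close> work everywhere: on average
  over the moves, \<open>p\<close>-th powers of small distances shrink by a factor less than one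
  (\<open>moves_contract_infinitesimally\<close>, \<open>ex_contracting_tube\<close>).
  
  Hence every map into \<open>M\<close> admits a move that lowers its energy by a fixed factor. The energy used here is
  discrete: a map of the \<open>k\<close>-cube is sampled on a grid of mesh \<open>1 / N\<close>, and the \<open>p\<close>-th powers of the distances
  between images of neighbouring grid points are summed. For a Lipschitz map about \<open>N ^ k\<close> edges contribute
  about \<open>N powr (- p)\<close> each, so for \<open>k \<le> 6 < p\<close> the energy is small on fine grids
  (\<open>energy_of_samples_tendsto_0\<close>). Small energy bounds every single edge, and short edges allow the samples to
  be interpolated by projected convex combinations (\<open>blend\<close>). So repeated energy-decreasing moves are
  homotopies of interpolations, and they end with all samples close to one point, where the interpolation is
  homotopic to a constant (\<open>null_homotopic_if_small_energy\<close>, \<open>cube_map_null_homotopic\<close>). During these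
  homotopies the boundary of the cube is mapped to a moving point; \<open>based_homotopic_const_if_free\<close> makes them
  relative to the boundary, so the homotopy groups up to dimension \<open>6\<close> are trivial.
\<close>

section \<open>Calculus of k times continuously differentiable maps\<close>

lemma Ck_on_cong:
  assumes "open S" "\<And>x. x \<in> S \<Longrightarrow> f x = g x"
  shows "Ck_on k S f \<longleftrightarrow> Ck_on k S g"
  using assms(2)
proof (induction k arbitrary: f g)
  case 0
  then show ?case by (auto cong: continuous_on_cong)
next
  case (Suc k)
  have hd: "(f has_derivative f') (at x) \<longleftrightarrow> (g has_derivative f') (at x)" if "x \<in> S" for x f'
    using has_derivative_transform_within_open[OF _ \<open>open S\<close> that, of f f' UNIV g]
      has_derivative_transform_within_open[OF _ \<open>open S\<close> that, of g f' UNIV f] Suc.prems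
    by auto
  have "frechet_derivative f (at x) = frechet_derivative g (at x)" if "x \<in> S" for x
    unfolding frechet_derivative_def using hd[OF that] by simp
  moreover have "f differentiable (at x) \<longleftrightarrow> g differentiable (at x)" if "x \<in> S" for x
    unfolding differentiable_def using hd[OF that] by simp
  ultimately show ?case
    using Suc.IH[of "\<lambda>x. frechet_derivative f (at x) v" "\<lambda>x. frechet_derivative g (at x) v" for v]
    by simp
qed

lemma Ck_on_transform:
  assumes "open S" "Ck_on k S g" "\<And>x. x \<in> S \<Longrightarrow> f x = g x"
  shows "Ck_on k S f"
  using Ck_on_cong[OF assms(1,3)] assms(2) by simp

lemma Ck_on_subset: "Ck_on k T f \<Longrightarrow> S \<subseteq> T \<Longrightarrow> Ck_on k S f"
  by (induction k arbitrary: f) (auto intro: continuous_on_subset)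

lemma Ck_on_imp_continuous_on: "Ck_on k S f \<Longrightarrow> continuous_on S f"
  by (cases k) (auto intro!: continuous_at_imp_continuous_on differentiable_imp_continuous_within)

lemma Ck_on_Suc_D: "Ck_on (Suc k) S f \<Longrightarrow> Ck_on k S f"
proof (induction k arbitrary: f)
  case 0
  then show ?case using Ck_on_imp_continuous_on[of "Suc 0" S f] by simp
next
  case (Suc k)
  show ?case
    unfolding Ck_on.simps(2)[of k S f] using Suc by (auto simp del: Ck_on.simps(2) simp: Ck_on.simps(2)[of "Suc k"])
qed

lemma Ck_on_SucI:
  assumes "open S" "\<And>x. x \<in> S \<Longrightarrow> (f has_derivative f' x) (at x)" "\<And>v. Ck_on k S (\<lambda>x. f' x v)"
  shows "Ck_on (Suc k) S f"
  unfolding Ck_on.simps(2)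
proof (intro conjI ballI allI)
  show "f differentiable (at x)" if "x \<in> S" for x using assms(2)[OF that] by (auto simp: differentiable_def)
  show "Ck_on k S (\<lambda>x. frechet_derivative f (at x) v)" for v
    by (rule Ck_on_transform[OF \<open>open S\<close> assms(3)[of v]])
      (simp add: frechet_derivative_at[OF assms(2), symmetric])
qed

lemma Ck_on_has_derivative:
  assumes "Ck_on (Suc k) S f" "x \<in> S"
  shows "(f has_derivative frechet_derivative f (at x)) (at x)"
  using assms frechet_derivative_works by auto

lemma Ck_on_derivative:
  assumes "Ck_on (Suc k) S f"
  shows "Ck_on k S (\<lambda>x. frechet_derivative f (at x) v)"
  using assms by auto

lemma Ck_on_const: "open S \<Longrightarrow> Ck_on k S (\<lambda>_. c)"
proof (induction k arbitrary: c)
  case (Suc k)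
  show ?case
    by (rule Ck_on_SucI[where f' = "\<lambda>_ _. 0"]) (use Suc in auto)
qed (auto)

lemma Ck_on_bounded_linear:
  assumes "open S" "bounded_linear L"
  shows "Ck_on k S L"
proof (cases k)
  case 0
  then show ?thesis using assms by (simp add: linear_continuous_on)
next
  case (Suc j)
  show ?thesis unfolding Suc
    by (rule Ck_on_SucI[where f' = "\<lambda>_. L"])
      (use assms in \<open>auto intro: bounded_linear_imp_has_derivative Ck_on_const\<close>)
qed

lemma Ck_on_add:
  assumes "open S" "Ck_on k S f" "Ck_on k S g"
  shows "Ck_on k S (\<lambda>x. f x + g x)"
  using assms(2,3)
proof (induction k arbitrary: f g)
  case 0
  then show ?case by (auto intro: continuous_intros)
next
  case (Suc k)
  show ?case
    by (rule Ck_on_SucI[OF \<open>open S\<close> has_derivative_add[OF Ck_on_has_derivative Ck_on_has_derivative]])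
      (use Suc in \<open>auto intro!: Suc.IH\<close>)
qed

lemma Ck_on_bilinear:
  fixes prod :: "'a::real_normed_vector \<Rightarrow> 'b::real_normed_vector \<Rightarrow> 'c::real_normed_vector"
  assumes "bounded_bilinear prod" "open S" "Ck_on k S f" "Ck_on k S g"
  shows "Ck_on k S (\<lambda>x. prod (f x) (g x))"
  using assms(3,4)
proof (induction k arbitrary: f g)
  case 0
  then show ?case using bounded_bilinear.continuous_on[OF assms(1)] by auto
next
  case (Suc k)
  note C = Suc.prems[THEN Ck_on_Suc_D]
  show ?case
    by (rule Ck_on_SucI[OF \<open>open S\<close> bounded_bilinear.FDERIV[OF assms(1)
            Ck_on_has_derivative[OF Suc.prems(1)] Ck_on_has_derivative[OF Suc.prems(2)]]])
      (intro Ck_on_add \<open>open S\<close> Suc.IH C Ck_on_derivative Suc.prems | assumption)+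
qed

lemmas Ck_on_inner = Ck_on_bilinear[OF bounded_bilinear_inner]
lemmas Ck_on_scaleR = Ck_on_bilinear[OF bounded_bilinear_scaleR]
lemmas Ck_on_mult = Ck_on_bilinear[OF bounded_bilinear_mult]

lemma Ck_on_diff:
  assumes "open S" "Ck_on k S f" "Ck_on k S g"
  shows "Ck_on k S (\<lambda>x. f x - g x)"
  using Ck_on_add[OF assms(1,2) Ck_on_scaleR[OF assms(1) Ck_on_const[OF assms(1), of k "-1"] assms(3)]]
  by simp

lemma Ck_on_sum:
  assumes "open S" "\<And>i. i \<in> I \<Longrightarrow> Ck_on k S (f i)"
  shows "Ck_on k S (\<lambda>x. \<Sum>i\<in>I. f i x)"
  using assms(2) by (induction I rule: infinite_finite_induct) (auto intro: Ck_on_const Ck_on_add assms(1))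

lemma Ck_on_prod:
  fixes f :: "'i \<Rightarrow> 'a::real_normed_vector \<Rightarrow> real"
  assumes "open S" "\<And>i. i \<in> I \<Longrightarrow> Ck_on k S (f i)"
  shows "Ck_on k S (\<lambda>x. \<Prod>i\<in>I. f i x)"
  using assms(2) by (induction I rule: infinite_finite_induct) (auto intro: Ck_on_const Ck_on_mult assms(1))

lemma linear_expand_Basis:
  fixes v :: "'a::euclidean_space"
  assumes "linear L"
  shows "L v = (\<Sum>b\<in>Basis. (v \<bullet> b) *\<^sub>R L b)"
proof -
  have "L v = L (\<Sum>b\<in>Basis. (v \<bullet> b) *\<^sub>R b)" by (simp add: euclidean_representation)
  also have "\<dots> = (\<Sum>b\<in>Basis. (v \<bullet> b) *\<^sub>R L b)"
    using assms by (simp add: linear_sum linear_cmul)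
  finally show ?thesis .
qed

text \<open>
  The derivative of \<open>g \<circ> f\<close> expands over a basis of the space in between into products of partial
  derivatives of \<open>g\<close> at \<open>f x\<close> with components of the derivative of \<open>f\<close>; these are covered by the
  induction hypothesis and the product rule.
\<close>

lemma Ck_on_compose:
  fixes f :: "'a::real_normed_vector \<Rightarrow> 'b::euclidean_space" and g :: "'b \<Rightarrow> 'c::real_normed_vector"
  assumes "open S" "open T" "f ` S \<subseteq> T" "Ck_on k S f" "Ck_on k T g"
  shows "Ck_on k S (\<lambda>x. g (f x))"
  using assms(4,5)
proof (induction k arbitrary: g)
  case 0
  then show ?case using assms(3) by (auto intro: continuous_on_compose2)
next
  case (Suc k)
  have fT: "f x \<in> T" if "x \<in> S" for x using that assms(3) by auto
  let ?d = "\<lambda>x v. frechet_derivative g (at (f x)) (frechet_derivative f (at x) v)"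
  have der: "((\<lambda>x. g (f x)) has_derivative ?d x) (at x)" if "x \<in> S" for x
    using has_derivative_compose[OF Ck_on_has_derivative[OF Suc.prems(1) that]
        Ck_on_has_derivative[OF Suc.prems(2) fT[OF that]]] by simp
  show ?case
  proof (rule Ck_on_SucI[OF \<open>open S\<close> der])
    fix v
    have eq: "?d x v = (\<Sum>b\<in>Basis. (frechet_derivative f (at x) v \<bullet> b) *\<^sub>R frechet_derivative g (at (f x)) b)"
      if "x \<in> S" for x
      by (rule linear_expand_Basis[OF has_derivative_linear[OF
              Ck_on_has_derivative[OF Suc.prems(2) fT[OF that]]]])
    have "Ck_on k S (\<lambda>x. \<Sum>b\<in>Basis. (frechet_derivative f (at x) v \<bullet> b) *\<^sub>R frechet_derivative g (at (f x)) b)"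
      by (intro Ck_on_sum Ck_on_scaleR Ck_on_inner Ck_on_const assms(1) Suc.IH Ck_on_derivative Suc.prems
          Ck_on_Suc_D)
    from Ck_on_transform[OF assms(1) this eq] show "Ck_on k S (\<lambda>x. ?d x v)" .
  qed
qed

lemma Ck_on_inverse:
  fixes g :: "'a::real_normed_vector \<Rightarrow> real"
  assumes "open S" "Ck_on k S g" "\<And>x. x \<in> S \<Longrightarrow> g x \<noteq> 0"
  shows "Ck_on k S (\<lambda>x. inverse (g x))"
  using assms(2)
proof (induction k)
  case 0
  then show ?case using assms by (auto intro: continuous_intros)
next
  case (Suc k)
  let ?d = "\<lambda>x v. (-1) * (inverse (g x) * frechet_derivative g (at x) v * inverse (g x))"
  have der: "((\<lambda>x. inverse (g x)) has_derivative ?d x) (at x)" if "x \<in> S" for x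
    using Deriv.has_derivative_inverse[OF assms(3)[OF that] Ck_on_has_derivative[OF Suc.prems that]] by simp
  show ?case
    using Suc Ck_on_Suc_D[OF Suc.prems]
    by (intro Ck_on_SucI[OF \<open>open S\<close> der] Ck_on_mult Ck_on_const assms(1) Suc.IH)
      (auto dest: Ck_on_derivative)
qed

lemma Ck_on_vec_lambda:
  fixes f :: "'i::finite \<Rightarrow> 'a::real_normed_vector \<Rightarrow> real"
  assumes "open S" "\<And>i. Ck_on k S (f i)"
  shows "Ck_on k S (\<lambda>x. \<chi> i. f i x)"
proof -
  have "(\<chi> i. f i x) = (\<Sum>i\<in>UNIV. f i x *\<^sub>R axis i 1)" for x
    by (simp add: vec_eq_iff axis_def if_distrib cong: if_cong)
  moreover have "Ck_on k S (\<lambda>x. \<Sum>i\<in>UNIV. f i x *\<^sub>R axis i (1::real))"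
    by (intro Ck_on_sum Ck_on_scaleR Ck_on_const assms)
  ultimately show ?thesis by simp
qed

lemma Ck_on_det:
  fixes A :: "'a::real_normed_vector \<Rightarrow> real^'n^'n"
  assumes "open S" "\<And>i j. Ck_on k S (\<lambda>x. A x $ i $ j)"
  shows "Ck_on k S (\<lambda>x. det (A x))"
  unfolding det_def by (intro Ck_on_sum Ck_on_mult Ck_on_prod Ck_on_const assms)

text \<open>
  Cramer's rule writes \<open>u\<close> as a polynomial in the entries of \<open>A\<close>, in \<open>b\<close> and in \<open>1 / det A\<close>.
\<close>

lemma Ck_on_linear_solve:
  fixes A :: "'a::real_normed_vector \<Rightarrow> real^'n^'n" and u b :: "'a \<Rightarrow> real^'n"
  assumes "open S" "\<And>i j. Ck_on k S (\<lambda>x. A x $ i $ j)" "Ck_on k S b"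
    and "\<And>x. x \<in> S \<Longrightarrow> det (A x) \<noteq> 0" "\<And>x. x \<in> S \<Longrightarrow> A x *v u x = b x"
  shows "Ck_on k S u"
proof -
  let ?c = "\<lambda>x. \<chi> l. det (\<chi> i j. if j = l then b x $ i else A x $ i $ j) * inverse (det (A x))"
  have eq: "u x = ?c x" if "x \<in> S" for x
    using cramer[OF assms(4)[OF that], of "u x" "b x"] assms(5)[OF that] by (simp add: divide_inverse)
  have "Ck_on k S ?c"
  proof (intro Ck_on_vec_lambda Ck_on_mult Ck_on_det Ck_on_inverse assms)
    fix l i j :: 'n
    have "Ck_on k S (\<lambda>x. b x \<bullet> axis i 1)" by (intro Ck_on_inner Ck_on_const assms)
    then show "Ck_on k S (\<lambda>x. (\<chi> i j. if j = l then b x $ i else A x $ i $ j) $ i $ j)"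
      using assms(2)[of i j] by (cases "j = l") (simp_all add: inner_axis)
  qed
  from Ck_on_transform[OF assms(1) this eq] show ?thesis .
qed

text \<open>
  Schwarz's theorem: by two applications of the mean value theorem the second difference over a
  parallelogram of side \<open>h\<close> is \<open>h * h\<close> times a value of either mixed derivative near \<open>x\<close>, and \<open>h\<close> tends
  to \<open>0\<close>.
\<close>

lemma second_derivative_symmetric_real:
  fixes f :: "'a::real_normed_vector \<Rightarrow> real"
  assumes "open S" "Ck_on 2 S f" "x \<in> S"
  shows "frechet_derivative (\<lambda>y. frechet_derivative f (at y) u) (at x) v =
    frechet_derivative (\<lambda>y. frechet_derivative f (at y) v) (at x) u"
proof -
  define D where "D = (\<lambda>y v. frechet_derivative f (at y) v)"
  define D2 where "D2 = (\<lambda>u v y. frechet_derivative (\<lambda>y. D y u) (at y) v)"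
  have C: "Ck_on (Suc (Suc 0)) S f" using assms(2) by (simp add: numeral_2_eq_2)
  have df: "(f has_derivative D y) (at y)" if "y \<in> S" for y
    unfolding D_def using Ck_on_has_derivative[OF C that] by simp
  have dD: "((\<lambda>y. D y u) has_derivative (\<lambda>v. D2 u v y)) (at y)" if "y \<in> S" for y u
    unfolding D_def D2_def using Ck_on_has_derivative[OF Ck_on_derivative[OF C] that] by simp
  have cD2: "continuous_on S (D2 u v)" for u v
    using Ck_on_derivative[OF Ck_on_derivative[OF C, of u], of v] unfolding D_def D2_def by simp
  \<comment> \<open>The second difference over a small parallelogram is a value of either mixed derivative.\<close>
  have key: "\<exists>s\<in>{0<..<h}. \<exists>t\<in>{0<..<h}.
      f (x + h *\<^sub>R u + h *\<^sub>R v) - f (x + h *\<^sub>R u) - f (x + h *\<^sub>R v) + f x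
        = h * h * D2 u v (x + s *\<^sub>R u + t *\<^sub>R v)"
    if "h > 0" and inS: "\<And>s t. 0 \<le> s \<Longrightarrow> s \<le> h \<Longrightarrow> 0 \<le> t \<Longrightarrow> t \<le> h \<Longrightarrow> x + s *\<^sub>R u + t *\<^sub>R v \<in> S"
    for h u v
  proof -
    let ?g = "\<lambda>s. f (x + s *\<^sub>R u + h *\<^sub>R v) - f (x + s *\<^sub>R u)"
    have dg: "(?g has_real_derivative D (x + s *\<^sub>R u + h *\<^sub>R v) u - D (x + s *\<^sub>R u) u) (at s)"
      if "0 \<le> s" "s \<le> h" for s
    proof -
      have "(?g has_derivative (\<lambda>r. D (x + s *\<^sub>R u + h *\<^sub>R v) (r *\<^sub>R u) - D (x + s *\<^sub>R u) (r *\<^sub>R u))) (at s)"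
        using inS[of s h] inS[of s 0] that \<open>h > 0\<close>
        by (intro has_derivative_diff has_derivative_compose[OF _ df]) (auto intro!: derivative_eq_intros)
      moreover have "D y (r *\<^sub>R u) = r * D y u" if "y \<in> S" for y r
        using linear_cmul[OF has_derivative_linear[OF df[OF that]]] by simp
      then have "(\<lambda>r. D (x + s *\<^sub>R u + h *\<^sub>R v) (r *\<^sub>R u) - D (x + s *\<^sub>R u) (r *\<^sub>R u))
          = (*) (D (x + s *\<^sub>R u + h *\<^sub>R v) u - D (x + s *\<^sub>R u) u)"
        using inS[of s h] inS[of s 0] that \<open>h > 0\<close> by (auto simp: fun_eq_iff algebra_simps)
      ultimately show ?thesis by (simp add: has_field_derivative_def)
    qed
    obtain s where s: "0 < s" "s < h" "?g h - ?g 0 = h * (D (x + s *\<^sub>R u + h *\<^sub>R v) u - D (x + s *\<^sub>R u) u)"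
      using MVT2[OF \<open>h > 0\<close> dg] by auto
    have dk: "((\<lambda>t. D (x + s *\<^sub>R u + t *\<^sub>R v) u) has_real_derivative D2 u v (x + s *\<^sub>R u + t *\<^sub>R v)) (at t)"
      if "0 \<le> t" "t \<le> h" for t
    proof -
      have m: "x + s *\<^sub>R u + t *\<^sub>R v \<in> S" using inS[of s t] s that by auto
      have "((\<lambda>t. D (x + s *\<^sub>R u + t *\<^sub>R v) u) has_derivative (\<lambda>r. D2 u (r *\<^sub>R v) (x + s *\<^sub>R u + t *\<^sub>R v))) (at t)"
        by (rule has_derivative_compose[of "\<lambda>t. x + s *\<^sub>R u + t *\<^sub>R v" "\<lambda>r. r *\<^sub>R v" t UNIV
              "\<lambda>y. D y u" "\<lambda>r. D2 u r (x + s *\<^sub>R u + t *\<^sub>R v)"])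
          (use dD[OF m, of u] in \<open>auto intro!: derivative_eq_intros\<close>)
      moreover have "D2 u (r *\<^sub>R v) (x + s *\<^sub>R u + t *\<^sub>R v) = D2 u v (x + s *\<^sub>R u + t *\<^sub>R v) * r" for r
        using linear_cmul[OF has_derivative_linear[OF dD[OF m]]] by simp
      ultimately show ?thesis by (simp add: has_field_derivative_def)
    qed
    obtain t where t: "0 < t" "t < h"
      "D (x + s *\<^sub>R u + h *\<^sub>R v) u - D (x + s *\<^sub>R u + 0 *\<^sub>R v) u = h * D2 u v (x + s *\<^sub>R u + t *\<^sub>R v)"
      using MVT2[OF \<open>h > 0\<close> dk] by auto
    show ?thesis
      by (rule bexI[of _ s], rule bexI[of _ t]) (use s t in auto)
  qed
  have "\<bar>D2 u v x - D2 v u x\<bar> \<le> e" if "e > 0" for e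
  proof -
    obtain d1 where d1: "d1 > 0" "\<And>y. y \<in> S \<Longrightarrow> dist y x < d1 \<Longrightarrow> dist (D2 u v y) (D2 u v x) < e/2"
      using cD2[of u v] \<open>x \<in> S\<close> \<open>e > 0\<close> unfolding continuous_on_iff by (metis half_gt_zero)
    obtain d2 where d2: "d2 > 0" "\<And>y. y \<in> S \<Longrightarrow> dist y x < d2 \<Longrightarrow> dist (D2 v u y) (D2 v u x) < e/2"
      using cD2[of v u] \<open>x \<in> S\<close> \<open>e > 0\<close> unfolding continuous_on_iff by (metis half_gt_zero)
    obtain d3 where d3: "d3 > 0" "ball x d3 \<subseteq> S" using assms open_contains_ball by metis
    define d where "d = min d1 (min d2 d3)"
    define h where "h = d / (2 * (norm u + norm v + 1))"
    have "d > 0" unfolding d_def using d1 d2 d3 by auto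
    have pos: "norm u + norm v + 1 > 0" by (smt (verit) norm_ge_zero)
    then have "h > 0" using \<open>d > 0\<close> by (simp add: h_def)
    have close: "dist (x + s *\<^sub>R u + t *\<^sub>R v) x < d" if "0 \<le> s" "s \<le> h" "0 \<le> t" "t \<le> h" for s t
    proof -
      have "dist (x + s *\<^sub>R u + t *\<^sub>R v) x \<le> s * norm u + t * norm v"
        using that norm_triangle_ineq[of "s *\<^sub>R u" "t *\<^sub>R v"] by (simp add: dist_norm add.assoc)
      also have "\<dots> \<le> h * norm u + h * norm v" using that by (intro add_mono mult_right_mono) auto
      also have "\<dots> \<le> h * (norm u + norm v + 1)" using \<open>h > 0\<close> by (simp add: algebra_simps)
      also have "\<dots> = d / 2" using pos by (simp add: h_def field_simps)
      finally show ?thesis using \<open>d > 0\<close> by simp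
    qed
    have close': "dist (x + s *\<^sub>R v + t *\<^sub>R u) x < d" if "0 \<le> s" "s \<le> h" "0 \<le> t" "t \<le> h" for s t
      using close[of t s] that by (simp add: algebra_simps)
    have inS: "x + s *\<^sub>R u + t *\<^sub>R v \<in> S" "x + s *\<^sub>R v + t *\<^sub>R u \<in> S"
      if "0 \<le> s" "s \<le> h" "0 \<le> t" "t \<le> h" for s t
      using close[OF that] close'[OF that] d3 by (auto simp: d_def dist_commute)
    obtain s t where 1: "s \<in> {0<..<h}" "t \<in> {0<..<h}"
      "f (x + h *\<^sub>R u + h *\<^sub>R v) - f (x + h *\<^sub>R u) - f (x + h *\<^sub>R v) + f x
        = h * h * D2 u v (x + s *\<^sub>R u + t *\<^sub>R v)"
      using key[OF \<open>h > 0\<close>, of u v] inS(1) by metis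
    obtain s' t' where 2: "s' \<in> {0<..<h}" "t' \<in> {0<..<h}"
      "f (x + h *\<^sub>R v + h *\<^sub>R u) - f (x + h *\<^sub>R v) - f (x + h *\<^sub>R u) + f x
        = h * h * D2 v u (x + s' *\<^sub>R v + t' *\<^sub>R u)"
      using key[OF \<open>h > 0\<close>, of v u] inS(2) by metis
    have swap: "x + h *\<^sub>R v + h *\<^sub>R u = x + h *\<^sub>R u + h *\<^sub>R v" by (simp add: algebra_simps)
    have "h * h * D2 u v (x + s *\<^sub>R u + t *\<^sub>R v) = h * h * D2 v u (x + s' *\<^sub>R v + t' *\<^sub>R u)"
      using 1(3) 2(3)[unfolded swap] by linarith
    then have eq: "D2 u v (x + s *\<^sub>R u + t *\<^sub>R v) = D2 v u (x + s' *\<^sub>R v + t' *\<^sub>R u)"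
      using \<open>h > 0\<close> by simp
    have "dist (D2 u v (x + s *\<^sub>R u + t *\<^sub>R v)) (D2 u v x) < e/2"
      using d1(2)[OF inS(1)[of s t]] close[of s t] 1(1,2) by (auto simp: d_def)
    moreover have "dist (D2 v u (x + s' *\<^sub>R v + t' *\<^sub>R u)) (D2 v u x) < e/2"
      using d2(2)[OF inS(2)[of s' t']] close'[of s' t'] 2(1,2) by (auto simp: d_def)
    ultimately show ?thesis using eq by (auto simp: dist_real_def abs_if split: if_splits)
  qed
  then have "D2 u v x = D2 v u x" using field_le_epsilon[of "\<bar>D2 u v x - D2 v u x\<bar>" 0] by auto
  then show ?thesis by (simp add: D2_def D_def)
qed

lemma second_derivative_symmetric:
  fixes f :: "'a::real_normed_vector \<Rightarrow> 'b::euclidean_space"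
  assumes "open S" "Ck_on 2 S f" "x \<in> S"
  shows "frechet_derivative (\<lambda>y. frechet_derivative f (at y) u) (at x) v =
    frechet_derivative (\<lambda>y. frechet_derivative f (at y) v) (at x) u"
proof (rule euclidean_eqI)
  fix b :: 'b assume "b \<in> Basis"
  have C: "Ck_on (Suc (Suc 0)) S f" using assms(2) by (simp add: numeral_2_eq_2)
  have 1: "frechet_derivative (\<lambda>y. f y \<bullet> b) (at y) = (\<lambda>u. frechet_derivative f (at y) u \<bullet> b)"
    if "y \<in> S" for y
    by (rule frechet_derivative_at[OF has_derivative_inner_left[OF Ck_on_has_derivative[OF C that]], symmetric])
  have 2: "frechet_derivative (\<lambda>y. frechet_derivative (\<lambda>y. f y \<bullet> b) (at y) u) (at x) v
    = frechet_derivative (\<lambda>y. frechet_derivative f (at y) u) (at x) v \<bullet> b" for u v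
  proof -
    have "((\<lambda>y. frechet_derivative f (at y) u \<bullet> b) has_derivative
        (\<lambda>v. frechet_derivative (\<lambda>y. frechet_derivative f (at y) u) (at x) v \<bullet> b)) (at x)"
      by (intro has_derivative_inner_left Ck_on_has_derivative[OF Ck_on_derivative[OF C] assms(3)])
    then have "((\<lambda>y. frechet_derivative (\<lambda>y. f y \<bullet> b) (at y) u) has_derivative
        (\<lambda>v. frechet_derivative (\<lambda>y. frechet_derivative f (at y) u) (at x) v \<bullet> b)) (at x)"
      by (rule has_derivative_transform_within_open[OF _ assms(1,3)]) (simp add: 1)
    from frechet_derivative_at[OF this, symmetric] show ?thesis by (rule fun_cong)
  qed
  have "Ck_on 2 S (\<lambda>y. f y \<bullet> b)" by (intro Ck_on_inner Ck_on_const assms)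
  from second_derivative_symmetric_real[OF assms(1) this assms(3), of u v]
  show "frechet_derivative (\<lambda>y. frechet_derivative f (at y) u) (at x) v \<bullet> b =
    frechet_derivative (\<lambda>y. frechet_derivative f (at y) v) (at x) u \<bullet> b"
    by (simp add: 2)
qed

section \<open>Foot points on an immersed patch\<close>

lemma has_derivative_vec_lambda:
  fixes f :: "'i::finite \<Rightarrow> 'a::real_normed_vector \<Rightarrow> real"
  assumes "\<And>i. (f i has_derivative f' i) F"
  shows "((\<lambda>x. \<chi> i. f i x) has_derivative (\<lambda>h. \<chi> i. f' i h)) F"
proof -
  have eq: "(\<chi> i. g i) = (\<Sum>i\<in>UNIV. g i *\<^sub>R axis i 1)" for g :: "'i \<Rightarrow> real"
    by (simp add: vec_eq_iff axis_def if_distrib cong: if_cong)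
  show ?thesis unfolding eq by (intro derivative_intros assms)
qed

locale local_immersion =
  fixes S :: "(real^'m) set" and f :: "real^'m \<Rightarrow> real^'q"
  assumes open_S: "open S" and smooth: "\<And>k. Ck_on k S f"
    and inj: "\<And>x. x \<in> S \<Longrightarrow> inj (frechet_derivative f (at x))"
begin

definition Df :: "real^'m \<Rightarrow> real^'m \<Rightarrow> real^'q" where
  "Df x u = frechet_derivative f (at x) u"

definition D2f :: "real^'m \<Rightarrow> real^'m \<Rightarrow> real^'m \<Rightarrow> real^'q" where
  "D2f x u v = frechet_derivative (\<lambda>x. Df x u) (at x) v"

lemma Df_Ck: "Ck_on k S (\<lambda>x. Df x u)"
  unfolding Df_def by (rule Ck_on_derivative[OF smooth])

lemma D2f_Ck: "Ck_on k S (\<lambda>x. D2f x u v)"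
  unfolding D2f_def by (rule Ck_on_derivative[OF Df_Ck])

lemma f_has_derivative: "x \<in> S \<Longrightarrow> (f has_derivative Df x) (at x)"
  using Ck_on_has_derivative[OF smooth[of "Suc 0"]] by (simp add: Df_def[abs_def])

lemma Df_has_derivative: "x \<in> S \<Longrightarrow> ((\<lambda>x. Df x u) has_derivative D2f x u) (at x)"
  using Ck_on_has_derivative[OF Df_Ck[of "Suc 0"]] by (simp add: D2f_def[abs_def])

lemma Df_linear: "x \<in> S \<Longrightarrow> linear (Df x)"
  by (rule has_derivative_linear[OF f_has_derivative])

lemma D2f_linear: "x \<in> S \<Longrightarrow> linear (D2f x u)"
  by (rule has_derivative_linear[OF Df_has_derivative])

lemma Df_eq_0_iff: "x \<in> S \<Longrightarrow> Df x u = 0 \<longleftrightarrow> u = 0"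
  using inj[of x] linear_injective_0[OF Df_linear, of x] Df_linear[of x] by (auto simp: Df_def[abs_def] linear_0)

text \<open>
  The gradient, in the coordinates \<open>x\<close>, of half the squared distance between \<open>f x\<close> and \<open>w\<close>. It vanishes
  if \<open>f x\<close> is the foot of a perpendicular from \<open>w\<close>.
\<close>

definition foot_defect :: "real^'m \<Rightarrow> real^'q \<Rightarrow> real^'m" where
  "foot_defect x w = (\<chi> i. Df x (axis i 1) \<bullet> (f x - w))"

lemma foot_defect_eq_0_iff:
  assumes "x \<in> S"
  shows "foot_defect x w = 0 \<longleftrightarrow> (\<forall>u. Df x u \<bullet> (f x - w) = 0)"
proof
  assume 0: "foot_defect x w = 0"
  show "\<forall>u. Df x u \<bullet> (f x - w) = 0"
  proof
    fix u :: "real^'m"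
    have "Df x u = (\<Sum>b\<in>Basis. (u \<bullet> b) *\<^sub>R Df x b)" by (rule linear_expand_Basis[OF Df_linear[OF assms]])
    moreover have "Df x b \<bullet> (f x - w) = 0" if b: "b \<in> Basis" for b
    proof -
      obtain i where i: "b = axis i 1" using b by (auto simp: Basis_vec_def)
      have "foot_defect x w $ i = 0" using 0 by simp
      then show ?thesis by (simp add: foot_defect_def i)
    qed
    ultimately show "Df x u \<bullet> (f x - w) = 0" by (simp add: inner_sum_left)
  qed
qed (simp add: foot_defect_def vec_eq_iff)

text \<open>
  The Hessian of half the squared distance to \<open>w\<close>. At \<open>w = f x\<close> it is the Gram matrix of the coordinate
  tangent vectors, which is invertible because \<open>f\<close> is an immersion.
\<close>

definition foot_hessian :: "real^'m \<Rightarrow> real^'q \<Rightarrow> real^'m^'m" where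
  "foot_hessian x w = (\<chi> i j. Df x (axis i 1) \<bullet> Df x (axis j 1) + D2f x (axis i 1) (axis j 1) \<bullet> (f x - w))"

lemma foot_hessian_mult:
  assumes "x \<in> S"
  shows "(foot_hessian x w *v u) $ i = Df x (axis i 1) \<bullet> Df x u + D2f x (axis i 1) u \<bullet> (f x - w)"
proof -
  have u: "u = (\<Sum>j\<in>UNIV. (u $ j) *\<^sub>R axis j 1)"
    by (simp add: vec_eq_iff axis_def if_distrib cong: if_cong)
  have 1: "Df x u = (\<Sum>j\<in>UNIV. (u $ j) *\<^sub>R Df x (axis j 1))"
    by (subst u) (simp add: linear_sum[OF Df_linear[OF assms]] linear_cmul[OF Df_linear[OF assms]])
  have 2: "D2f x (axis i 1) u = (\<Sum>j\<in>UNIV. (u $ j) *\<^sub>R D2f x (axis i 1) (axis j 1))"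
    by (subst u) (simp add: linear_sum[OF D2f_linear[OF assms]] linear_cmul[OF D2f_linear[OF assms]])
  show ?thesis
    unfolding 1 2 by (simp add: foot_hessian_def matrix_vector_mult_def inner_sum_left inner_sum_right
        distrib_left distrib_right sum.distrib mult.commute)
qed

lemma foot_defect_has_derivative:
  assumes "x \<in> S"
  shows "((\<lambda>z. foot_defect (fst z) (snd z)) has_derivative
    (\<lambda>h. foot_hessian x w *v fst h - (\<chi> i. Df x (axis i 1) \<bullet> snd h))) (at (x, w))"
proof -
  have "((\<lambda>z. foot_defect (fst z) (snd z)) has_derivative
    (\<lambda>h. \<chi> i. Df x (axis i 1) \<bullet> (Df x (fst h) - snd h) + D2f x (axis i 1) (fst h) \<bullet> (f x - w))) (at (x, w))"
    unfolding foot_defect_def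
  proof (rule has_derivative_vec_lambda)
    fix i
    have 1: "((\<lambda>z. Df (fst z) (axis i 1)) has_derivative (\<lambda>h. D2f x (axis i 1) (fst h))) (at (x, w))"
      by (rule has_derivative_compose[of fst fst "(x, w)" UNIV "\<lambda>x. Df x (axis i 1)" "D2f x (axis i 1)"])
        (use Df_has_derivative[OF assms] in \<open>auto intro!: derivative_eq_intros\<close>)
    have 2: "((\<lambda>z. f (fst z) - snd z) has_derivative (\<lambda>h. Df x (fst h) - snd h)) (at (x, w))"
      by (intro has_derivative_diff has_derivative_compose[of fst fst "(x, w)" UNIV f "Df x"])
        (use f_has_derivative[OF assms] in \<open>auto intro!: derivative_eq_intros\<close>)
    show "((\<lambda>z. Df (fst z) (axis i 1) \<bullet> (f (fst z) - snd z)) has_derivative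
       (\<lambda>h. Df x (axis i 1) \<bullet> (Df x (fst h) - snd h) + D2f x (axis i 1) (fst h) \<bullet> (f x - w))) (at (x, w))"
      using has_derivative_inner[OF 1 2] by simp
  qed
  moreover have "(\<chi> i. Df x (axis i 1) \<bullet> (Df x (fst h) - snd h) + D2f x (axis i 1) (fst h) \<bullet> (f x - w))
      = foot_hessian x w *v fst h - (\<chi> i. Df x (axis i 1) \<bullet> snd h)" for h :: "(real^'m) \<times> (real^'q)"
    by (simp add: vec_eq_iff foot_hessian_mult[OF assms] inner_diff_right)
  ultimately show ?thesis by simp
qed

text \<open>
  With \<open>w\<close> kept as a second component, solving \<open>foot_defect x w = 0\<close> for \<open>x\<close> means inverting a map
  between spaces of the same dimension, as the inverse function theorem requires.
\<close>

definition extended_defect :: "(real^'m) \<times> (real^'q) \<Rightarrow> (real^'m) \<times> (real^'q)" where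
  "extended_defect z = (foot_defect (fst z) (snd z), snd z)"

definition D_extended_defect :: "(real^'m) \<times> (real^'q) \<Rightarrow> (real^'m) \<times> (real^'q) \<Rightarrow> (real^'m) \<times> (real^'q)" where
  "D_extended_defect z h =
     (foot_hessian (fst z) (snd z) *v fst h - (\<chi> i. Df (fst z) (axis i 1) \<bullet> snd h), snd h)"

lemma extended_defect_has_derivative:
  assumes "fst z \<in> S"
  shows "(extended_defect has_derivative D_extended_defect z) (at z)"
proof -
  obtain x w where z: "z = (x, w)" by force
  have "((\<lambda>z. (foot_defect (fst z) (snd z), snd z)) has_derivative
    (\<lambda>h. (foot_hessian x w *v fst h - (\<chi> i. Df x (axis i 1) \<bullet> snd h), snd h))) (at (x, w))"
    using assms by (intro has_derivative_Pair foot_defect_has_derivative derivative_intros) (simp add: z)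
  then show ?thesis by (simp add: extended_defect_def[abs_def] D_extended_defect_def[abs_def] z)
qed

lemma D_extended_defect_continuous: "continuous_on (S \<times> UNIV) (\<lambda>z. D_extended_defect z h)"
proof -
  have 1: "continuous_on (S \<times> UNIV) (\<lambda>z. g (fst z))" if "continuous_on S g" for g :: "real^'m \<Rightarrow> real^'q"
    using that by (rule continuous_on_compose2) (auto intro: continuous_intros)
  have 2: "continuous_on S (\<lambda>x. Df x u)" "continuous_on S (\<lambda>x. D2f x u v)" "continuous_on S f" for u v
    using Df_Ck D2f_Ck smooth by (auto intro: Ck_on_imp_continuous_on)
  show ?thesis
    unfolding D_extended_defect_def foot_hessian_def matrix_vector_mult_def
    by (intro continuous_intros) (auto intro!: continuous_intros 1[OF 2(1)] 1[OF 2(2)] 1[OF 2(3)])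
qed

lemma D_extended_defect_injective:
  assumes "x \<in> S" "D_extended_defect (x, f x) h = 0"
  shows "h = 0"
proof -
  have snd: "snd h = 0" using assms(2) by (simp add: D_extended_defect_def prod_eq_iff)
  moreover have "(0 :: real^'m) = (\<chi> i. 0)" by (simp add: vec_eq_iff)
  ultimately have 0: "foot_hessian x (f x) *v fst h = 0"
    using assms(2) by (simp add: D_extended_defect_def prod_eq_iff)
  have "Df x b \<bullet> Df x (fst h) = 0" if bB: "b \<in> Basis" for b
  proof -
    obtain i where b: "b = axis i 1" using bB by (auto simp: Basis_vec_def)
    have "(foot_hessian x (f x) *v fst h) $ i = 0" by (simp add: 0)
    then show ?thesis by (simp add: foot_hessian_mult[OF assms(1)] b)
  qed
  then have "Df x (fst h) \<bullet> Df x (fst h) = 0"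
    by (subst (1) linear_expand_Basis[OF Df_linear[OF assms(1)]]) (simp add: inner_sum_left)
  then have "fst h = 0" using Df_eq_0_iff[OF assms(1)] by simp
  then show ?thesis using snd by (simp add: prod_eq_iff)
qed

text \<open>
  The implicit function theorem for \<open>foot_defect x w = 0\<close> near \<open>(x0, f x0)\<close>. The inverse function theorem
  provides a differentiable solution \<open>y\<close>. Its derivative solves a linear system whose coefficients are
  smooth functions of \<open>y w\<close> and \<open>w\<close>, so each order of differentiability of \<open>y\<close> yields the next one.
\<close>

theorem smooth_foot_point:
  assumes x0: "x0 \<in> S"
  obtains s k W y where "s > 0" "k > 0" "ball x0 s \<subseteq> S"
    "\<And>w x x'. \<lbrakk>w \<in> ball (f x0) k; x \<in> ball x0 s; x' \<in> ball x0 s; foot_defect x w = 0; foot_defect x' w = 0\<rbrakk> \<Longrightarrow> x = x'"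
    "open W" "W = {w \<in> ball (f x0) k. \<exists>x\<in>ball x0 s. foot_defect x w = 0}"
    "\<And>w. w \<in> W \<Longrightarrow> y w \<in> ball x0 s \<and> foot_defect (y w) w = 0"
    "\<And>j. Ck_on j W y"
proof -
  let ?z0 = "(x0, f x0)"
  define \<Psi>' where "\<Psi>' z = Blinfun (D_extended_defect z)" for z
  have bl: "bounded_linear (D_extended_defect z)" if "fst z \<in> S" for z
    by (rule has_derivative_bounded_linear[OF extended_defect_has_derivative[OF that]])
  have app: "blinfun_apply (\<Psi>' z) = D_extended_defect z" if "fst z \<in> S" for z
    unfolding \<Psi>'_def by (rule bounded_linear_Blinfun_apply[OF bl[OF that]])
  have "linear (D_extended_defect ?z0)" using bl[of ?z0] x0 by (simp add: bounded_linear.linear)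
  moreover from this have "inj (D_extended_defect ?z0)"
    using D_extended_defect_injective[OF x0] by (simp add: linear_injective_0)
  ultimately obtain G where G: "linear G" "G \<circ> D_extended_defect ?z0 = id"
    using linear_injective_left_inverse by blast
  have invf: "Blinfun G o\<^sub>L \<Psi>' ?z0 = id_blinfun"
  proof (rule blinfun_eqI)
    fix i
    have "G (D_extended_defect ?z0 i) = i" using fun_cong[OF G(2), of i] by simp
    then show "(Blinfun G o\<^sub>L \<Psi>' ?z0) i = id_blinfun i"
      using G(1) x0 by (simp add: app bounded_linear_Blinfun_apply linear_conv_bounded_linear)
  qed
  have opn: "open (S \<times> (UNIV :: (real^'q) set))" using open_S by (simp add: open_Times)
  have cont: "continuous_on (S \<times> UNIV) \<Psi>'"
  proof (rule continuous_on_blinfun_componentwise)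
    fix i :: "(real^'m) \<times> (real^'q)"
    show "continuous_on (S \<times> UNIV) (\<lambda>z. blinfun_apply (\<Psi>' z) i)"
      using D_extended_defect_continuous[of i] by (rule continuous_on_eq) (auto simp: app)
  qed
  obtain U' V g g' where U': "open U'" "U' \<subseteq> S \<times> UNIV" "?z0 \<in> U'" and V: "open V"
    and hom: "homeomorphism U' V extended_defect g"
    and g: "\<And>z. z \<in> V \<Longrightarrow> (g has_derivative (g' z)) (at z)"
      "\<And>z. z \<in> V \<Longrightarrow> g' z = inv_into UNIV (blinfun_apply (\<Psi>' (g z)))"
      "\<And>z. z \<in> V \<Longrightarrow> bij (blinfun_apply (\<Psi>' (g z)))"
  proof (rule inverse_function_theorem[OF opn _ cont _ invf])
    show "(extended_defect has_derivative blinfun_apply (\<Psi>' z)) (at z)" if "z \<in> S \<times> UNIV" for z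
      using that extended_defect_has_derivative[of z] app[of z] by auto
  qed (use x0 in auto)
  have gU: "g z \<in> U'" "extended_defect (g z) = z" if "z \<in> V" for z
    using hom that by (auto simp: homeomorphism_def)
  have gE: "g (extended_defect z) = z" "extended_defect z \<in> V" if "z \<in> U'" for z
    using hom that by (auto simp: homeomorphism_def)
  obtain A B where AB: "open A" "open B" "?z0 \<in> A \<times> B" "A \<times> B \<subseteq> U'"
    using U'(1,3) by (metis open_prod_elim)
  have "x0 \<in> A" "f x0 \<in> B" using AB(3) by auto
  then obtain s k where s: "s > 0" "ball x0 s \<subseteq> A" and k: "k > 0" "ball (f x0) k \<subseteq> B"
    using AB(1,2) by (meson open_contains_ball)
  have box: "(x, w) \<in> U'" if "x \<in> ball x0 s" "w \<in> ball (f x0) k" for x w using that s k AB by blast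
  have AS: "ball x0 s \<subseteq> S"
  proof
    fix x assume "x \<in> ball x0 s"
    then have "(x, f x0) \<in> U'" using box k(1) by simp
    then show "x \<in> S" using U'(2) by blast
  qed
  \<comment> \<open>The solution is the first component of the inverse map on the slice where the defect vanishes.\<close>
  define y where "y w = fst (g (0, w))" for w
  define W where "W = {w \<in> ball (f x0) k. \<exists>x\<in>ball x0 s. foot_defect x w = 0}"
  have sol: "(0, w) \<in> V \<and> g (0, w) = (x, w)" if "x \<in> ball x0 s" "w \<in> ball (f x0) k" "foot_defect x w = 0" for x w
    using gE[OF box[OF that(1,2)]] that(3) by (simp add: extended_defect_def)
  have gy: "g (0, w) = (y w, w)" "foot_defect (y w) w = 0" if "(0, w) \<in> V" for w
    using gU(2)[OF that] by (auto simp: extended_defect_def y_def prod_eq_iff)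
  let ?V0 = "{w. (0, w) \<in> V}"
  have V0: "open ?V0"
    using continuous_open_vimage[of V "\<lambda>w. (0, w)"] V by (simp add: vimage_def continuous_intros)
  have yder: "(y has_derivative (\<lambda>v. fst (g' (0, w) (0, v)))) (at w)" if "(0, w) \<in> V" for w
  proof -
    have "((\<lambda>w. g (0, w)) has_derivative (\<lambda>v. g' (0, w) (0, v))) (at w)"
      by (rule has_derivative_compose[of "\<lambda>w. (0, w)" "\<lambda>v. (0, v)" w UNIV g "g' (0, w)"])
        (use g(1)[OF that] in \<open>auto intro!: derivative_eq_intros\<close>)
    then show ?thesis unfolding y_def by (rule has_derivative_fst)
  qed
  have ycont: "continuous_on ?V0 y"
    by (rule has_derivative_continuous_on[OF has_derivative_at_withinI[OF yder]]) simp
  have Weq: "W = ball (f x0) k \<inter> (?V0 \<inter> y -` ball x0 s)"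
  proof (intro equalityI subsetI)
    fix w assume "w \<in> W"
    then obtain x where x: "w \<in> ball (f x0) k" "x \<in> ball x0 s" "foot_defect x w = 0"
      unfolding W_def by blast
    then show "w \<in> ball (f x0) k \<inter> (?V0 \<inter> y -` ball x0 s)"
      using sol[OF x(2,1,3)] by (simp add: y_def)
  next
    fix w assume "w \<in> ball (f x0) k \<inter> (?V0 \<inter> y -` ball x0 s)"
    then show "w \<in> W" unfolding W_def using gy(2)[of w] by auto
  qed
  have "open W" unfolding Weq by (intro open_Int open_ball continuous_open_preimage[OF ycont V0])
  have WV: "(0, w) \<in> V" "y w \<in> ball x0 s" "y w \<in> S" if "w \<in> W" for w using that AS by (auto simp: Weq)
  define A where "A w = foot_hessian (y w) w" for w
  have bij: "bij (D_extended_defect (y w, w))" if "w \<in> W" for w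
    using g(3)[OF WV(1)[OF that]] gy(1)[OF WV(1)[OF that]] app[of "(y w, w)"] WV(3)[OF that] by simp
  have solve: "A w *v fst (g' (0, w) (0, v)) = (\<chi> i. Df (y w) (axis i 1) \<bullet> v)" if "w \<in> W" for w v
  proof -
    let ?h = "g' (0, w) (0, v)"
    have "D_extended_defect (y w, w) ?h = (0, v)"
      using g(2)[OF WV(1)[OF that]] gy(1)[OF WV(1)[OF that]] app[of "(y w, w)"] WV(3)[OF that]
        bij[OF that] by (simp add: bij_is_surj surj_f_inv_f)
    then show ?thesis by (simp add: D_extended_defect_def A_def)
  qed
  have det: "det (A w) \<noteq> 0" if "w \<in> W" for w
  proof -
    have "u = 0" if "A w *v u = 0" for u
    proof -
      have "(0 :: real^'m) = (\<chi> i. 0)" by (simp add: vec_eq_iff)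
      then have "D_extended_defect (y w, w) (u, 0) = D_extended_defect (y w, w) (0, 0)"
        using that by (simp add: D_extended_defect_def A_def)
      then show ?thesis using bij[OF \<open>w \<in> W\<close>] by (metis Pair_inject bij_is_inj injD)
    qed
    then have "inj ((*v) (A w))"
      by (simp add: linear_injective_0 matrix_vector_mul_linear)
    then show ?thesis by (metis invertible_det_nz invertible_left_inverse matrix_left_invertible_injective)
  qed
  have ySW: "y ` W \<subseteq> S" using WV by auto
  have Cy: "Ck_on j W y" for j
  proof (induction j)
    case 0
    show ?case using continuous_on_subset[OF ycont] WV by auto
  next
    case (Suc j)
    have C: "Ck_on j W (\<lambda>w. F (y w))" if "Ck_on j S F" for F :: "real^'m \<Rightarrow> real^'q"
      by (rule Ck_on_compose[OF \<open>open W\<close> open_S ySW Suc that])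
    show ?case
    proof (rule Ck_on_SucI[OF \<open>open W\<close> yder[OF WV(1)]])
      fix v
      show "Ck_on j W (\<lambda>w. fst (g' (0, w) (0, v)))"
      proof (rule Ck_on_linear_solve[OF \<open>open W\<close> _ _ det solve])
        show "Ck_on j W (\<lambda>w. A w $ i $ l)" for i l
          unfolding A_def foot_hessian_def
          by (simp, intro Ck_on_add Ck_on_inner Ck_on_diff C Df_Ck D2f_Ck smooth \<open>open W\<close>
              Ck_on_bounded_linear bounded_linear_ident)
        show "Ck_on j W (\<lambda>w. \<chi> i. Df (y w) (axis i 1) \<bullet> v)"
          by (intro Ck_on_vec_lambda Ck_on_inner C Df_Ck Ck_on_const \<open>open W\<close>)
      qed
    qed
  qed
  show ?thesis
  proof (rule that[OF s(1) k(1) AS _ \<open>open W\<close> W_def _ Cy])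
    show "x = x'" if "w \<in> ball (f x0) k" "x \<in> ball x0 s" "x' \<in> ball x0 s" "foot_defect x w = 0" "foot_defect x' w = 0" for w x x'
      using sol[OF that(2,1,4)] sol[OF that(3,1,5)] by simp
    show "y w \<in> ball x0 s \<and> foot_defect (y w) w = 0" if "w \<in> W" for w
      using WV[OF that] gy by simp
  qed
qed

end

section \<open>The nearest-point retraction and the second fundamental form\<close>

lemma sum_Basis_inner_scaleR: "(\<Sum>b\<in>Basis. (b \<bullet> x) *\<^sub>R b) = (x :: 'w::euclidean_space)"
  by (subst inner_commute) (rule euclidean_representation)

lemma sum_Basis_inner_sq: "(\<Sum>b\<in>Basis. (x \<bullet> b)\<^sup>2) = (norm (x :: 'w::euclidean_space))\<^sup>2"
  unfolding power2_norm_eq_inner euclidean_inner[of x x] by (simp add: power2_eq_square)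

text \<open>
  In an orthonormal basis adapted to the span of the \<open>E i\<close>, the trace of \<open>Q\<close> is the sum over the \<open>E i\<close>
  plus values at normal vectors, which vanish. Instead of extending \<open>E\<close> to a basis, the proof splits
  each \<open>b\<close> into its orthogonal projection \<open>P b\<close> and \<open>b - P b\<close>, and contracts the mixed terms.
\<close>

lemma sum_Basis_bilinear_eq_tangential:
  fixes Q :: "'w::euclidean_space \<Rightarrow> 'w \<Rightarrow> 'v::real_vector" and E :: "'i::finite \<Rightarrow> 'w"
  assumes lin: "\<And>a. linear (Q a)" "\<And>b. linear (\<lambda>a. Q a b)"
    and E: "\<And>i j. E i \<bullet> E j = (if i = j then 1 else 0)"
    and normal: "\<And>n. (\<And>i. n \<bullet> E i = 0) \<Longrightarrow> Q n n = 0"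
  shows "(\<Sum>b\<in>Basis. Q b b) = (\<Sum>i\<in>UNIV. Q (E i) (E i))"
proof -
  define P where "P b = (\<Sum>i\<in>UNIV. (b \<bullet> E i) *\<^sub>R E i)" for b
  have linP: "linear P" unfolding P_def
    by (intro linear_compose_sum ballI linearI) (simp_all add: inner_add_left scaleR_add_left)
  have lin': "linear (\<lambda>b. b - P b)" by (intro linear_compose_sub linear_ident linP)
  have PE: "P (E i) = E i" for i
    by (simp add: P_def E if_distrib[of "\<lambda>c. c *\<^sub>R _"] cong: if_cong)
  have orth: "(b - P b) \<bullet> E i = 0" for b i
    by (simp add: P_def E inner_diff_left inner_sum_left if_distrib cong: if_cong)
  have sumP: "(\<Sum>b\<in>Basis. (b \<bullet> E i) *\<^sub>R L b) = L (E i)" if "linear L" for L :: "'w \<Rightarrow> 'u::real_vector" and i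
  proof -
    have "(\<Sum>b\<in>Basis. (b \<bullet> E i) *\<^sub>R L b) = L (\<Sum>b\<in>Basis. (b \<bullet> E i) *\<^sub>R b)"
      using that by (simp add: linear_sum linear_cmul)
    then show ?thesis by (simp add: sum_Basis_inner_scaleR)
  qed
  have Q1: "(\<Sum>b\<in>Basis. Q (P b) (L b)) = (\<Sum>i\<in>UNIV. Q (E i) (L (E i)))" if "linear L" for L
  proof -
    have "(\<Sum>b\<in>Basis. Q (P b) (L b)) = (\<Sum>b\<in>Basis. \<Sum>i\<in>UNIV. (b \<bullet> E i) *\<^sub>R Q (E i) (L b))"
      unfolding P_def by (simp add: linear_sum[OF lin(2)] linear_cmul[OF lin(2)])
    also have "\<dots> = (\<Sum>i\<in>UNIV. \<Sum>b\<in>Basis. (b \<bullet> E i) *\<^sub>R Q (E i) (L b))" by (rule sum.swap)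
    also have "\<dots> = (\<Sum>i\<in>UNIV. Q (E i) (L (E i)))"
      using linear_compose[OF that lin(1)] by (intro sum.cong refl sumP) (simp add: o_def)
    finally show ?thesis .
  qed
  have Q2: "(\<Sum>b\<in>Basis. Q (L b) (P b)) = (\<Sum>i\<in>UNIV. Q (L (E i)) (E i))" if "linear L" for L
  proof -
    have "(\<Sum>b\<in>Basis. Q (L b) (P b)) = (\<Sum>b\<in>Basis. \<Sum>i\<in>UNIV. (b \<bullet> E i) *\<^sub>R Q (L b) (E i))"
      unfolding P_def by (simp add: linear_sum[OF lin(1)] linear_cmul[OF lin(1)])
    also have "\<dots> = (\<Sum>i\<in>UNIV. \<Sum>b\<in>Basis. (b \<bullet> E i) *\<^sub>R Q (L b) (E i))" by (rule sum.swap)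
    also have "\<dots> = (\<Sum>i\<in>UNIV. Q (L (E i)) (E i))"
      using linear_compose[OF that lin(2)] by (intro sum.cong refl sumP) (simp add: o_def)
    finally show ?thesis .
  qed
  have "Q b b = Q (P b) (P b) + Q (P b) (b - P b) + Q (b - P b) (P b)" for b
  proof -
    have "Q b b = Q (P b) b + Q (b - P b) b" using linear_add[OF lin(2), of "P b" "b - P b" b] by simp
    moreover have "Q (P b) b = Q (P b) (P b) + Q (P b) (b - P b)"
      using linear_add[OF lin(1), of "P b" "P b" "b - P b"] by simp
    moreover have "Q (b - P b) b = Q (b - P b) (P b) + Q (b - P b) (b - P b)"
      using linear_add[OF lin(1), of "b - P b" "P b" "b - P b"] by simp
    ultimately show ?thesis using normal[OF orth, of b] by simp
  qed
  then have "(\<Sum>b\<in>Basis. Q b b) = (\<Sum>b\<in>Basis. Q (P b) (P b) + Q (P b) (b - P b) + Q (b - P b) (P b))"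
    by (rule sum.cong[OF refl])
  also have "\<dots> = (\<Sum>b\<in>Basis. Q (P b) (P b)) + (\<Sum>b\<in>Basis. Q (P b) (b - P b)) + (\<Sum>b\<in>Basis. Q (b - P b) (P b))"
    by (simp only: sum.distrib)
  also have "\<dots> = (\<Sum>i\<in>UNIV. Q (E i) (E i))"
    unfolding Q1[OF linP] Q1[OF lin'] Q2[OF lin'] by (simp add: PE linear_0[OF lin(1)] linear_0[OF lin(2)])
  finally show ?thesis .
qed

text \<open>
  The hypotheses hold for the derivative \<open>A\<close> of a family of orthogonal projections through \<open>P\<close>:
  differentiating \<open>P P = P\<close> gives \<open>P A + A P = A\<close>. Such an \<open>A\<close> interchanges the range and the kernel of
  \<open>P\<close>, and by symmetry its two blocks are adjoint to each other, hence the factor \<open>2\<close>.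
\<close>

lemma sum_Basis_norm_sq_off_diagonal:
  fixes A P :: "'w::euclidean_space \<Rightarrow> 'w" and E :: "'i::finite \<Rightarrow> 'w"
  assumes lin: "linear A" and sym: "\<And>a b. A a \<bullet> b = a \<bullet> A b"
    and P: "\<And>b. P b = (\<Sum>i\<in>UNIV. (b \<bullet> E i) *\<^sub>R E i)"
    and AP: "\<And>a b. A a \<bullet> P b + P a \<bullet> A b = A a \<bullet> b"
  shows "(\<Sum>b\<in>Basis. (norm (A b))\<^sup>2) = 2 * (\<Sum>i\<in>UNIV. (norm (A (E i)))\<^sup>2)"
proof -
  have 1: "(\<Sum>b\<in>Basis. A b \<bullet> P (A b)) = (\<Sum>i\<in>UNIV. (norm (A (E i)))\<^sup>2)"
  proof -
    have "(\<Sum>b\<in>Basis. A b \<bullet> P (A b)) = (\<Sum>b\<in>Basis. \<Sum>i\<in>UNIV. (A (E i) \<bullet> b)\<^sup>2)"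
      unfolding P by (simp add: inner_sum_right sym power2_eq_square inner_commute)
    also have "\<dots> = (\<Sum>i\<in>UNIV. (norm (A (E i)))\<^sup>2)"
      by (subst sum.swap) (simp add: sum_Basis_inner_sq)
    finally show ?thesis .
  qed
  have 2: "(\<Sum>b\<in>Basis. P b \<bullet> A (A b)) = (\<Sum>i\<in>UNIV. (norm (A (E i)))\<^sup>2)"
  proof -
    have s: "E i \<bullet> A (A b) = b \<bullet> A (A (E i))" for i b
      using sym[of "E i" "A b"] sym[of "A (E i)" b] by (simp add: inner_commute)
    have "(\<Sum>b\<in>Basis. P b \<bullet> A (A b)) = (\<Sum>b\<in>Basis. \<Sum>i\<in>UNIV. (b \<bullet> E i) * (b \<bullet> A (A (E i))))"
      unfolding P by (simp add: inner_sum_left s)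
    also have "\<dots> = (\<Sum>i\<in>UNIV. \<Sum>b\<in>Basis. (b \<bullet> E i) * (b \<bullet> A (A (E i))))" by (rule sum.swap)
    also have "\<dots> = (\<Sum>i\<in>UNIV. E i \<bullet> A (A (E i)))"
    proof (rule sum.cong[OF refl])
      show "(\<Sum>b\<in>Basis. (b \<bullet> E i) * (b \<bullet> A (A (E i)))) = E i \<bullet> A (A (E i))" for i
        by (subst euclidean_inner[of "E i"]) (simp add: inner_commute)
    qed
    also have "\<dots> = (\<Sum>i\<in>UNIV. (norm (A (E i)))\<^sup>2)" by (simp add: power2_norm_eq_inner sym)
    finally show ?thesis .
  qed
  have "(\<Sum>b\<in>Basis. (norm (A b))\<^sup>2) = (\<Sum>b\<in>Basis. A b \<bullet> P (A b) + P b \<bullet> A (A b))"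
    using AP[of _ "A _"] by (simp add: power2_norm_eq_inner)
  then show ?thesis by (simp add: sum.distrib 1 2)
qed

context local_immersion
begin

text \<open>
  The second fundamental form at \<open>f x\<close>, in the coordinates of the patch.
\<close>

definition II :: "real^'m \<Rightarrow> real^'m \<Rightarrow> real^'m \<Rightarrow> real^'q" where
  "II x u v = normal_part (range (Df x)) (D2f x v u)"

definition orthonormal_frame :: "real^'m \<Rightarrow> ('m \<Rightarrow> real^'m) \<Rightarrow> bool" where
  "orthonormal_frame x e \<longleftrightarrow> (\<forall>i j. Df x (e i) \<bullet> Df x (e j) = (if i = j then 1 else 0))"

definition unstable_at :: "real^'m \<Rightarrow> bool" where
  "unstable_at x \<longleftrightarrow> (\<forall>e u. orthonormal_frame x e \<and> norm (Df x u) = 1 \<longrightarrow>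
     (\<Sum>i\<in>UNIV. 6 * (II x u (e i) \<bullet> II x u (e i)) - II x u u \<bullet> II x (e i) (e i)) < 0)"

end

text \<open>
  The output of \<open>smooth_foot_point\<close>. Points of \<open>W\<close> have a foot point, with coordinates \<open>y w\<close>, so that
  \<open>w \<mapsto> f (y w)\<close> is the nearest-point retraction of \<open>W\<close> onto the patch; this is the map \<open>r\<close> below.
\<close>

locale foot_patch = local_immersion S f for S :: "(real^'m) set" and f :: "real^'m \<Rightarrow> real^'q" +
  fixes x0 :: "real^'m" and s k :: real and W :: "(real^'q) set" and y :: "real^'q \<Rightarrow> real^'m"
  assumes s_pos: "s > 0" and k_pos: "k > 0" and ball_S: "ball x0 s \<subseteq> S"
    and foot_unique: "\<And>w x x'. \<lbrakk>w \<in> ball (f x0) k; x \<in> ball x0 s; x' \<in> ball x0 s;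
      foot_defect x w = 0; foot_defect x' w = 0\<rbrakk> \<Longrightarrow> x = x'"
    and open_W: "open W" and W_eq: "W = {w \<in> ball (f x0) k. \<exists>x\<in>ball x0 s. foot_defect x w = 0}"
    and foot: "\<And>w. w \<in> W \<Longrightarrow> y w \<in> ball x0 s \<and> foot_defect (y w) w = 0"
    and y_Ck: "\<And>j. Ck_on j W y"
begin

definition r :: "real^'q \<Rightarrow> real^'q" where "r w = f (y w)"

text \<open>
  The coordinates of those points of the patch that lie in \<open>W\<close> themselves and are fixed by \<open>r\<close>.
\<close>

definition U :: "(real^'m) set" where "U = {x \<in> ball x0 s. f x \<in> ball (f x0) k}"

definition Dr :: "real^'q \<Rightarrow> real^'q \<Rightarrow> real^'q" where
  "Dr w a = frechet_derivative r (at w) a"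

definition D2r :: "real^'q \<Rightarrow> real^'q \<Rightarrow> real^'q \<Rightarrow> real^'q" where
  "D2r w a b = frechet_derivative (\<lambda>w. Dr w a) (at w) b"

definition D3r :: "real^'q \<Rightarrow> real^'q \<Rightarrow> real^'q \<Rightarrow> real^'q \<Rightarrow> real^'q" where
  "D3r w a b c = frechet_derivative (\<lambda>w. D2r w a b) (at w) c"

lemma r_Ck: "Ck_on j W r"
  unfolding r_def using foot ball_S by (intro Ck_on_compose[OF open_W open_S _ y_Ck smooth]) auto

lemma Dr_Ck: "Ck_on j W (\<lambda>w. Dr w a)"
  unfolding Dr_def by (rule Ck_on_derivative[OF r_Ck])

lemma D2r_Ck: "Ck_on j W (\<lambda>w. D2r w a b)"
  unfolding D2r_def by (rule Ck_on_derivative[OF Dr_Ck])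

lemma D3r_Ck: "Ck_on j W (\<lambda>w. D3r w a b c)"
  unfolding D3r_def by (rule Ck_on_derivative[OF D2r_Ck])

lemma r_has_derivative: "w \<in> W \<Longrightarrow> (r has_derivative Dr w) (at w)"
  using Ck_on_has_derivative[OF r_Ck[of "Suc 0"]] by (simp add: Dr_def[abs_def])

lemma Dr_has_derivative: "w \<in> W \<Longrightarrow> ((\<lambda>w. Dr w a) has_derivative D2r w a) (at w)"
  using Ck_on_has_derivative[OF Dr_Ck[of "Suc 0"]] by (simp add: D2r_def[abs_def])

lemma D2r_has_derivative: "w \<in> W \<Longrightarrow> ((\<lambda>w. D2r w a b) has_derivative D3r w a b) (at w)"
  using Ck_on_has_derivative[OF D2r_Ck[of "Suc 0"]] by (simp add: D3r_def[abs_def])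

lemma D2r_sym: "w \<in> W \<Longrightarrow> D2r w a b = D2r w b a"
  unfolding D2r_def Dr_def by (rule second_derivative_symmetric[OF open_W r_Ck])

lemma D3r_swap: "w \<in> W \<Longrightarrow> D3r w a b c = D3r w a c b"
  unfolding D3r_def D2r_def by (rule second_derivative_symmetric[OF open_W Dr_Ck])

lemma D3r_sym:
  assumes "w \<in> W"
  shows "D3r w a b c = D3r w b a c"
proof -
  have "((\<lambda>w. D2r w b a) has_derivative D3r w a b) (at w)"
    by (rule has_derivative_transform_within_open[OF D2r_has_derivative[OF assms] open_W assms])
      (rule D2r_sym)
  from has_derivative_unique[OF this D2r_has_derivative[OF assms]] show ?thesis by simp
qed

lemma Dr_linear: "w \<in> W \<Longrightarrow> linear (Dr w)"
  by (rule has_derivative_linear[OF r_has_derivative])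

lemma D2r_linear: "w \<in> W \<Longrightarrow> linear (D2r w a)"
  by (rule has_derivative_linear[OF Dr_has_derivative])

lemma D2r_linear': "w \<in> W \<Longrightarrow> linear (\<lambda>a. D2r w a b)"
  using D2r_linear[of w b] by (simp add: D2r_sym[of w _ b])

lemma U_subset_S: "x \<in> U \<Longrightarrow> x \<in> S"
  using ball_S by (auto simp: U_def)

lemma open_U: "open U"
proof -
  have "continuous_on (ball x0 s) f"
    using Ck_on_imp_continuous_on[OF smooth] ball_S continuous_on_subset by blast
  then have "open (ball x0 s \<inter> f -` ball (f x0) k)" by (rule continuous_open_preimage) auto
  then show ?thesis by (simp add: U_def vimage_def Int_def)
qed

text \<open>
  The residual at \<open>x\<close> of the point \<open>f x + n\<close> is normal, so \<open>f x\<close> is its foot point: the retraction is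
  constant along normal segments.
\<close>

lemma foot_normal:
  assumes "x \<in> ball x0 s" "\<And>u. n \<bullet> Df x u = 0" "f x + n \<in> ball (f x0) k"
  shows "f x + n \<in> W" "y (f x + n) = x" "r (f x + n) = f x"
proof -
  have 0: "foot_defect x (f x + n) = 0"
    using assms ball_S by (subst foot_defect_eq_0_iff) (auto simp: inner_commute)
  show W: "f x + n \<in> W" using assms 0 by (auto simp: W_eq)
  show "y (f x + n) = x" using foot_unique[OF assms(3)] foot[OF W] assms(1) 0 by blast
  then show "r (f x + n) = f x" by (simp add: r_def)
qed

lemma f_in_W: "x \<in> U \<Longrightarrow> f x \<in> W" and r_f: "x \<in> U \<Longrightarrow> r (f x) = f x"
  using foot_normal[of x 0] by (auto simp: U_def)

lemma Dr_tangent: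
  assumes "x \<in> U"
  shows "Dr (f x) (Df x u) = Df x u"
proof -
  have "((\<lambda>x. r (f x)) has_derivative (\<lambda>u. Dr (f x) (Df x u))) (at x)"
    by (rule has_derivative_compose[OF f_has_derivative[OF U_subset_S[OF assms]]
          r_has_derivative[OF f_in_W[OF assms]]])
  then have "(f has_derivative (\<lambda>u. Dr (f x) (Df x u))) (at x)"
    by (rule has_derivative_transform_within_open[OF _ open_U assms]) (simp add: r_f)
  from has_derivative_unique[OF this f_has_derivative[OF U_subset_S[OF assms]]] show ?thesis by metis
qed

lemma derivative_along_normal:
  assumes "x \<in> U" "\<And>u. n \<bullet> Df x u = 0"
  shows "\<exists>e>0. \<forall>t. \<bar>t\<bar> < e \<longrightarrow> f x + t *\<^sub>R n \<in> W \<and> Dr (f x + t *\<^sub>R n) n = 0"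
proof -
  have "open ((\<lambda>t. f x + t *\<^sub>R n) -` ball (f x0) k)"
    by (intro continuous_open_vimage continuous_intros) auto
  moreover have "0 \<in> (\<lambda>t. f x + t *\<^sub>R n) -` ball (f x0) k" using assms(1) by (simp add: U_def)
  ultimately obtain e where e: "e > 0" "ball 0 e \<subseteq> (\<lambda>t. f x + t *\<^sub>R n) -` ball (f x0) k"
    by (meson open_contains_ball)
  have in_W: "f x + t *\<^sub>R n \<in> W" and const: "r (f x + t *\<^sub>R n) = f x" if "\<bar>t\<bar> < e" for t
    using foot_normal[of x "t *\<^sub>R n"] assms that e by (auto simp: U_def dist_norm subset_iff)
  have "Dr (f x + t *\<^sub>R n) n = 0" if t: "\<bar>t\<bar> < e" for t
  proof -
    have "((\<lambda>t. r (f x + t *\<^sub>R n)) has_derivative (\<lambda>c. Dr (f x + t *\<^sub>R n) (c *\<^sub>R n))) (at t)"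
      by (rule has_derivative_compose[of "\<lambda>t. f x + t *\<^sub>R n" "\<lambda>c. c *\<^sub>R n" t UNIV r])
        (use r_has_derivative[OF in_W[OF t]] in \<open>auto intro!: derivative_eq_intros\<close>)
    then have "((\<lambda>t. f x) has_derivative (\<lambda>c. Dr (f x + t *\<^sub>R n) (c *\<^sub>R n))) (at t)"
      by (rule has_derivative_transform_within_open[of _ _ _ _ "ball 0 e"]) (use t const in auto)
    from has_derivative_unique[OF this has_derivative_const] have "Dr (f x + t *\<^sub>R n) (1 *\<^sub>R n) = 0" by metis
    then show ?thesis by simp
  qed
  then show ?thesis using e(1) in_W by blast
qed

lemma Dr_normal:
  assumes "x \<in> U" "\<And>u. n \<bullet> Df x u = 0"
  shows "Dr (f x) n = 0"
  using derivative_along_normal[OF assms] by (metis abs_zero add_0_right scaleR_zero_left)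

lemma D2r_normal:
  assumes "x \<in> U" "\<And>u. n \<bullet> Df x u = 0"
  shows "D2r (f x) n n = 0"
proof -
  obtain e where e: "e > 0" "\<And>t. \<bar>t\<bar> < e \<Longrightarrow> f x + t *\<^sub>R n \<in> W" "\<And>t. \<bar>t\<bar> < e \<Longrightarrow> Dr (f x + t *\<^sub>R n) n = 0"
    using derivative_along_normal[OF assms] by metis
  have "((\<lambda>t. Dr (f x + t *\<^sub>R n) n) has_derivative (\<lambda>c. D2r (f x + 0 *\<^sub>R n) n (c *\<^sub>R n))) (at 0)"
    by (rule has_derivative_compose[of "\<lambda>t. f x + t *\<^sub>R n" "\<lambda>c. c *\<^sub>R n" 0 UNIV "\<lambda>w. Dr w n"])
      (use Dr_has_derivative[OF e(2)[of 0], of n] e(1) in \<open>auto intro!: derivative_eq_intros\<close>)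
  then have "((\<lambda>t. 0) has_derivative (\<lambda>c. D2r (f x + 0 *\<^sub>R n) n (c *\<^sub>R n))) (at 0)"
    by (rule has_derivative_transform_within_open[of _ _ _ _ "ball 0 e"]) (use e in auto)
  from has_derivative_unique[OF this has_derivative_const] have "D2r (f x + 0 *\<^sub>R n) n (1 *\<^sub>R n) = 0" by metis
  then show ?thesis by simp
qed

lemma tangent_normal_decomposition:
  assumes "x \<in> U"
  obtains u n where "a = Df x u + n" "\<And>v. n \<bullet> Df x v = 0"
proof -
  have sub: "subspace (range (Df x))"
    using linear_subspace_image[OF Df_linear[OF U_subset_S[OF assms]] subspace_UNIV] .
  obtain t n where "t \<in> span (range (Df x))" "\<And>w. w \<in> span (range (Df x)) \<Longrightarrow> orthogonal n w" "a = t + n"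
    using orthogonal_subspace_decomp_exists[of "range (Df x)" a] by metis
  then show ?thesis using that sub by (auto simp: span_eq_iff[THEN iffD2] orthogonal_def)
qed

text \<open>
  By \<open>Dr_tangent\<close> and \<open>Dr_normal\<close>, \<open>Dr (f x)\<close> is the orthogonal projection onto the tangent space. The
  next lemmas record the projection identities whose derivatives along the patch bring in the second
  fundamental form.
\<close>

lemma Dr_symmetric:
  assumes "x \<in> U"
  shows "Dr (f x) a \<bullet> b = a \<bullet> Dr (f x) b"
proof -
  obtain u n where a: "a = Df x u + n" "\<And>v. n \<bullet> Df x v = 0" using tangent_normal_decomposition[OF assms] by metis
  obtain u' n' where b: "b = Df x u' + n'" "\<And>v. n' \<bullet> Df x v = 0" using tangent_normal_decomposition[OF assms] by metis
  show ?thesis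
    using linear_add[OF Dr_linear[OF f_in_W[OF assms]]] Dr_tangent[OF assms] Dr_normal[OF assms] a(2) b(2)
    by (simp add: a(1) b(1) inner_add_left inner_add_right inner_commute)
qed

lemma Dr_projection:
  assumes "x \<in> U"
  shows "Dr (f x) a \<bullet> Dr (f x) b = Dr (f x) a \<bullet> b"
proof -
  obtain u n where b: "b = Df x u + n" "\<And>v. n \<bullet> Df x v = 0" using tangent_normal_decomposition[OF assms] by metis
  have "Dr (f x) b = Df x u"
    using linear_add[OF Dr_linear[OF f_in_W[OF assms]]] Dr_tangent[OF assms] Dr_normal[OF assms b(2)]
    by (simp add: b(1))
  then show ?thesis using Dr_symmetric[OF assms, of a b] Dr_symmetric[OF assms, of a "Df x u"]
      Dr_tangent[OF assms] by metis
qed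

lemma normal_diff_Dr: 
  assumes "x \<in> U"
  shows "(a - Dr (f x) a) \<bullet> Df x v = 0"
  using Dr_symmetric[OF assms, of a "Df x v"] Dr_tangent[OF assms] by (simp add: inner_diff_left)

lemma Dr_in_range:
  assumes "x \<in> U"
  shows "Dr (f x) a \<in> range (Df x)"
proof -
  obtain u n where a: "a = Df x u + n" "\<And>v. n \<bullet> Df x v = 0" using tangent_normal_decomposition[OF assms] by metis
  then show ?thesis
    using linear_add[OF Dr_linear[OF f_in_W[OF assms]]] Dr_tangent[OF assms] Dr_normal[OF assms a(2)] by auto
qed

lemma II_eq:
  assumes "x \<in> U"
  shows "II x u v = D2f x v u - Dr (f x) (D2f x v u)"
  unfolding II_def normal_part_def
proof (rule the_equality)
  let ?w = "D2f x v u"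
  show "?w - (?w - Dr (f x) ?w) \<in> range (Df x) \<and> (\<forall>t\<in>range (Df x). orthogonal (?w - Dr (f x) ?w) t)"
    using Dr_in_range[OF assms] normal_diff_Dr[OF assms] by (auto simp: orthogonal_def)
  fix n assume n: "?w - n \<in> range (Df x) \<and> (\<forall>t\<in>range (Df x). orthogonal n t)"
  then obtain z where z: "?w - n = Df x z" by auto
  have "Dr (f x) (Df x z + n) = Df x z"
    using linear_add[OF Dr_linear[OF f_in_W[OF assms]]] Dr_tangent[OF assms] Dr_normal[OF assms, of n] n
    by (auto simp: orthogonal_def)
  moreover have "Df x z + n = ?w" using z by (simp add: algebra_simps)
  ultimately show "n = ?w - Dr (f x) ?w" using z by (simp add: algebra_simps)
qed

lemma Dr_f_has_derivative:
  assumes "x \<in> U"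
  shows "((\<lambda>x. Dr (f x) a) has_derivative (\<lambda>u. D2r (f x) a (Df x u))) (at x)"
  by (rule has_derivative_compose[OF f_has_derivative[OF U_subset_S[OF assms]]
        Dr_has_derivative[OF f_in_W[OF assms]]])

lemma derivative_eq_if_eq_on_U:
  assumes "x \<in> U" "(g has_derivative g') (at x)" "(h has_derivative h') (at x)" "\<And>x. x \<in> U \<Longrightarrow> g x = h x"
  shows "g' u = h' u"
proof -
  have "(h has_derivative g') (at x)"
    by (rule has_derivative_transform_within_open[OF assms(2) open_U assms(1)]) (rule assms(4))
  from has_derivative_unique[OF this assms(3)] show ?thesis by simp
qed

text \<open>
  The derivative of \<open>Dr_symmetric\<close> along the patch.
\<close>

lemma D2r_symmetric_operator:
  assumes "x \<in> U"
  shows "D2r (f x) a (Df x u) \<bullet> b = a \<bullet> D2r (f x) b (Df x u)"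
  using derivative_eq_if_eq_on_U[OF assms
      has_derivative_inner_left[OF Dr_f_has_derivative[OF assms], of a b]
      has_derivative_inner_right[OF Dr_f_has_derivative[OF assms], of a b] Dr_symmetric, of u] by simp

text \<open>
  The derivative of \<open>Dr_projection\<close> along the patch.
\<close>

lemma D2r_projection:
  assumes "x \<in> U"
  shows "D2r (f x) a (Df x u) \<bullet> Dr (f x) b + Dr (f x) a \<bullet> D2r (f x) b (Df x u) = D2r (f x) a (Df x u) \<bullet> b"
  using derivative_eq_if_eq_on_U[OF assms
      has_derivative_inner[OF Dr_f_has_derivative[OF assms, of a] Dr_f_has_derivative[OF assms, of b]]
      has_derivative_inner_left[OF Dr_f_has_derivative[OF assms], of a b] Dr_projection, of u] by simp

text \<open>
  Differentiate \<open>Dr (f x) b \<bullet> Df x v = b \<bullet> Df x v\<close> in direction \<open>u\<close>: the tangential parts cancel, and what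
  remains is the normal part of the second derivative of \<open>f\<close>.
\<close>

lemma D2r_tangent:
  assumes "x \<in> U"
  shows "D2r (f x) (Df x v) (Df x u) = II x u v"
proof -
  have "D2r (f x) b (Df x u) \<bullet> Df x v + Dr (f x) b \<bullet> D2f x v u = b \<bullet> D2f x v u" for b
    using derivative_eq_if_eq_on_U[OF assms
        has_derivative_inner[OF Dr_f_has_derivative[OF assms, of b] Df_has_derivative[OF U_subset_S[OF assms], of v]]
        has_derivative_inner_right[OF Df_has_derivative[OF U_subset_S[OF assms], of v], of b], of u]
      Dr_symmetric Dr_tangent by simp
  from this have "b \<bullet> D2r (f x) (Df x v) (Df x u) = b \<bullet> II x u v" for b
    using D2r_symmetric_operator[OF assms, of b u "Df x v"] Dr_symmetric[OF assms, of b "D2f x v u"]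
    unfolding II_eq[OF assms] inner_diff_right by (metis add_diff_cancel_right')
  then show ?thesis by (metis vector_eq_ldot)
qed

lemma II_normal: "x \<in> U \<Longrightarrow> II x u v \<bullet> Df x z = 0"
  by (simp add: II_eq normal_diff_Dr)

lemma ex_orthonormal_frame:
  assumes "x \<in> U"
  obtains e where "orthonormal_frame x e"
proof -
  have lin: "linear (Df x)" by (rule Df_linear[OF U_subset_S[OF assms]])
  have sub: "subspace (range (Df x))" using linear_subspace_image[OF lin subspace_UNIV] .
  obtain B where B: "B \<subseteq> range (Df x)" "pairwise orthogonal B" "\<And>b. b \<in> B \<Longrightarrow> norm b = 1"
    "independent B" "card B = dim (range (Df x))"
    using orthonormal_basis_subspace[OF sub] by metis
  have "inj (Df x)" using inj[OF U_subset_S[OF assms]] by (simp add: Df_def[abs_def])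
  then have "dim (range (Df x)) = CARD('m)" using dim_image_eq[OF lin, of UNIV] by simp
  then have "finite B" "card B = CARD('m)" using B(4,5) independent_imp_finite by auto
  then obtain h where h: "bij_betw h (UNIV :: 'm set) B"
    using finite_same_card_bij[of "UNIV :: 'm set" B] by auto
  have "\<forall>i. \<exists>u. Df x u = h i" using h B(1) by (auto simp: bij_betw_def image_subset_iff) (metis UNIV_I image_iff rangeI subsetD)
  then obtain e where e: "\<And>i. Df x (e i) = h i" by metis
  have "h i \<bullet> h j = (if i = j then 1 else 0)" for i j
  proof (cases "i = j")
    case True
    have "h i \<in> B" using h by (auto simp: bij_betw_def)
    then show ?thesis using B(3)[of "h i"] True by (simp add: norm_eq_1)
  next
    case False
    then have "h i \<noteq> h j" using h by (auto simp: bij_betw_def inj_def)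
    then show ?thesis using False B(2) h by (auto simp: bij_betw_def pairwise_def orthogonal_def)
  qed
  then show ?thesis using that[of e] by (simp add: orthonormal_frame_def e)
qed

lemma frame_expansion:
  assumes "x \<in> U" "orthonormal_frame x e"
  shows "Dr (f x) b = (\<Sum>i\<in>UNIV. (b \<bullet> Df x (e i)) *\<^sub>R Df x (e i))"
    "u = (\<Sum>i\<in>UNIV. (Df x u \<bullet> Df x (e i)) *\<^sub>R e i)"
proof -
  have lin: "linear (Df x)" by (rule Df_linear[OF U_subset_S[OF assms(1)]])
  have E: "Df x (e i) \<bullet> Df x (e j) = (if i = j then 1 else 0)" for i j
    using assms(2) by (simp add: orthonormal_frame_def)
  have inj: "inj (Df x)" using inj[OF U_subset_S[OF assms(1)]] by (simp add: Df_def[abs_def])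
  have ei: "inj e" using E by (metis (no_types, lifting) injI one_neq_zero)
  have ind: "independent (range e)"
  proof (rule independent_if_scalars_zero)
    fix c v assume c: "(\<Sum>x\<in>range e. c x *\<^sub>R x) = 0" and "v \<in> range e"
    then obtain j where j: "v = e j" by auto
    have "(\<Sum>i\<in>UNIV. c (e i) *\<^sub>R e i) = 0" using c by (simp add: sum.reindex[OF ei])
    then have "Df x (\<Sum>i\<in>UNIV. c (e i) *\<^sub>R e i) \<bullet> Df x (e j) = 0" by (simp add: linear_0[OF lin])
    then show "c v = 0"
      by (simp add: j linear_sum[OF lin] linear_cmul[OF lin] inner_sum_left E if_distrib cong: if_cong)
  qed simp
  have "dim (UNIV :: (real^'m) set) \<le> card (range e)" using ei by (simp add: card_image)
  then have "UNIV \<subseteq> span (range e)" using card_ge_dim_independent[of "range e" UNIV] ind by auto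
  then have "u \<in> span (range e)" for u by auto
  show exp: "u = (\<Sum>i\<in>UNIV. (Df x u \<bullet> Df x (e i)) *\<^sub>R e i)" for u
  proof -
    obtain c where "u = (\<Sum>v\<in>range e. c v *\<^sub>R v)"
      using \<open>u \<in> span (range e)\<close> span_finite[of "range e"] by auto
    then have c: "u = (\<Sum>i\<in>UNIV. c (e i) *\<^sub>R e i)" by (simp add: sum.reindex[OF ei])
    have "Df x u \<bullet> Df x (e i) = c (e i)" for i
      by (subst c) (simp add: linear_sum[OF lin] linear_cmul[OF lin] inner_sum_left E if_distrib cong: if_cong)
    then show ?thesis using c by simp
  qed
  obtain u n where b: "b = Df x u + n" "\<And>v. n \<bullet> Df x v = 0"
    using tangent_normal_decomposition[OF assms(1)] by metis
  have "Dr (f x) b = Df x u"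
    using linear_add[OF Dr_linear[OF f_in_W[OF assms(1)]]] Dr_tangent[OF assms(1)] Dr_normal[OF assms(1) b(2)]
    by (simp add: b(1))
  also have "\<dots> = (\<Sum>i\<in>UNIV. (Df x u \<bullet> Df x (e i)) *\<^sub>R Df x (e i))"
    using arg_cong[OF exp[of u], of "Df x"] unfolding linear_sum[OF lin] linear_cmul[OF lin] .
  finally show "Dr (f x) b = (\<Sum>i\<in>UNIV. (b \<bullet> Df x (e i)) *\<^sub>R Df x (e i))"
    by (simp add: b(1) inner_add_left b(2))
qed

end

section \<open>The second variation of sixth powers\<close>

lemma second_order_bound:
  fixes H :: "real \<Rightarrow> real"
  assumes "t > 0" and 1: "\<And>s. 0 \<le> s \<Longrightarrow> s \<le> t \<Longrightarrow> (H has_real_derivative H1 s) (at s)"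
    and 2: "\<And>s. 0 \<le> s \<Longrightarrow> s \<le> t \<Longrightarrow> (H1 has_real_derivative H2 s) (at s)"
    and "H1 0 = 0" and M: "\<And>s. 0 \<le> s \<Longrightarrow> s \<le> t \<Longrightarrow> H2 s \<le> M"
  shows "H t \<le> H 0 + M * t\<^sup>2 / 2"
proof -
  let ?diff = "\<lambda>m::nat. if m = 0 then H else if m = 1 then H1 else H2"
  have D: "\<forall>m s. m < 2 \<and> 0 \<le> s \<and> s \<le> t \<longrightarrow> (?diff m has_real_derivative ?diff (Suc m) s) (at s)"
    using 1 2 by (auto simp: less_2_cases_iff)
  obtain s where s: "0 < s" "s < t" "H t = (\<Sum>m<2. (?diff m 0 / fact m) * (t - 0) ^ m) + (?diff 2 s / fact 2) * (t - 0) ^ 2"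
    using Taylor_up[of 2 ?diff H 0 t 0, OF _ _ D] \<open>t > 0\<close> by auto
  then have "H t = H 0 + H2 s * t\<^sup>2 / 2"
    using \<open>H1 0 = 0\<close> by (simp add: numeral_2_eq_2 lessThan_Suc)
  moreover have "H2 s * t\<^sup>2 \<le> M * t\<^sup>2" using M[of s] s by (intro mult_right_mono) auto
  ultimately show ?thesis by simp
qed

context foot_patch
begin

definition Laplacian :: "real^'q \<Rightarrow> real^'q" where
  "Laplacian w = (\<Sum>b\<in>Basis. D2r w b b)"

lemma Laplacian_has_derivative:
  "w \<in> W \<Longrightarrow> (Laplacian has_derivative (\<lambda>h. \<Sum>b\<in>Basis. D3r w b b h)) (at w)"
  unfolding Laplacian_def by (intro has_derivative_sum D2r_has_derivative)

text \<open>
  Normal directions contribute nothing by \<open>D2r_normal\<close>, so along the patch the Laplacian of the retraction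
  is the trace of the second fundamental form, the unnormalised mean curvature vector.
\<close>

lemma Laplacian_eq:
  assumes "x \<in> U" "orthonormal_frame x e"
  shows "Laplacian (f x) = (\<Sum>i\<in>UNIV. II x (e i) (e i))"
proof -
  have lin: "linear (Df x)" by (rule Df_linear[OF U_subset_S[OF assms(1)]])
  have "Laplacian (f x) = (\<Sum>i\<in>UNIV. D2r (f x) (Df x (e i)) (Df x (e i)))"
    unfolding Laplacian_def
  proof (rule sum_Basis_bilinear_eq_tangential[where Q = "D2r (f x)"])
    show "Df x (e i) \<bullet> Df x (e j) = (if i = j then 1 else 0)" for i j
      using assms(2) by (simp add: orthonormal_frame_def)
    show "D2r (f x) n n = 0" if "\<And>i. n \<bullet> Df x (e i) = 0" for n
    proof (rule D2r_normal[OF assms(1)])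
      fix u
      have "n \<bullet> Df x (\<Sum>i\<in>UNIV. (Df x u \<bullet> Df x (e i)) *\<^sub>R e i) = 0"
        by (simp add: linear_sum[OF lin] linear_cmul[OF lin] inner_sum_right that)
      then show "n \<bullet> Df x u = 0" using frame_expansion(2)[OF assms, of u] by simp
    qed
  qed (use D2r_linear D2r_linear' f_in_W[OF assms(1)] in auto)
  then show ?thesis by (simp add: D2r_tangent[OF assms(1)])
qed

lemma Laplacian_normal:
  assumes "x \<in> U"
  shows "Laplacian (f x) \<bullet> Df x u = 0"
proof -
  obtain e where "orthonormal_frame x e" using ex_orthonormal_frame[OF assms] by metis
  from Laplacian_eq[OF assms this] show ?thesis by (simp add: inner_sum_left II_normal[OF assms])
qed

text \<open>
  The Laplacian of \<open>r\<close> is normal along the patch. Differentiating its inner product with the tangent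
  field \<open>Df x u\<close> trades the third derivatives of \<open>r\<close> for the second fundamental form.
\<close>

lemma derivative_Laplacian_tangent:
  assumes "x \<in> U"
  shows "(\<Sum>b\<in>Basis. D3r (f x) b b (Df x u)) \<bullet> Df x u = - (Laplacian (f x) \<bullet> II x u u)"
proof -
  have "((\<lambda>x. Laplacian (f x)) has_derivative (\<lambda>u. \<Sum>b\<in>Basis. D3r (f x) b b (Df x u))) (at x)"
    by (rule has_derivative_compose[OF f_has_derivative[OF U_subset_S[OF assms]]
          Laplacian_has_derivative[OF f_in_W[OF assms]]])
  from derivative_eq_if_eq_on_U[OF assms
      has_derivative_inner[OF this Df_has_derivative[OF U_subset_S[OF assms], of u]] has_derivative_const[of 0], of u]
  have "Laplacian (f x) \<bullet> D2f x u u + (\<Sum>b\<in>Basis. D3r (f x) b b (Df x u)) \<bullet> Df x u = 0"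
    using Laplacian_normal by simp
  moreover have "Laplacian (f x) \<bullet> D2f x u u = Laplacian (f x) \<bullet> II x u u"
  proof -
    obtain z where "Dr (f x) (D2f x u u) = Df x z" using Dr_in_range[OF assms] by blast
    then show ?thesis using Laplacian_normal[OF assms, of z] by (simp add: II_eq[OF assms] inner_diff_right)
  qed
  ultimately show ?thesis by simp
qed

lemma II_linear:
  assumes "x \<in> U"
  shows "linear (II x u)"
proof -
  have "II x u = (\<lambda>a. D2r (f x) a (Df x u)) \<circ> Df x" by (simp add: fun_eq_iff D2r_tangent[OF assms])
  then show ?thesis
    using linear_compose[OF Df_linear[OF U_subset_S[OF assms]] D2r_linear'[OF f_in_W[OF assms], of "Df x u"]] by simp
qed

text \<open>
  Expand \<open>u\<close> in the frame and apply the Cauchy-Schwarz inequality.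
\<close>

lemma norm_II_le:
  assumes "x \<in> U" "orthonormal_frame x e"
  shows "(norm (II x u u))\<^sup>2 \<le> (norm (Df x u))\<^sup>2 * (\<Sum>i\<in>UNIV. (norm (II x u (e i)))\<^sup>2)"
proof -
  let ?c = "\<lambda>i. Df x u \<bullet> Df x (e i)"
  have "II x u u = (\<Sum>i\<in>UNIV. ?c i *\<^sub>R II x u (e i))"
    using arg_cong[OF frame_expansion(2)[OF assms, of u], of "II x u"]
    unfolding linear_sum[OF II_linear[OF assms(1)]] linear_cmul[OF II_linear[OF assms(1)]] .
  then have "norm (II x u u) \<le> (\<Sum>i\<in>UNIV. \<bar>?c i\<bar> * norm (II x u (e i)))"
    using norm_sum[of "\<lambda>i. ?c i *\<^sub>R II x u (e i)" UNIV] by simp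
  then have "(norm (II x u u))\<^sup>2 \<le> (\<Sum>i\<in>UNIV. \<bar>?c i\<bar> * norm (II x u (e i)))\<^sup>2"
    by (intro power_mono) auto
  also have "\<dots> \<le> (\<Sum>i\<in>UNIV. \<bar>?c i\<bar>\<^sup>2) * (\<Sum>i\<in>UNIV. (norm (II x u (e i)))\<^sup>2)"
    by (rule Cauchy_Schwarz_ineq_sum)
  also have "(\<Sum>i\<in>UNIV. \<bar>?c i\<bar>\<^sup>2) = (norm (Df x u))\<^sup>2"
  proof -
    have "Df x u = (\<Sum>i\<in>UNIV. ?c i *\<^sub>R Df x (e i))"
      using frame_expansion(1)[OF assms, of "Df x u"] Dr_tangent[OF assms(1)] by simp
    then have "Df x u \<bullet> Df x u = (\<Sum>i\<in>UNIV. ?c i *\<^sub>R Df x (e i)) \<bullet> Df x u" by (rule arg_cong)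
    also have "\<dots> = (\<Sum>i\<in>UNIV. \<bar>?c i\<bar>\<^sup>2)" by (simp add: inner_sum_left power2_eq_square inner_sum_right inner_commute)
    finally show ?thesis by (simp add: power2_norm_eq_inner)
  qed
  finally show ?thesis .
qed

text \<open>
  The three ingredients of the second derivative of \<open>norm (Dr (f x + t *\<^sub>R b) v) powr p\<close> at \<open>t = 0\<close>, each
  summed over an orthonormal basis of directions \<open>b\<close> of the ambient space.
\<close>

lemma second_variation:
  assumes "x \<in> U" "orthonormal_frame x e"
  defines "v u \<equiv> Df x u"
  shows "(\<Sum>b\<in>Basis. (norm (D2r (f x) (v u) b))\<^sup>2) = 2 * (\<Sum>i\<in>UNIV. (norm (II x u (e i)))\<^sup>2)"
    and "(\<Sum>b\<in>Basis. (v u \<bullet> D2r (f x) (v u) b)\<^sup>2) = (norm (II x u u))\<^sup>2"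
    and "(\<Sum>b\<in>Basis. v u \<bullet> D3r (f x) (v u) b b) = - (\<Sum>i\<in>UNIV. II x u u \<bullet> II x (e i) (e i))"
proof -
  have W: "f x \<in> W" by (rule f_in_W[OF assms(1)])
  have sym: "D2r (f x) (v u) b = D2r (f x) b (v u)" for b by (rule D2r_sym[OF W])
  have "(\<Sum>b\<in>Basis. (norm (D2r (f x) b (v u)))\<^sup>2) = 2 * (\<Sum>i\<in>UNIV. (norm (D2r (f x) (Df x (e i)) (v u)))\<^sup>2)"
    unfolding v_def
    by (rule sum_Basis_norm_sq_off_diagonal[OF D2r_linear'[OF W] D2r_symmetric_operator[OF assms(1)]
          frame_expansion(1)[OF assms(1,2)] D2r_projection[OF assms(1)]])
  then show "(\<Sum>b\<in>Basis. (norm (D2r (f x) (v u) b))\<^sup>2) = 2 * (\<Sum>i\<in>UNIV. (norm (II x u (e i)))\<^sup>2)"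
    unfolding sym unfolding v_def by (simp add: D2r_tangent[OF assms(1)])
  have "v u \<bullet> D2r (f x) (v u) b = II x u u \<bullet> b" for b
    using D2r_symmetric_operator[OF assms(1), of b u "v u"] sym[of b] D2r_tangent[OF assms(1), of u u]
    by (simp add: v_def inner_commute)
  then show "(\<Sum>b\<in>Basis. (v u \<bullet> D2r (f x) (v u) b)\<^sup>2) = (norm (II x u u))\<^sup>2"
    by (simp add: sum_Basis_inner_sq)
  have "D3r (f x) (v u) b b = D3r (f x) b b (v u)" for b
    using D3r_sym[OF W, of "v u" b b] D3r_swap[OF W, of b "v u" b] by simp
  then have "(\<Sum>b\<in>Basis. v u \<bullet> D3r (f x) (v u) b b) = (\<Sum>b\<in>Basis. D3r (f x) b b (v u)) \<bullet> v u"
    by (simp add: inner_sum_left inner_sum_right inner_commute)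
  also have "\<dots> = - (\<Sum>i\<in>UNIV. II x u u \<bullet> II x (e i) (e i))"
    unfolding v_def derivative_Laplacian_tangent[OF assms(1)] Laplacian_eq[OF assms(1,2)]
    by (simp add: inner_sum_left inner_sum_right inner_commute)
  finally show "(\<Sum>b\<in>Basis. v u \<bullet> D3r (f x) (v u) b b) = - (\<Sum>i\<in>UNIV. II x u u \<bullet> II x (e i) (e i))" .
qed

text \<open>
  For a tangent vector \<open>v\<close>, the next definitions follow the squared length of its image under the
  differential of the retraction at \<open>w\<close>. The prefixes \<open>D\<close> and \<open>D2\<close> denote derivatives with respect to \<open>w\<close>
  in direction \<open>b\<close>, and \<open>D2_speed_powr\<close> belongs to the power of \<open>speed_sq\<close> with exponent \<open>q\<close>. Lengths are
  thus raised to the power \<open>2 * q\<close>, so \<open>q = 3\<close> is the critical exponent.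
\<close>

definition speed_sq :: "real^'q \<Rightarrow> real^'q \<Rightarrow> real" where "speed_sq w v = Dr w v \<bullet> Dr w v"
definition D_speed_sq :: "real^'q \<Rightarrow> real^'q \<Rightarrow> real^'q \<Rightarrow> real" where "D_speed_sq w v b = 2 * (Dr w v \<bullet> D2r w v b)"
definition D2_speed_sq :: "real^'q \<Rightarrow> real^'q \<Rightarrow> real^'q \<Rightarrow> real" where
  "D2_speed_sq w v b = 2 * ((norm (D2r w v b))\<^sup>2 + Dr w v \<bullet> D3r w v b b)"
definition D2_speed_powr :: "real^'q \<Rightarrow> real^'q \<Rightarrow> real^'q \<Rightarrow> real \<Rightarrow> real" where
  "D2_speed_powr w v b q = q * (q - 1) * speed_sq w v powr (q - 2) * (D_speed_sq w v b)\<^sup>2 + q * speed_sq w v powr (q - 1) * D2_speed_sq w v b"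

text \<open>
  Write \<open>B\<close> for the second fundamental form, \<open>H\<close> for its trace, and let \<open>v\<close> be a unit tangent vector. For
  sixth powers of lengths the sum is a positive multiple of
  \<open>4 |B v v|\<^sup>2 + 2 (\<Sum>i. |B v (e i)|\<^sup>2) - B v v \<bullet> H\<close>. Since \<open>|B v v|\<^sup>2 \<le> (\<Sum>i. |B v (e i)|\<^sup>2)\<close>, it is at most
  the expression with coefficient \<open>6 = 4 + 2\<close> that instability makes negative.
\<close>

lemma sum_D2_speed_powr_neg:
  assumes "x \<in> U" "unstable_at x" "u \<noteq> 0"
  shows "(\<Sum>b\<in>Basis. D2_speed_powr (f x) (Df x u) b 3) < 0"
proof -
  have W: "f x \<in> W" by (rule f_in_W[OF assms(1)])
  have lin: "linear (Df x)" by (rule Df_linear[OF U_subset_S[OF assms(1)]])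
  obtain e where e: "orthonormal_frame x e" using ex_orthonormal_frame[OF assms(1)] by metis
  define c where "c = norm (Df x u)"
  have "c > 0" using assms(3) Df_eq_0_iff[OF U_subset_S[OF assms(1)]] by (simp add: c_def)
  define u1 where "u1 = (1 / c) *\<^sub>R u"
  have n1: "norm (Df x u1) = 1" using \<open>c > 0\<close> by (simp add: u1_def linear_cmul[OF lin] c_def)
  have Du: "Df x u = c *\<^sub>R Df x u1" using \<open>c > 0\<close> by (simp add: u1_def linear_cmul[OF lin])
  define v where "v = Df x u1"
  have D3lin: "D3r (f x) (c *\<^sub>R v) b b = c *\<^sub>R D3r (f x) v b b" for b
  proof -
    have eq: "D3r (f x) v b b = D3r (f x) b b v" for v
      using D3r_sym[OF W, of v b b] D3r_swap[OF W, of b v b] by simp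
    show ?thesis unfolding eq using linear_cmul[OF has_derivative_linear[OF D2r_has_derivative[OF W]]] by simp
  qed
  let ?T = "\<lambda>b. 4 * (v \<bullet> D2r (f x) v b)\<^sup>2 + (norm (D2r (f x) v b))\<^sup>2 + v \<bullet> D3r (f x) v b b"
  have G: "D2_speed_powr (f x) (Df x u) b 3 = 6 * c ^ 6 * ?T b" for b
  proof -
    have D: "Dr (f x) (Df x u) = c *\<^sub>R v" unfolding Dr_tangent[OF assms(1)] v_def by (rule Du)
    have D2: "D2r (f x) (Df x u) b = c *\<^sub>R D2r (f x) v b"
      using linear_cmul[OF D2r_linear'[OF W, of b]] by (simp add: Du v_def)
    have D3: "D3r (f x) (Df x u) b b = c *\<^sub>R D3r (f x) v b b" using D3lin by (simp add: Du v_def)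
    have speed_sq: "speed_sq (f x) (Df x u) = c\<^sup>2" using n1 by (simp add: speed_sq_def D v_def norm_eq_1 power2_eq_square)
    have p1: "c\<^sup>2 powr (3 - 2) = c\<^sup>2" "c\<^sup>2 powr (3 - 1) = c ^ 4"
      using \<open>c > 0\<close> powr_realpow[of "c\<^sup>2" 2] by (simp_all add: powr_one flip: power_mult)
    show ?thesis
      unfolding D2_speed_powr_def speed_sq p1 D_speed_sq_def D2_speed_sq_def D D2 D3
      by (simp add: power_mult_distrib power2_eq_square algebra_simps eval_nat_numeral)
  qed
  have "(\<Sum>b\<in>Basis. ?T b) = 4 * (norm (II x u1 u1))\<^sup>2 + 2 * (\<Sum>i\<in>UNIV. (norm (II x u1 (e i)))\<^sup>2)
      - (\<Sum>i\<in>UNIV. II x u1 u1 \<bullet> II x (e i) (e i))"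
    using second_variation[OF assms(1) e, of u1] by (simp add: v_def sum.distrib flip: sum_distrib_left)
  also have "\<dots> \<le> 6 * (\<Sum>i\<in>UNIV. (norm (II x u1 (e i)))\<^sup>2) - (\<Sum>i\<in>UNIV. II x u1 u1 \<bullet> II x (e i) (e i))"
    using norm_II_le[OF assms(1) e, of u1] by (simp add: n1)
  also have "\<dots> = (\<Sum>i\<in>UNIV. 6 * (II x u1 (e i) \<bullet> II x u1 (e i)) - II x u1 u1 \<bullet> II x (e i) (e i))"
    by (simp add: sum_subtractf power2_norm_eq_inner flip: sum_distrib_left)
  also have "\<dots> < 0" using assms(2) e n1 by (auto simp: unstable_at_def)
  finally have "(\<Sum>b\<in>Basis. ?T b) < 0" .
  then show ?thesis using \<open>c > 0\<close> by (simp add: G mult_less_0_iff flip: sum_distrib_left)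
qed

end

section \<open>Small translations contract on average\<close>

context foot_patch
begin

lemma continuous_on_linear_family:
  fixes L :: "real^'q \<Rightarrow> real^'q \<Rightarrow> real^'q"
  assumes "\<And>w. w \<in> W \<Longrightarrow> linear (L w)" "\<And>c. continuous_on W (\<lambda>w. L w c)"
    "continuous_on A g" "continuous_on A h" "g ` A \<subseteq> W"
  shows "continuous_on A (\<lambda>z. L (g z) (h z))"
proof -
  have "continuous_on A (\<lambda>z. \<Sum>c\<in>Basis. (h z \<bullet> c) *\<^sub>R L (g z) c)"
    by (intro continuous_intros assms continuous_on_compose2[OF assms(2) assms(3,5)])
  then show ?thesis
    by (rule continuous_on_eq) (use assms(1,5) in \<open>auto intro!: linear_expand_Basis[symmetric]\<close>)
qed

lemma D3r_linear: "w \<in> W \<Longrightarrow> linear (\<lambda>a. D3r w a b b)"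
proof -
  assume W: "w \<in> W"
  have "(\<lambda>a. D3r w a b b) = D3r w b b"
    using D3r_sym[OF W, of _ b b] D3r_swap[OF W, of b _ b] by (simp add: fun_eq_iff)
  then show ?thesis using has_derivative_linear[OF D2r_has_derivative[OF W]] by simp
qed

text \<open>
  Away from zeros of \<open>Dr w v\<close>, real powers of \<open>speed_sq\<close> are smooth.
\<close>

definition nondegenerate :: "((real^'q) \<times> (real^'q) \<times> real) set" where
  "nondegenerate = {z. fst z \<in> W \<and> Dr (fst z) (fst (snd z)) \<noteq> 0}"

lemma continuous_on_Dr:
  "\<lbrakk>continuous_on A g; continuous_on A h; g ` A \<subseteq> W\<rbrakk> \<Longrightarrow> continuous_on A (\<lambda>z. Dr (g z) (h z))"
  by (rule continuous_on_linear_family[OF Dr_linear Ck_on_imp_continuous_on[OF Dr_Ck]])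

lemma open_nondegenerate: "open nondegenerate"
proof -
  have "continuous_on (W \<times> UNIV) (\<lambda>z. Dr (fst z) (fst (snd z)))"
    by (intro continuous_on_Dr continuous_intros) auto
  then have "open ((W \<times> UNIV) \<inter> (\<lambda>z. Dr (fst z) (fst (snd z))) -` (- {0}))"
    by (rule continuous_open_preimage) (auto simp: open_W open_Times)
  also have "(W \<times> UNIV) \<inter> (\<lambda>z. Dr (fst z) (fst (snd z))) -` (- {0}) = nondegenerate"
    by (auto simp: nondegenerate_def)
  finally show ?thesis .
qed

lemma continuous_on_D2_speed_powr: "continuous_on nondegenerate (\<lambda>z. D2_speed_powr (fst z) (fst (snd z)) b (snd (snd z)))"
proof -
  have sub: "fst ` nondegenerate \<subseteq> W" by (auto simp: nondegenerate_def)
  have 1: "continuous_on nondegenerate (\<lambda>z. Dr (fst z) (fst (snd z)))"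
    by (intro continuous_on_Dr continuous_intros sub)
  have 2: "continuous_on nondegenerate (\<lambda>z. D2r (fst z) (fst (snd z)) b)"
    by (intro continuous_on_linear_family[OF D2r_linear' Ck_on_imp_continuous_on[OF D2r_Ck]] continuous_intros sub)
  have 3: "continuous_on nondegenerate (\<lambda>z. D3r (fst z) (fst (snd z)) b b)"
    by (intro continuous_on_linear_family[OF D3r_linear Ck_on_imp_continuous_on[OF D3r_Ck]] continuous_intros sub)
  show ?thesis
    unfolding D2_speed_powr_def speed_sq_def D_speed_sq_def D2_speed_sq_def
    by (intro continuous_intros 1 2 3) (auto simp: nondegenerate_def)
qed

text \<open>
  The second variation is continuous in the base point, the vector, the step and the exponent, so it stays
  negative nearby. A separate bound \<open>M b\<close> for each direction is needed because the Taylor expansions run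
  along different lines, each with its own intermediate point.
\<close>

lemma D2_speed_powr_locally_bounded:
  assumes "x \<in> U" "unstable_at x" "u \<noteq> 0"
  obtains \<epsilon> M where "\<epsilon> > 0" "(\<Sum>b\<in>Basis. M b) < 0"
    "\<And>x' u' t q b. \<lbrakk>dist x' x < \<epsilon>; dist u' u < \<epsilon>; \<bar>t\<bar> < \<epsilon>; \<bar>q - 3\<bar> < \<epsilon>; b \<in> Basis\<rbrakk> \<Longrightarrow>
      x' \<in> U \<and> (f x' + t *\<^sub>R b, Df x' u', q) \<in> nondegenerate \<and> D2_speed_powr (f x' + t *\<^sub>R b) (Df x' u') b q \<le> M b"
proof -
  define g0 where "g0 b = D2_speed_powr (f x) (Df x u) b 3" for b
  define c where "c = - (\<Sum>b\<in>Basis. g0 b) / (2 * DIM(real^'q))"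
  have neg: "(\<Sum>b\<in>Basis. g0 b) < 0" unfolding g0_def by (rule sum_D2_speed_powr_neg[OF assms])
  then have "c > 0" by (simp add: c_def divide_neg_pos)
  have DIM: "real DIM(real^'q) > 0" by simp
  let ?z0 = "(x, u, 0::real, 3::real)"
  define \<kappa> where "\<kappa> b z = (f (fst z) + fst (snd (snd z)) *\<^sub>R b, Df (fst z) (fst (snd z)), snd (snd (snd z)))"
    for b :: "real^'q" and z :: "(real^'m) \<times> (real^'m) \<times> real \<times> real"
  have US: "U \<subseteq> S" using U_subset_S by auto
  have contf: "continuous_on U f" and contDf: "continuous_on U (\<lambda>x. Df x v)" for v
    using Ck_on_imp_continuous_on[OF smooth] Ck_on_imp_continuous_on[OF Df_Ck] continuous_on_subset US by blast+
  have cont\<kappa>: "isCont (\<kappa> b) ?z0" for b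
  proof -
    have "continuous_on (U \<times> UNIV) (\<lambda>z. Df (fst z) (fst (snd z)) :: real^'q)"
    proof -
      have "continuous_on (U \<times> UNIV) (\<lambda>z. \<Sum>c\<in>Basis. (fst (snd z) \<bullet> c) *\<^sub>R Df (fst z) c)"
        by (intro continuous_intros continuous_on_compose2[OF contDf]) auto
      then show ?thesis
        by (rule continuous_on_eq) (use US in \<open>auto intro!: linear_expand_Basis[symmetric] Df_linear\<close>)
    qed
    then have "continuous_on (U \<times> UNIV) (\<kappa> b)"
      unfolding \<kappa>_def by (intro continuous_intros continuous_on_compose2[OF contf]) auto
    then show ?thesis
      using assms(1) open_U by (subst (asm) continuous_on_eq_continuous_at) (auto simp: open_Times)
  qed
  have \<kappa>0: "\<kappa> b ?z0 = (f x, Df x u, 3)" for b by (simp add: \<kappa>_def)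
  have innondegenerate: "(f x, Df x u, 3) \<in> nondegenerate"
    using f_in_W[OF assms(1)] Dr_tangent[OF assms(1)] Df_eq_0_iff[OF U_subset_S[OF assms(1)]] assms(3)
    by (simp add: nondegenerate_def)
  have ev: "eventually (\<lambda>z. \<kappa> b z \<in> nondegenerate \<and>
      D2_speed_powr (fst (\<kappa> b z)) (fst (snd (\<kappa> b z))) b (snd (snd (\<kappa> b z))) < g0 b + c) (nhds ?z0)" for b
  proof -
    have lim: "(\<kappa> b \<longlongrightarrow> (f x, Df x u, 3)) (nhds ?z0)"
      using cont\<kappa>[of b] tendsto_at_iff_tendsto_nhds[of "\<kappa> b" ?z0] by (simp add: isCont_def \<kappa>0)
    have "isCont (\<lambda>z. D2_speed_powr (fst z) (fst (snd z)) b (snd (snd z))) (f x, Df x u, 3)"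
      using continuous_on_D2_speed_powr[of b] innondegenerate open_nondegenerate by (simp add: continuous_on_eq_continuous_at)
    from isCont_tendsto_compose[OF this lim]
    have "((\<lambda>z. D2_speed_powr (fst (\<kappa> b z)) (fst (snd (\<kappa> b z))) b (snd (snd (\<kappa> b z)))) \<longlongrightarrow> g0 b) (nhds ?z0)"
      by (simp add: g0_def)
    from order_tendstoD(2)[OF this, of "g0 b + c"] topological_tendstoD[OF lim open_nondegenerate innondegenerate] \<open>c > 0\<close>
    show ?thesis by (auto intro: eventually_conj)
  qed
  have "eventually (\<lambda>z. fst z \<in> U) (nhds ?z0)"
    using eventually_nhds_in_open[of "U \<times> UNIV" ?z0] open_U assms(1)
    by (auto simp: open_Times elim: eventually_mono)
  moreover have "eventually (\<lambda>z. \<forall>b\<in>Basis. \<kappa> b z \<in> nondegenerate \<and>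
      D2_speed_powr (fst (\<kappa> b z)) (fst (snd (\<kappa> b z))) b (snd (snd (\<kappa> b z))) < g0 b + c) (nhds ?z0)"
    by (intro eventually_ball_finite ballI ev finite_Basis)
  ultimately have "eventually (\<lambda>z. fst z \<in> U \<and> (\<forall>b\<in>Basis. \<kappa> b z \<in> nondegenerate \<and>
      D2_speed_powr (fst (\<kappa> b z)) (fst (snd (\<kappa> b z))) b (snd (snd (\<kappa> b z))) < g0 b + c)) (nhds ?z0)"
    by (rule eventually_conj)
  then obtain d where d: "d > 0" "\<And>z. dist z ?z0 < d \<Longrightarrow> fst z \<in> U \<and> (\<forall>b\<in>Basis. \<kappa> b z \<in> nondegenerate \<and>
      D2_speed_powr (fst (\<kappa> b z)) (fst (snd (\<kappa> b z))) b (snd (snd (\<kappa> b z))) < g0 b + c)"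
    unfolding eventually_nhds_metric by blast
  show ?thesis
  proof (rule that[of "d/4" "\<lambda>b. g0 b + c"])
    have "(\<Sum>b\<in>Basis. g0 b + c) = (\<Sum>b\<in>Basis. g0 b) + DIM(real^'q) * c" by (simp add: sum.distrib)
    also have "DIM(real^'q) * c = - (\<Sum>b\<in>Basis. g0 b) / 2" using DIM unfolding c_def by (simp del: DIM_cart)
    finally show "(\<Sum>b\<in>Basis. g0 b + c) < 0" using neg by simp
    fix x' u' t q and b :: "real^'q"
    assume near: "dist x' x < d/4" "dist u' u < d/4" "\<bar>t\<bar> < d/4" "\<bar>q - 3\<bar> < d/4" and b: "b \<in> Basis"
    have pair: "dist (a, b) (a', b') \<le> dist a a' + dist b b'" for a a' :: "'x::metric_space" and b b' :: "'y::metric_space"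
      unfolding dist_Pair_Pair by (rule sqrt_sum_squares_le_sum) auto
    have "dist (x', u', t, q) ?z0 \<le> dist x' x + (dist u' u + (dist t 0 + dist q 3))"
      by (rule order_trans[OF pair add_left_mono[OF order_trans[OF pair add_left_mono[OF pair]]]])
    also have "\<dots> < d" using near by (simp add: dist_real_def)
    finally show "x' \<in> U \<and> (f x' + t *\<^sub>R b, Df x' u', q) \<in> nondegenerate \<and> D2_speed_powr (f x' + t *\<^sub>R b) (Df x' u') b q \<le> g0 b + c"
      using d(2)[of "(x', u', t, q)"] b by (auto simp: \<kappa>_def less_imp_le)
  qed (use d(1) in auto)
qed

lemma D2_speed_powr_uniformly_bounded:
  assumes "x \<in> U" "unstable_at x"
  obtains \<epsilon> where "\<epsilon> > 0" 
    "\<And>x' u' q. \<lbrakk>dist x' x < \<epsilon>; norm u' = 1; \<bar>q - 3\<bar> < \<epsilon>\<rbrakk> \<Longrightarrow> x' \<in> U \<and> (\<exists>M. (\<Sum>b\<in>Basis. M b) < 0 \<and>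
       (\<forall>t. \<bar>t\<bar> < \<epsilon> \<longrightarrow> (\<forall>b\<in>Basis. (f x' + t *\<^sub>R b, Df x' u', q) \<in> nondegenerate \<and> D2_speed_powr (f x' + t *\<^sub>R b) (Df x' u') b q \<le> M b)))"
proof -
  have "\<forall>u\<in>sphere 0 1. \<exists>\<epsilon> M. \<epsilon> > 0 \<and> (\<Sum>b\<in>Basis. M b) < 0 \<and>
    (\<forall>x' u' t q. dist x' x < \<epsilon> \<longrightarrow> dist u' u < \<epsilon> \<longrightarrow> \<bar>t\<bar> < \<epsilon> \<longrightarrow> \<bar>q - 3\<bar> < \<epsilon> \<longrightarrow> (\<forall>b\<in>Basis.
      x' \<in> U \<and> (f x' + t *\<^sub>R b, Df x' u', q) \<in> nondegenerate \<and> D2_speed_powr (f x' + t *\<^sub>R b) (Df x' u') b q \<le> M b))"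
  proof
    fix u :: "real^'m" assume "u \<in> sphere 0 1"
    then have "u \<noteq> 0" by auto
    from D2_speed_powr_locally_bounded[OF assms this] show "\<exists>\<epsilon> M. \<epsilon> > 0 \<and> (\<Sum>b\<in>Basis. M b) < 0 \<and>
      (\<forall>x' u' t q. dist x' x < \<epsilon> \<longrightarrow> dist u' u < \<epsilon> \<longrightarrow> \<bar>t\<bar> < \<epsilon> \<longrightarrow> \<bar>q - 3\<bar> < \<epsilon> \<longrightarrow> (\<forall>b\<in>Basis.
        x' \<in> U \<and> (f x' + t *\<^sub>R b, Df x' u', q) \<in> nondegenerate \<and> D2_speed_powr (f x' + t *\<^sub>R b) (Df x' u') b q \<le> M b))"
      by metis
  qed
  then obtain \<epsilon> M where \<epsilon>: "\<And>u::real^'m. u \<in> sphere 0 1 \<Longrightarrow> \<epsilon> u > 0" "\<And>u::real^'m. u \<in> sphere 0 1 \<Longrightarrow> (\<Sum>b\<in>Basis. M u b) < 0"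
    "\<And>(u::real^'m) x' (u'::real^'m) t q b. \<lbrakk>u \<in> sphere 0 1; dist x' x < \<epsilon> u; dist u' u < \<epsilon> u; \<bar>t\<bar> < \<epsilon> u; \<bar>q - 3\<bar> < \<epsilon> u; b \<in> Basis\<rbrakk> \<Longrightarrow>
      x' \<in> U \<and> (f x' + t *\<^sub>R b, Df x' u', q) \<in> nondegenerate \<and> D2_speed_powr (f x' + t *\<^sub>R b) (Df x' u') b q \<le> M u b"
    by metis
  obtain D where D: "D \<subseteq> sphere 0 1" "finite D" "sphere 0 1 \<subseteq> (\<Union>u\<in>D. ball u (\<epsilon> u))"
    by (rule compactE_image[of "sphere (0::real^'m) 1" "sphere 0 1" "\<lambda>u. ball u (\<epsilon> u)"])
      (use \<epsilon>(1) in \<open>auto simp: compact_sphere\<close>)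
  define e where "e = Min (insert 1 (\<epsilon> ` D))"
  have e: "e > 0" "\<And>u. u \<in> D \<Longrightarrow> e \<le> \<epsilon> u" using D \<epsilon>(1) by (auto simp: e_def)
  show ?thesis
  proof (rule that[OF e(1)])
    fix x' u' :: "real^'m" and q :: real
    assume near: "dist x' x < e" "norm u' = 1" "\<bar>q - 3\<bar> < e"
    then obtain u where u: "u \<in> D" "dist u' u < \<epsilon> u" using D(3) by (force simp: dist_commute)
    have uS: "u \<in> sphere 0 1" using u D by auto
    have *: "x' \<in> U \<and> (f x' + t *\<^sub>R b, Df x' u', q) \<in> nondegenerate \<and> D2_speed_powr (f x' + t *\<^sub>R b) (Df x' u') b q \<le> M u b"
      if "\<bar>t\<bar> < e" "b \<in> Basis" for t b
      by (rule \<epsilon>(3)[OF uS _ u(2)]) (use near that e(2)[OF u(1)] in auto)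
    obtain b :: "real^'q" where "b \<in> Basis" using nonempty_Basis by blast
    then have "x' \<in> U" using *[of 0 b] e(1) by simp
    then show "x' \<in> U \<and> (\<exists>M. (\<Sum>b\<in>Basis. M b) < 0 \<and>
       (\<forall>t. \<bar>t\<bar> < e \<longrightarrow> (\<forall>b\<in>Basis. (f x' + t *\<^sub>R b, Df x' u', q) \<in> nondegenerate \<and> D2_speed_powr (f x' + t *\<^sub>R b) (Df x' u') b q \<le> M b)))"
      using * \<epsilon>(2)[OF uS] by blast
  qed
qed

text \<open>
  Taylor's formula for the even function \<open>s \<mapsto> g s + g (- s)\<close>, where \<open>g s\<close> is the power of the length at
  \<open>f x + s *\<^sub>R b\<close>: the first-order terms cancel.
\<close>

lemma norm_powr_second_order:
  assumes x: "x \<in> U" and t: "0 < t" "t < e"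
    and nondegenerate: "\<And>s. \<bar>s\<bar> < e \<Longrightarrow> (f x + s *\<^sub>R b, Df x u, q) \<in> nondegenerate"
    and M: "\<And>s. \<bar>s\<bar> < e \<Longrightarrow> D2_speed_powr (f x + s *\<^sub>R b) (Df x u) b q \<le> M"
  shows "norm (Dr (f x + t *\<^sub>R b) (Df x u)) powr (2 * q) + norm (Dr (f x - t *\<^sub>R b) (Df x u)) powr (2 * q)
    \<le> 2 * norm (Df x u) powr (2 * q) + M * t\<^sup>2"
proof -
  define v where "v = Df x u"
  define w where "w s = f x + s *\<^sub>R b" for s
  have wW: "w s \<in> W" and D0: "Dr (w s) v \<noteq> 0" if "\<bar>s\<bar> < e" for s
    using nondegenerate[OF that] by (auto simp: w_def v_def nondegenerate_def)
  have line: "((\<lambda>s. F (w s)) has_vector_derivative F' b) (at s)"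
    if "(F has_derivative F') (at (w s))" for F :: "real^'q \<Rightarrow> real^'q" and F' s
  proof -
    have "((\<lambda>s. F (w s)) has_derivative (\<lambda>h. F' (h *\<^sub>R b))) (at s)"
      unfolding w_def
      by (rule has_derivative_compose[of "\<lambda>s. f x + s *\<^sub>R b" "\<lambda>h. h *\<^sub>R b" s UNIV F F'])
        (use that in \<open>auto simp: w_def intro!: derivative_eq_intros\<close>)
    moreover have "F' (h *\<^sub>R b) = h *\<^sub>R F' b" for h
      using linear_cmul[OF has_derivative_linear[OF that]] .
    ultimately show ?thesis by (simp add: has_vector_derivative_def)
  qed
  have inner: "((\<lambda>s. A s \<bullet> B s) has_real_derivative (A s \<bullet> B' + A' \<bullet> B s)) (at s)"
    if "(A has_vector_derivative A') (at s)" "(B has_vector_derivative B') (at s)"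
    for A B :: "real \<Rightarrow> real^'q" and A' B' s
  proof -
    have "((\<lambda>s. A s \<bullet> B s) has_derivative (\<lambda>h. A s \<bullet> (h *\<^sub>R B') + (h *\<^sub>R A') \<bullet> B s)) (at s)"
      using that unfolding has_vector_derivative_def by (rule has_derivative_inner)
    moreover have "(\<lambda>h. A s \<bullet> (h *\<^sub>R B') + (h *\<^sub>R A') \<bullet> B s) = (*) (A s \<bullet> B' + A' \<bullet> B s)"
      by (auto simp: fun_eq_iff algebra_simps)
    ultimately show ?thesis by (simp add: has_field_derivative_def)
  qed
  have \<phi>d: "((\<lambda>s. speed_sq (w s) v) has_real_derivative D_speed_sq (w s) v b) (at s)" if "\<bar>s\<bar> < e" for s
    using inner[OF line line, OF Dr_has_derivative Dr_has_derivative, OF wW[OF that] wW[OF that], of v v]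
    by (simp add: speed_sq_def D_speed_sq_def inner_commute)
  have \<phi>1d: "((\<lambda>s. D_speed_sq (w s) v b) has_real_derivative D2_speed_sq (w s) v b) (at s)" if "\<bar>s\<bar> < e" for s
    using DERIV_cmult[OF inner[OF line line, OF Dr_has_derivative D2r_has_derivative, OF wW[OF that] wW[OF that], of v v b], of 2]
    by (simp add: D_speed_sq_def D2_speed_sq_def power2_norm_eq_inner algebra_simps)
  have \<phi>pos: "speed_sq (w s) v > 0" if "\<bar>s\<bar> < e" for s using D0[OF that] by (simp add: speed_sq_def)
  define g where "g s = speed_sq (w s) v powr q" for s
  define g1 where "g1 s = q * speed_sq (w s) v powr (q - 1) * D_speed_sq (w s) v b" for s
  define g2 where "g2 s = D2_speed_powr (w s) v b q" for s
  have gd: "(g has_real_derivative g1 s) (at s)" if "\<bar>s\<bar> < e" for s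
    using DERIV_fun_powr[OF \<phi>d[OF that] \<phi>pos[OF that], of q] by (simp add: g_def[abs_def] g1_def)
  have g1d: "(g1 has_real_derivative g2 s) (at s)" if "\<bar>s\<bar> < e" for s
  proof -
    have "((\<lambda>s. q * speed_sq (w s) v powr (q - 1)) has_real_derivative
        q * ((q - 1) * speed_sq (w s) v powr (q - 1 - 1) * D_speed_sq (w s) v b)) (at s)"
      using DERIV_cmult[OF DERIV_fun_powr[OF \<phi>d[OF that] \<phi>pos[OF that], of "q - 1"], of q] by simp
    from DERIV_mult[OF this \<phi>1d[OF that]] show ?thesis
      by (simp add: g1_def[abs_def] g2_def D2_speed_powr_def power2_eq_square algebra_simps)
  qed
  have "g t + g (- t) \<le> (g 0 + g (- 0)) + 2 * M * t\<^sup>2 / 2"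
  proof (rule second_order_bound[where H = "\<lambda>s. g s + g (- s)" and ?H1.0 = "\<lambda>s. g1 s - g1 (- s)"
        and ?H2.0 = "\<lambda>s. g2 s + g2 (- s)"])
    fix s assume s: "0 \<le> s" "s \<le> t"
    have m: "\<bar>s\<bar> < e" "\<bar>- s\<bar> < e" using s t by auto
    show "((\<lambda>s. g s + g (- s)) has_real_derivative g1 s - g1 (- s)) (at s)"
      using DERIV_add[OF gd[OF m(1)] gd[OF m(2), unfolded DERIV_mirror]] by simp
    show "((\<lambda>s. g1 s - g1 (- s)) has_real_derivative g2 s + g2 (- s)) (at s)"
      using DERIV_diff[OF g1d[OF m(1)] g1d[OF m(2), unfolded DERIV_mirror]] by simp
    show "g2 s + g2 (- s) \<le> 2 * M" using M[OF m(1)] M[OF m(2)] by (simp add: g2_def w_def v_def)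
  qed (use t in auto)
  moreover have "g s = norm (Dr (w s) v) powr (2 * q)" if "\<bar>s\<bar> < e" for s
    using D0[OF that] powr_powr[of "norm (Dr (w s) v)" 2 q]
    by (simp add: g_def speed_sq_def dot_square_norm)
  moreover have "w t = f x + t *\<^sub>R b" "w (- t) = f x - t *\<^sub>R b" "w 0 = f x" by (auto simp: w_def)
  moreover have "Dr (f x) v = v" unfolding v_def by (rule Dr_tangent[OF x])
  ultimately show ?thesis using t by (simp add: v_def)
qed

text \<open>
  Over all directions \<open>b\<close> and \<open>- b\<close> the second-order terms add up to a negative number. Both sides are
  homogeneous of degree \<open>p\<close> in \<open>u\<close>, so unit vectors suffice. The negativity at the exponent \<open>6\<close> extends to
  exponents slightly above \<open>6\<close>; that gain decides the matter for cubes of dimension \<open>6\<close>.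
\<close>

theorem moves_contract_infinitesimally:
  assumes "x \<in> U" "unstable_at x"
  obtains \<epsilon> where "\<epsilon> > 0"
    "\<And>x' u t p. \<lbrakk>dist x' x < \<epsilon>; u \<noteq> 0; 0 < t; t < \<epsilon>; \<bar>p - 6\<bar> < \<epsilon>\<rbrakk> \<Longrightarrow> x' \<in> U \<and>
      (\<forall>b\<in>Basis. f x' + t *\<^sub>R b \<in> W \<and> f x' - t *\<^sub>R b \<in> W) \<and>
      (\<Sum>b\<in>Basis. norm (Dr (f x' + t *\<^sub>R b) (Df x' u)) powr p + norm (Dr (f x' - t *\<^sub>R b) (Df x' u)) powr p)
        < 2 * DIM(real^'q) * norm (Df x' u) powr p"
proof -
  obtain \<epsilon> where "\<epsilon> > 0" and \<epsilon>:
    "\<And>x' u' q. \<lbrakk>dist x' x < \<epsilon>; norm u' = 1; \<bar>q - 3\<bar> < \<epsilon>\<rbrakk> \<Longrightarrow> x' \<in> U \<and> (\<exists>M. (\<Sum>b\<in>Basis. M b) < 0 \<and>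
       (\<forall>t. \<bar>t\<bar> < \<epsilon> \<longrightarrow> (\<forall>b\<in>Basis. (f x' + t *\<^sub>R b, Df x' u', q) \<in> nondegenerate \<and> D2_speed_powr (f x' + t *\<^sub>R b) (Df x' u') b q \<le> M b)))"
    using D2_speed_powr_uniformly_bounded[OF assms] by blast
  show ?thesis
  proof (rule that[OF \<open>\<epsilon> > 0\<close>])
    fix x' u :: "real^'m" and t p :: real
    assume near: "dist x' x < \<epsilon>" "u \<noteq> 0" "0 < t" "t < \<epsilon>" "\<bar>p - 6\<bar> < \<epsilon>"
    define c where "c = norm u"
    define u1 where "u1 = (1 / c) *\<^sub>R u"
    have c: "c > 0" "norm u1 = 1" "u = c *\<^sub>R u1" using near(2) by (auto simp: c_def u1_def)
    have q: "\<bar>p / 2 - 3\<bar> < \<epsilon>" using near(5) by (simp add: abs_if split: if_splits)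
    obtain M where x': "x' \<in> U" and M: "(\<Sum>b\<in>Basis. M b) < 0"
      "\<And>t b. \<bar>t\<bar> < \<epsilon> \<Longrightarrow> b \<in> Basis \<Longrightarrow> (f x' + t *\<^sub>R b, Df x' u1, p / 2) \<in> nondegenerate"
      "\<And>t b. \<bar>t\<bar> < \<epsilon> \<Longrightarrow> b \<in> Basis \<Longrightarrow> D2_speed_powr (f x' + t *\<^sub>R b) (Df x' u1) b (p / 2) \<le> M b"
      using \<epsilon>[OF near(1) c(2) q] by blast
    have W: "f x' + s *\<^sub>R b \<in> W" if "\<bar>s\<bar> < \<epsilon>" "b \<in> Basis" for s b using M(2)[OF that] by (simp add: nondegenerate_def)
    have W2: "f x' + t *\<^sub>R b \<in> W" "f x' - t *\<^sub>R b \<in> W" if "b \<in> Basis" for b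
      using W[of t b] W[of "- t" b] that near by auto
    let ?S = "\<lambda>u. \<Sum>b\<in>Basis. norm (Dr (f x' + t *\<^sub>R b) (Df x' u)) powr p + norm (Dr (f x' - t *\<^sub>R b) (Df x' u)) powr p"
    have "?S u1 \<le> (\<Sum>b\<in>Basis. 2 * norm (Df x' u1) powr p + M b * t\<^sup>2)"
    proof (rule sum_mono)
      fix b :: "real^'q" assume b: "b \<in> Basis"
      show "norm (Dr (f x' + t *\<^sub>R b) (Df x' u1)) powr p + norm (Dr (f x' - t *\<^sub>R b) (Df x' u1)) powr p
        \<le> 2 * norm (Df x' u1) powr p + M b * t\<^sup>2"
        using norm_powr_second_order[OF x' near(3,4) M(2) M(3), of b] b by simp
    qed
    also have "\<dots> = 2 * DIM(real^'q) * norm (Df x' u1) powr p + (\<Sum>b\<in>Basis. M b) * t\<^sup>2"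
      by (simp add: sum.distrib sum_distrib_right)
    also have "\<dots> < 2 * DIM(real^'q) * norm (Df x' u1) powr p"
      using M(1) near(3) by (simp add: mult_neg_pos)
    finally have less: "?S u1 < 2 * DIM(real^'q) * norm (Df x' u1) powr p" .
    have Du: "Df x' u = c *\<^sub>R Df x' u1"
      unfolding c(3) by (rule linear_cmul[OF Df_linear[OF U_subset_S[OF x']]])
    have "?S u = (\<Sum>b\<in>Basis. c powr p * (norm (Dr (f x' + t *\<^sub>R b) (Df x' u1)) powr p
        + norm (Dr (f x' - t *\<^sub>R b) (Df x' u1)) powr p))"
    proof (rule sum.cong[OF refl])
      fix b :: "real^'q" assume b: "b \<in> Basis"
      show "norm (Dr (f x' + t *\<^sub>R b) (Df x' u)) powr p + norm (Dr (f x' - t *\<^sub>R b) (Df x' u)) powr p =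
        c powr p * (norm (Dr (f x' + t *\<^sub>R b) (Df x' u1)) powr p + norm (Dr (f x' - t *\<^sub>R b) (Df x' u1)) powr p)"
        unfolding Du using W2[OF b] c(1)
        by (simp add: linear_cmul[OF Dr_linear] powr_mult distrib_left)
    qed
    also have "\<dots> = c powr p * ?S u1" by (simp add: sum_distrib_left)
    also have "\<dots> < c powr p * (2 * DIM(real^'q) * norm (Df x' u1) powr p)"
      using less c(1) by (intro mult_strict_left_mono) auto
    also have "\<dots> = 2 * DIM(real^'q) * norm (Df x' u) powr p"
      using c(1) by (simp add: Du powr_mult)
    finally show "x' \<in> U \<and> (\<forall>b\<in>Basis. f x' + t *\<^sub>R b \<in> W \<and> f x' - t *\<^sub>R b \<in> W) \<and>
      ?S u < 2 * DIM(real^'q) * norm (Df x' u) powr p"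
      using x' W2 by blast
  qed
qed

end

section \<open>Interpolation by projected convex combinations\<close>

lemma compact_space_positive_lower_bound:
  assumes "compact_space Z" "closedin Z C" "continuous_map Z euclideanreal g" "\<And>z. z \<in> C \<Longrightarrow> g z > 0"
  obtains e :: real where "e > 0" "\<And>z. z \<in> C \<Longrightarrow> e \<le> g z"
proof (cases "C = {}")
  case True
  then show ?thesis using that[of 1] by auto
next
  case False
  have "compactin Z C" using assms closedin_compact_space by blast
  then have "compact (g ` C)" using image_compactin[OF _ assms(3)] by fastforce
  then obtain z where "z \<in> C" "\<And>y. y \<in> C \<Longrightarrow> g z \<le> g y"
    using compact_attains_inf[of "g ` C"] False by auto
  then show ?thesis using that[of "g z"] assms(4) by blast
qed

lemma continuous_map_scaleR_vector:
  fixes g :: "'a \<Rightarrow> 'b::real_normed_vector"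
  assumes "continuous_map X euclideanreal c" "continuous_map X euclidean g"
  shows "continuous_map X euclidean (\<lambda>x. c x *\<^sub>R g x)"
proof -
  have "continuous_map X (prod_topology euclideanreal euclidean) (\<lambda>x. (c x, g x))"
    using assms by (intro continuous_map_pairedI)
  then have 1: "continuous_map X euclidean (\<lambda>x. (c x, g x))" by (simp add: euclidean_product_topology)
  have 2: "continuous_map euclidean euclidean (\<lambda>(a::real, b::'b). a *\<^sub>R b)"
    by (auto simp: case_prod_beta intro!: continuous_intros)
  show ?thesis using continuous_map_compose[OF 1 2] by (simp add: o_def)
qed

definition partition :: "'t topology \<Rightarrow> 'v set \<Rightarrow> ('v \<Rightarrow> 't \<Rightarrow> real) \<Rightarrow> bool" where
  "partition T V w \<longleftrightarrow> finite V \<and> (\<forall>v\<in>V. continuous_map T euclideanreal (w v)) \<and>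
     (\<forall>t\<in>topspace T. (\<forall>v\<in>V. 0 \<le> w v t) \<and> (\<Sum>v\<in>V. w v t) = 1)"

definition adjacent :: "'t topology \<Rightarrow> 'v set \<Rightarrow> ('v \<Rightarrow> 't \<Rightarrow> real) \<Rightarrow> ('v \<times> 'v) set" where
  "adjacent T V w = {(u, v). u \<in> V \<and> v \<in> V \<and> (\<exists>t\<in>topspace T. w u t > 0 \<and> w v t > 0)}"

text \<open>
  During the homotopies below the boundary may travel, but at each time it is mapped to a single point.
\<close>

definition const_on :: "'t set \<Rightarrow> ('t \<Rightarrow> 'b) \<Rightarrow> bool" where
  "const_on B f \<longleftrightarrow> (\<exists>c. \<forall>t\<in>B. f t = c)"

text \<open>
  \<open>\<rho> x w\<close> stands for the point of \<open>M\<close> near \<open>x\<close> whose image is nearest to \<open>w\<close>. As \<open>F\<close> may have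
  self-intersections, the projection depends on a starting point \<open>x\<close>, which singles out a sheet; nearby
  starting points give the same result.
\<close>

locale tubular_immersion = Metric_space M d for M :: "'a set" and d +
  fixes F :: "'a \<Rightarrow> 'w::euclidean_space" and \<rho> :: "'a \<Rightarrow> 'w \<Rightarrow> 'a" and \<delta> \<eta> :: real
  assumes compact_M: "compact_space mtopology"
    and F_continuous: "continuous_map mtopology euclidean F"
    and \<delta>_pos: "0 < \<delta>" and \<eta>_pos: "0 < \<eta>"
    and F_near: "\<lbrakk>x \<in> M; y \<in> M; d x y < \<delta>\<rbrakk> \<Longrightarrow> norm (F y - F x) < \<eta>"
    and \<rho>_F: "\<lbrakk>x \<in> M; y \<in> M; d x y < \<delta>\<rbrakk> \<Longrightarrow> \<rho> x (F y) = y"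
    and \<rho>_continuous: "continuous_map
      (subtopology (prod_topology mtopology euclidean) {(x, w). norm (w - F x) < \<eta>}) mtopology (\<lambda>(x, w). \<rho> x w)"
    and \<rho>_indep: "\<lbrakk>x \<in> M; y \<in> M; d x y < \<delta>; norm (w - F x) < \<eta>; norm (w - F y) < \<eta>\<rbrakk> \<Longrightarrow> \<rho> x w = \<rho> y w"
begin

lemma \<rho>_continuous_compose:
  assumes "continuous_map Z mtopology f" "continuous_map Z euclidean g"
    "\<And>z. z \<in> topspace Z \<Longrightarrow> norm (g z - F (f z)) < \<eta>"
  shows "continuous_map Z mtopology (\<lambda>z. \<rho> (f z) (g z))"
proof -
  have "continuous_map Z (subtopology (prod_topology mtopology euclidean) {(x, w). norm (w - F x) < \<eta>}) (\<lambda>z. (f z, g z))"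
    using assms by (auto intro!: continuous_map_into_subtopology continuous_map_pairedI)
  from continuous_map_compose[OF this \<rho>_continuous] show ?thesis by (simp add: o_def)
qed

definition compatible :: "'v set \<Rightarrow> ('v \<Rightarrow> real) \<Rightarrow> ('v \<Rightarrow> 'a) \<Rightarrow> bool" where
  "compatible V w h \<longleftrightarrow> finite V \<and> (\<forall>v\<in>V. 0 \<le> w v) \<and> sum w V = 1 \<and> (\<forall>v\<in>V. h v \<in> M) \<and>
     (\<forall>u\<in>V. \<forall>v\<in>V. w u > 0 \<and> w v > 0 \<longrightarrow> d (h u) (h v) < \<delta>)"

text \<open>
  The convex combination of the images of the values \<open>h v\<close>, projected back to \<open>M\<close>. The starting point of
  the projection is any vertex of positive weight; \<open>blend_eq\<close> shows that the choice is immaterial.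
\<close>

definition blend :: "'v set \<Rightarrow> ('v \<Rightarrow> real) \<Rightarrow> ('v \<Rightarrow> 'a) \<Rightarrow> 'a" where
  "blend V w h = \<rho> (h (SOME v. v \<in> V \<and> w v > 0)) (\<Sum>v\<in>V. w v *\<^sub>R F (h v))"

lemma compatible_ex_pos:
  assumes "compatible V w h"
  shows "\<exists>v. v \<in> V \<and> w v > 0"
proof (rule ccontr)
  assume "\<not> ?thesis"
  then have "sum w V = 0" using assms by (intro sum.neutral) (force simp: compatible_def)
  then show False using assms by (simp add: compatible_def)
qed

text \<open>
  The images of the values of positive weight lie in a common ball, which is convex.
\<close>

lemma compatible_sum_near:
  assumes "compatible V w h" "v \<in> V" "w v > 0"
  shows "norm ((\<Sum>u\<in>V. w u *\<^sub>R F (h u)) - F (h v)) < \<eta>"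
proof -
  define y where "y u = (if w u > 0 then F (h u) else F (h v))" for u
  have "(\<Sum>u\<in>V. w u *\<^sub>R F (h u)) = (\<Sum>u\<in>V. w u *\<^sub>R y u)"
    using assms by (intro sum.cong refl) (force simp: y_def compatible_def)
  also have "\<dots> \<in> ball (F (h v)) \<eta>"
  proof (intro convex_sum convex_ball)
    show "y u \<in> ball (F (h v)) \<eta>" if "u \<in> V" for u
      using that assms F_near[of "h v" "h u"] \<eta>_pos
      by (auto simp: y_def compatible_def dist_norm norm_minus_commute)
  qed (use assms in \<open>auto simp: compatible_def\<close>)
  finally show ?thesis by (simp add: dist_norm norm_minus_commute)
qed

lemma blend_eq:
  assumes "compatible V w h" "v \<in> V" "w v > 0"
  shows "blend V w h = \<rho> (h v) (\<Sum>u\<in>V. w u *\<^sub>R F (h u))"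
proof -
  define u where "u = (SOME v. v \<in> V \<and> w v > 0)"
  have u: "u \<in> V" "w u > 0" unfolding u_def using someI_ex[OF compatible_ex_pos[OF assms(1)]] by auto
  show ?thesis unfolding blend_def u_def[symmetric]
    using assms u by (intro \<rho>_indep compatible_sum_near) (auto simp: compatible_def)
qed

lemma blend_const:
  assumes "compatible V w h" "\<And>v. v \<in> V \<Longrightarrow> w v > 0 \<Longrightarrow> h v = c"
  shows "blend V w h = c"
proof -
  obtain v where v: "v \<in> V" "w v > 0" using compatible_ex_pos[OF assms(1)] by auto
  have "(\<Sum>u\<in>V. w u *\<^sub>R F (h u)) = (\<Sum>u\<in>V. w u *\<^sub>R F c)"
    using assms by (intro sum.cong refl) (force simp: compatible_def)
  also have "\<dots> = F c" using assms(1) by (simp add: compatible_def flip: scaleR_left.sum)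
  finally have "blend V w h = \<rho> c (F c)" using blend_eq[OF assms(1) v] assms(2)[OF v] by simp
  moreover have "c \<in> M" using assms v by (auto simp: compatible_def)
  ultimately show ?thesis using \<rho>_F[of c c] \<delta>_pos by simp
qed

text \<open>
  On the open set where the weight of \<open>v\<close> is positive, the starting point may be fixed as \<open>h v\<close>, and
  continuity reduces to that of \<open>\<rho>\<close>.
\<close>

lemma blend_continuous:
  assumes comp: "\<And>z. z \<in> topspace Z \<Longrightarrow> compatible V (\<lambda>v. w v z) (\<lambda>v. h v z)"
    and w: "\<And>v. v \<in> V \<Longrightarrow> continuous_map Z euclideanreal (w v)"
    and h: "\<And>v. v \<in> V \<Longrightarrow> continuous_map Z mtopology (h v)"
  shows "continuous_map Z mtopology (\<lambda>z. blend V (\<lambda>v. w v z) (\<lambda>v. h v z))"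
proof (rule pasting_lemma[where I = V and T = "\<lambda>v. {z \<in> topspace Z. w v z \<in> {0<..}}"
      and f = "\<lambda>v z. \<rho> (h v z) (\<Sum>u\<in>V. w u z *\<^sub>R F (h u z))"])
  show "openin Z {z \<in> topspace Z. w v z \<in> {0<..}}" if "v \<in> V" for v
    by (rule openin_continuous_map_preimage[OF w[OF that]]) simp
  have sumc: "continuous_map Z euclidean (\<lambda>z. \<Sum>u\<in>V. w u z *\<^sub>R F (h u z))"
  proof (cases "topspace Z = {}")
    case False
    then have "finite V" using comp by (auto simp: compatible_def simp del: null_topspace_iff_trivial)
    then show ?thesis
      using continuous_map_compose[OF h F_continuous]
      by (intro continuous_map_sum continuous_map_scaleR_vector w) (auto simp: o_def)
  qed (simp add: continuous_map_def)
  show "continuous_map (subtopology Z {z \<in> topspace Z. w v z \<in> {0<..}}) mtopology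
      (\<lambda>z. \<rho> (h v z) (\<Sum>u\<in>V. w u z *\<^sub>R F (h u z)))" if "v \<in> V" for v
    using that compatible_sum_near[OF comp]
    by (intro \<rho>_continuous_compose continuous_map_from_subtopology h sumc) auto
  show "\<rho> (h u z) (\<Sum>u\<in>V. w u z *\<^sub>R F (h u z)) = \<rho> (h v z) (\<Sum>u\<in>V. w u z *\<^sub>R F (h u z))"
    if "u \<in> V" "v \<in> V" "z \<in> topspace Z \<inter> {z \<in> topspace Z. w u z \<in> {0<..}} \<inter> {z \<in> topspace Z. w v z \<in> {0<..}}"
    for u v z
    using that blend_eq[OF comp, of z u] blend_eq[OF comp, of z v] by auto
  show "\<exists>v. v \<in> V \<and> z \<in> {z \<in> topspace Z. w v z \<in> {0<..}} \<and>
      blend V (\<lambda>v. w v z) (\<lambda>v. h v z) = \<rho> (h v z) (\<Sum>u\<in>V. w u z *\<^sub>R F (h u z))"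
    if "z \<in> topspace Z" for z
    using compatible_ex_pos[OF comp[OF that]] blend_eq[OF comp[OF that]] that by auto
qed

definition mesh_below :: "'t topology \<Rightarrow> 'v set \<Rightarrow> ('v \<Rightarrow> 't \<Rightarrow> real) \<Rightarrow> real \<Rightarrow> ('v \<Rightarrow> 'a) \<Rightarrow> bool" where
  "mesh_below T V w e h \<longleftrightarrow> (\<forall>v\<in>V. h v \<in> M) \<and> (\<forall>(u, v)\<in>adjacent T V w. d (h u) (h v) < e)"

lemma compatible_if_mesh_below:
  assumes "partition T V w" "mesh_below T V w \<delta> h" "t \<in> topspace T"
  shows "compatible V (\<lambda>v. w v t) h"
  using assms unfolding compatible_def partition_def mesh_below_def adjacent_def by fastforce

text \<open>
  The homotopy is itself a blend, with one additional vertex \<open>None\<close> that carries the value \<open>f t\<close>: its weight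
  \<open>1 - s\<close> passes to the vertices of \<open>V\<close> as the time \<open>s\<close> grows.
\<close>

lemma homotopic_blend:
  fixes V :: "'v set" and T :: "'t topology"
  assumes part: "partition T V w" and f: "continuous_map T mtopology f" and B: "B \<subseteq> topspace T"
    and mesh: "mesh_below T V w \<delta> h"
    and near: "\<And>t v. t \<in> topspace T \<Longrightarrow> v \<in> V \<Longrightarrow> w v t > 0 \<Longrightarrow> d (f t) (h v) < \<delta>"
    and const: "\<And>t. t \<in> B \<Longrightarrow> f t = c" "\<And>t v. t \<in> B \<Longrightarrow> v \<in> V \<Longrightarrow> w v t > 0 \<Longrightarrow> h v = c"
  shows "homotopic_with (const_on B) T mtopology f (\<lambda>t. blend V (\<lambda>v. w v t) h)"
proof -
  define V' where "V' = insert None (Some ` V)"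
  define w' where "w' = (\<lambda>v z. case v of None \<Rightarrow> 1 - fst z | Some v \<Rightarrow> fst z * w v (snd z))"
  define h' where "h' = (\<lambda>v (z::real \<times> 't). case v of None \<Rightarrow> f (snd z) | Some v \<Rightarrow> h v)"
  let ?Z = "prod_topology (top_of_set {0..1::real}) T"
  have finV: "finite V" using part by (simp add: partition_def)
  have fM: "f t \<in> M" if "t \<in> topspace T" for t using continuous_map_image_subset_topspace[OF f] that by auto
  have hM: "h v \<in> M" if "v \<in> V" for v using mesh that by (auto simp: mesh_below_def)
  have sum': "(\<Sum>v\<in>V'. g v) = g None + (\<Sum>v\<in>V. g (Some v))" for g :: "'v option \<Rightarrow> 'x::comm_monoid_add"
    unfolding V'_def using finV by (subst sum.insert) (auto simp: sum.reindex)
  have comp: "compatible V' (\<lambda>v. w' v z) (\<lambda>v. h' v z)" if z: "z \<in> topspace ?Z" for z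
  proof -
    have t: "snd z \<in> topspace T" "fst z \<in> {0..1}" using z by auto
    have c: "compatible V (\<lambda>v. w v (snd z)) h" by (rule compatible_if_mesh_below[OF part mesh t(1)])
    show ?thesis unfolding compatible_def
    proof (intro conjI ballI impI)
      show "finite V'" using finV by (simp add: V'_def)
      show "0 \<le> w' v z" if "v \<in> V'" for v using that t c by (auto simp: V'_def w'_def compatible_def)
      show "(\<Sum>v\<in>V'. w' v z) = 1"
        using c by (subst sum') (simp add: w'_def compatible_def flip: sum_distrib_left)
      show "h' v z \<in> M" if "v \<in> V'" for v using that t fM hM by (auto simp: V'_def h'_def)
      fix u v assume uv: "u \<in> V'" "v \<in> V'" "0 < w' u z \<and> 0 < w' v z"
      have pos: "w v (snd z) > 0" if "w' (Some v) z > 0" for v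
        using that t by (auto simp: w'_def zero_less_mult_iff)
      show "d (h' u z) (h' v z) < \<delta>"
        using uv near[OF t(1)] fM[OF t(1)] \<delta>_pos c pos hM
        by (auto simp: V'_def h'_def commute compatible_def)
    qed
  qed
  have cont: "continuous_map ?Z mtopology (\<lambda>z. blend V' (\<lambda>v. w' v z) (\<lambda>v. h' v z))"
  proof (rule blend_continuous[OF comp])
    have fst: "continuous_map ?Z euclideanreal fst"
      using continuous_map_fst[of "top_of_set {0..1::real}" T] by (simp add: continuous_map_in_subtopology)
    have wc: "continuous_map ?Z euclideanreal (\<lambda>z. w v (snd z))" if "v \<in> V" for v
      using continuous_map_compose[OF continuous_map_snd, of T euclideanreal "w v" "top_of_set {0..1::real}"]
        part that by (auto simp: partition_def o_def)
    have fc: "continuous_map ?Z mtopology (\<lambda>z. f (snd z))"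
      using continuous_map_compose[OF continuous_map_snd f] by (simp add: o_def)
    fix v assume "v \<in> V'"
    then show "continuous_map ?Z euclideanreal (w' v)" "continuous_map ?Z mtopology (h' v)"
      using fst wc fc hM by (auto simp: V'_def w'_def h'_def intro!: continuous_intros)
  qed
  show ?thesis
  proof (subst homotopic_with)
    show "const_on B h = const_on B k" if "\<And>x. x \<in> topspace T \<Longrightarrow> h x = k x" for h k
      using that B by (auto simp: const_on_def subset_iff)
    show "\<exists>h'. continuous_map ?Z mtopology h' \<and> (\<forall>x\<in>topspace T. h' (0, x) = f x) \<and>
      (\<forall>x\<in>topspace T. h' (1, x) = blend V (\<lambda>v. w v x) h) \<and> (\<forall>t\<in>{0..1}. const_on B (\<lambda>x. h' (t, x)))"
    proof (intro exI conjI ballI)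
      show "continuous_map ?Z mtopology (\<lambda>z. blend V' (\<lambda>v. w' v z) (\<lambda>v. h' v z))" by (rule cont)
    next
      fix t assume t: "t \<in> topspace T"
      show "blend V' (\<lambda>v. w' v (0, t)) (\<lambda>v. h' v (0, t)) = f t"
        using t by (intro blend_const comp) (auto simp: V'_def w'_def h'_def)
      have c: "compatible V (\<lambda>v. w v t) h" by (rule compatible_if_mesh_below[OF part mesh t])
      obtain v where v: "v \<in> V" "w v t > 0" using compatible_ex_pos[OF c] by auto
      have "blend V' (\<lambda>v. w' v (1, t)) (\<lambda>v. h' v (1, t)) =
          \<rho> (h' (Some v) (1, t)) (\<Sum>v\<in>V'. w' v (1, t) *\<^sub>R F (h' v (1, t)))"
        using t v by (intro blend_eq comp) (auto simp: V'_def w'_def)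
      also have "\<dots> = blend V (\<lambda>v. w v t) h"
        using blend_eq[OF c v] by (simp add: sum' w'_def h'_def)
      finally show "blend V' (\<lambda>v. w' v (1, t)) (\<lambda>v. h' v (1, t)) = blend V (\<lambda>v. w v t) h" .
    next
      fix s :: real assume s: "s \<in> {0..1}"
      have "blend V' (\<lambda>v. w' v (s, t)) (\<lambda>v. h' v (s, t)) = c" if "t \<in> B" for t
        using that B s const by (intro blend_const comp) (auto simp: V'_def w'_def h'_def zero_less_mult_iff)
      then show "const_on B (\<lambda>t. blend V' (\<lambda>v. w' v (s, t)) (\<lambda>v. h' v (s, t)))"
        by (auto simp: const_on_def)
    qed
  qed
qed

lemma homotopic_blend_path:
  assumes part: "partition T V w" and B: "B \<subseteq> topspace T"
    and h: "\<And>v. v \<in> V \<Longrightarrow> continuous_map (top_of_set {0..1}) mtopology (\<lambda>s. h s v)"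
    and mesh: "\<And>s. s \<in> {0..1::real} \<Longrightarrow> mesh_below T V w \<delta> (h s)"
    and const: "\<And>s t v. s \<in> {0..1} \<Longrightarrow> t \<in> B \<Longrightarrow> v \<in> V \<Longrightarrow> w v t > 0 \<Longrightarrow> h s v = c s"
  shows "homotopic_with (const_on B) T mtopology (\<lambda>t. blend V (\<lambda>v. w v t) (h 0)) (\<lambda>t. blend V (\<lambda>v. w v t) (h 1))"
proof -
  let ?Z = "prod_topology (top_of_set {0..1::real}) T"
  have comp: "compatible V (\<lambda>v. w v (snd z)) (\<lambda>v. h (fst z) v)" if z: "z \<in> topspace ?Z" for z
    using z by (intro compatible_if_mesh_below[OF part mesh]) auto
  have cont: "continuous_map ?Z mtopology (\<lambda>z. blend V (\<lambda>v. w v (snd z)) (\<lambda>v. h (fst z) v))"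
  proof (rule blend_continuous[OF comp])
    fix v assume v: "v \<in> V"
    show "continuous_map ?Z euclideanreal (\<lambda>z. w v (snd z))"
      using continuous_map_compose[OF continuous_map_snd, of T euclideanreal "w v" "top_of_set {0..1::real}"]
        part v by (auto simp: partition_def o_def)
    show "continuous_map ?Z mtopology (\<lambda>z. h (fst z) v)"
      using continuous_map_compose[OF continuous_map_fst h[OF v]] by (simp add: o_def)
  qed
  have "const_on B (\<lambda>t. blend V (\<lambda>v. w v t) (h s))" if s: "s \<in> {0..1}" for s
  proof -
    have "blend V (\<lambda>v. w v t) (h s) = c s" if "t \<in> B" for t
      using that B s const by (intro blend_const compatible_if_mesh_below[OF part mesh]) auto
    then show ?thesis by (auto simp: const_on_def)
  qed
  then show ?thesis unfolding homotopic_with_def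
    by (intro exI[of _ "\<lambda>z. blend V (\<lambda>v. w v (snd z)) (\<lambda>v. h (fst z) v)"]) (use cont in auto)
qed

end

section \<open>Discrete energy\<close>

context tubular_immersion
begin

lemma d_continuous:
  assumes "continuous_map Z mtopology f" "continuous_map Z mtopology g"
  shows "continuous_map Z euclideanreal (\<lambda>z. d (f z) (g z))"
  using continuous_map_mdist[of Z Self f g] assms by (simp add: mtopology_of_def)

text \<open>
  On the compact set of pairs at distance between \<open>e\<close> and \<open>\<delta>/2\<close> the images are apart, since \<open>\<rho>\<close> recovers
  nearby points from their images.
\<close>

lemma locally_injective:
  assumes "e > 0"
  obtains r where "r > 0" "\<And>x y. \<lbrakk>x \<in> M; y \<in> M; d x y \<le> \<delta>/2; norm (F x - F y) < r\<rbrakk> \<Longrightarrow> d x y < e"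
proof -
  let ?Z = "prod_topology mtopology mtopology"
  let ?C = "{z \<in> topspace ?Z. d (fst z) (snd z) \<in> {e..\<delta>/2}}"
  have "compact_space ?Z" using compact_M by (simp add: compact_space_prod_topology)
  moreover have "closedin ?Z ?C"
    by (intro closedin_continuous_map_preimage[OF d_continuous] continuous_map_fst continuous_map_snd) simp
  moreover have "continuous_map ?Z euclideanreal (\<lambda>z. norm (F (fst z) - F (snd z)))"
    using continuous_map_compose[OF continuous_map_fst F_continuous]
      continuous_map_compose[OF continuous_map_snd F_continuous]
    by (intro continuous_intros) (auto simp: o_def)
  moreover have "norm (F (fst z) - F (snd z)) > 0" if "z \<in> ?C" for z
  proof (rule ccontr)
    assume "\<not> ?thesis"
    then have "F (fst z) = F (snd z)" by simp
    then have "fst z = snd z"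
      using \<rho>_F[of "fst z" "snd z"] \<rho>_F[of "fst z" "fst z"] that \<delta>_pos by auto
    then show False using that \<open>e > 0\<close> by auto
  qed
  ultimately obtain r where r: "r > 0" "\<And>z. z \<in> ?C \<Longrightarrow> r \<le> norm (F (fst z) - F (snd z))"
    using compact_space_positive_lower_bound[of ?Z ?C] by (smt (verit, best))
  show ?thesis
  proof (rule that[OF r(1)])
    show "d x y < e" if "x \<in> M" "y \<in> M" "d x y \<le> \<delta>/2" "norm (F x - F y) < r" for x y
      using r(2)[of "(x, y)"] that by fastforce
  qed
qed

definition move :: "'w \<Rightarrow> 'a \<Rightarrow> 'a" where
  "move j x = \<rho> x (F x + j)"

lemma move_zero: "x \<in> M \<Longrightarrow> move 0 x = x"
  using \<rho>_F[of x x] \<delta>_pos by (simp add: move_def)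

lemma move_continuous:
  assumes "continuous_map Z euclideanreal s" "continuous_map Z mtopology f"
    "\<And>z. z \<in> topspace Z \<Longrightarrow> s z \<in> {0..1}" "norm j < \<eta>"
  shows "continuous_map Z mtopology (\<lambda>z. move (s z *\<^sub>R j) (f z))"
  unfolding move_def
proof (rule \<rho>_continuous_compose[OF assms(2)])
  show "continuous_map Z euclidean (\<lambda>z. F (f z) + s z *\<^sub>R j)"
    using continuous_map_compose[OF assms(2) F_continuous]
    by (intro continuous_map_add continuous_map_scaleR_vector assms) (auto simp: o_def)
  fix z assume "z \<in> topspace Z"
  then have "\<bar>s z\<bar> * norm j \<le> 1 * norm j" using assms(3)[of z] by (intro mult_right_mono) auto
  then show "norm (F (f z) + s z *\<^sub>R j - F (f z)) < \<eta>" using assms(4) by simp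
qed

lemma move_in_M:
  assumes "x \<in> M" "norm j < \<eta>"
  shows "move j x \<in> M"
proof -
  have "continuous_map mtopology mtopology (\<lambda>z. move (1 *\<^sub>R j) z)"
    by (rule move_continuous[of mtopology "\<lambda>_. 1" id j, unfolded id_def]) (use assms in auto)
  then show ?thesis using continuous_map_image_subset_topspace assms by fastforce
qed

lemma move_uniformly_continuous:
  assumes "norm j < \<eta>"
  obtains e where "e > 0"
    "\<And>x y s. \<lbrakk>x \<in> M; y \<in> M; d x y < e; s \<in> {0..1}\<rbrakk> \<Longrightarrow> d (move (s *\<^sub>R j) x) (move (s *\<^sub>R j) y) < \<delta>/2"
proof -
  let ?Z = "prod_topology (top_of_set {0..1::real}) (prod_topology mtopology mtopology)"
  let ?x = "\<lambda>z. fst (snd z)" and ?y = "\<lambda>z. snd (snd z)"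
  have s: "continuous_map ?Z euclideanreal fst"
    using continuous_map_fst[of "top_of_set {0..1::real}" "prod_topology mtopology mtopology"]
    by (simp add: continuous_map_in_subtopology)
  have x: "continuous_map ?Z mtopology ?x" and y: "continuous_map ?Z mtopology ?y"
    using continuous_map_compose[OF continuous_map_snd continuous_map_fst]
      continuous_map_compose[OF continuous_map_snd continuous_map_snd] by (auto simp: o_def)
  let ?g = "\<lambda>z. d (move (fst z *\<^sub>R j) (?x z)) (move (fst z *\<^sub>R j) (?y z))"
  let ?C = "{z \<in> topspace ?Z. ?g z \<in> {\<delta>/2..}}"
  have "compact_space ?Z"
    using compact_M by (simp add: compact_space_prod_topology compact_space_subtopology)
  moreover have "closedin ?Z ?C"
    using assms by (intro closedin_continuous_map_preimage[OF d_continuous] move_continuous s x y) auto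
  moreover have "continuous_map ?Z euclideanreal (\<lambda>z. d (?x z) (?y z))" by (intro d_continuous x y)
  moreover have "d (?x z) (?y z) > 0" if z: "z \<in> ?C" for z
  proof (rule ccontr)
    assume "\<not> ?thesis"
    then have "d (?x z) (?y z) = 0" by (simp add: order.antisym)
    then have eq: "?x z = ?y z" using z by auto
    have "\<bar>fst z\<bar> * norm j \<le> 1 * norm j" using z by (intro mult_right_mono) auto
    then have "move (fst z *\<^sub>R j) (?y z) \<in> M" using z assms by (intro move_in_M) auto
    then show False using z \<delta>_pos eq by auto
  qed
  ultimately obtain e where e: "e > 0" "\<And>z. z \<in> ?C \<Longrightarrow> e \<le> d (?x z) (?y z)"
    using compact_space_positive_lower_bound[of ?Z ?C] by (smt (verit, best))
  show ?thesis
  proof (rule that[OF e(1)])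
    show "d (move (s *\<^sub>R j) x) (move (s *\<^sub>R j) y) < \<delta>/2" if "x \<in> M" "y \<in> M" "d x y < e" "s \<in> {0..1}" for x y s
      using e(2)[of "(s, x, y)"] that by fastforce
  qed
qed

text \<open>
  A discrete counterpart of the integral of the \<open>p\<close>-th power of the derivative of a map into \<open>M\<close>, sampled at
  the vertices.
\<close>

definition energy :: "'t topology \<Rightarrow> 'v set \<Rightarrow> ('v \<Rightarrow> 't \<Rightarrow> real) \<Rightarrow> real \<Rightarrow> ('v \<Rightarrow> 'a) \<Rightarrow> real" where
  "energy T V w p h = (\<Sum>(u, v)\<in>adjacent T V w. norm (F (h u) - F (h v)) powr p)"

lemma energy_nonneg: "0 \<le> energy T V w p h"
  unfolding energy_def by (intro sum_nonneg) auto

lemma norm_edge_less: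
  assumes "finite V" "(u, v) \<in> adjacent T V w" "energy T V w p h < r powr p" "0 < r" "0 < p"
  shows "norm (F (h u) - F (h v)) < r"
proof -
  have "finite (adjacent T V w)"
    by (rule finite_subset[of _ "V \<times> V"]) (use assms(1) in \<open>auto simp: adjacent_def\<close>)
  then have "norm (F (h u) - F (h v)) powr p \<le> energy T V w p h"
    unfolding energy_def
    using member_le_sum[of "(u, v)" "adjacent T V w" "\<lambda>(u, v). norm (F (h u) - F (h v)) powr p"] assms(2)
    by auto
  then have "norm (F (h u) - F (h v)) powr p < r powr p" using assms by simp
  then show ?thesis using powr_mono2[of p r "norm (F (h u) - F (h v))"] assms by (meson leD leI less_imp_le)
qed

text \<open>
  The factor \<open>c\<close> is gained on average over \<open>J\<close>; an individual move may enlarge distances.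
\<close>

definition contracting :: "'w set \<Rightarrow> real \<Rightarrow> real \<Rightarrow> bool" where
  "contracting J p c \<longleftrightarrow> finite J \<and> J \<noteq> {} \<and> (\<forall>j\<in>J. norm j < \<eta>) \<and> 0 < p \<and> 0 \<le> c \<and> c < 1 \<and>
     (\<forall>x\<in>M. \<forall>y\<in>M. d x y < \<delta> \<longrightarrow>
        (\<Sum>j\<in>J. norm (F (move j x) - F (move j y)) powr p) \<le> c * card J * norm (F x - F y) powr p)"

text \<open>
  Summing \<open>contracting\<close> over all edges, the average over \<open>J\<close> of the energies after a move is at most \<open>c\<close>
  times the energy, and some move does no worse than the average.
\<close>

lemma ex_energy_decreasing_move:
  assumes "contracting J p c" "mesh_below T V w \<delta> h"
  shows "\<exists>j\<in>J. energy T V w p (\<lambda>v. move j (h v)) \<le> c * energy T V w p h"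
proof (rule ccontr)
  let ?A = "adjacent T V w"
  assume "\<not> ?thesis"
  then have less: "c * energy T V w p h < energy T V w p (\<lambda>v. move j (h v))" if "j \<in> J" for j
    using that by force
  have J: "finite J" "J \<noteq> {}" using assms by (auto simp: contracting_def)
  have "card J * (c * energy T V w p h) = (\<Sum>j\<in>J. c * energy T V w p h)" by simp
  also have "\<dots> < (\<Sum>j\<in>J. energy T V w p (\<lambda>v. move j (h v)))"
    by (rule sum_strict_mono[OF J less])
  also have "\<dots> = (\<Sum>(u, v)\<in>?A. \<Sum>j\<in>J. norm (F (move j (h u)) - F (move j (h v))) powr p)"
    unfolding energy_def by (subst sum.swap) (simp add: case_prod_beta)
  also have "\<dots> \<le> (\<Sum>(u, v)\<in>?A. c * card J * norm (F (h u) - F (h v)) powr p)"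
    using assms by (intro sum_mono) (force simp: contracting_def mesh_below_def adjacent_def)
  also have "\<dots> = card J * (c * energy T V w p h)"
    by (simp add: energy_def sum_distrib_left case_prod_beta mult_ac)
  finally show False by simp
qed

text \<open>
  Apply energy-decreasing moves repeatedly. Small energy keeps every edge short, so the samples can be
  interpolated throughout and each move is a homotopy of the interpolations. The energy decays
  geometrically; after enough moves even chains of \<open>L\<close> edges are short, all values lie near one point, and
  the interpolation is homotopic to a constant. The threshold \<open>e\<close> is found before the vertices and \<open>L\<close>: a
  fine grid is chosen after \<open>e\<close>, and then only the number of moves depends on \<open>L\<close>.
\<close>

lemma null_homotopic_if_small_energy:
  assumes contr: "contracting J p c"
  obtains e where "e > 0" and "\<And>T :: 't topology. \<And>V :: 'v set. \<And>w B f h b v0 t0 L.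
    \<lbrakk>partition T V w; B \<subseteq> topspace T; continuous_map T mtopology f;
     mesh_below T V w e h; energy T V w p h < e;
     \<And>t v. \<lbrakk>t \<in> topspace T; v \<in> V; w v t > 0\<rbrakk> \<Longrightarrow> d (f t) (h v) < \<delta>;
     \<And>t. t \<in> B \<Longrightarrow> f t = b; \<And>t v. \<lbrakk>t \<in> B; v \<in> V; w v t > 0\<rbrakk> \<Longrightarrow> h v = b;
     v0 \<in> V; t0 \<in> B; w v0 t0 > 0; \<And>v. v \<in> V \<Longrightarrow> \<exists>n\<le>L. (v0, v) \<in> adjacent T V w ^^ n\<rbrakk>
    \<Longrightarrow> \<exists>a\<in>M. homotopic_with (const_on B) T mtopology f (\<lambda>_. a)"
proof -
  have J: "finite J" "J \<noteq> {}" "\<And>j. j \<in> J \<Longrightarrow> norm j < \<eta>" and p: "p > 0" and c: "0 \<le> c" "c < 1"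
    using contr by (auto simp: contracting_def)
  have "\<forall>j\<in>J. \<exists>e>0. \<forall>x\<in>M. \<forall>y\<in>M. \<forall>s\<in>{0..1}. d x y < e \<longrightarrow> d (move (s *\<^sub>R j) x) (move (s *\<^sub>R j) y) < \<delta>/2"
    using J(3) by (metis move_uniformly_continuous)
  then obtain ej where ej: "\<And>j. j \<in> J \<Longrightarrow> ej j > 0"
    "\<And>j x y s. \<lbrakk>j \<in> J; x \<in> M; y \<in> M; s \<in> {0..1}; d x y < ej j\<rbrakk> \<Longrightarrow> d (move (s *\<^sub>R j) x) (move (s *\<^sub>R j) y) < \<delta>/2"
    by metis
  \<comment> \<open>Edges shorter than \<open>e1\<close> stay below \<open>\<delta>/2\<close> throughout any move of \<open>J\<close>; low energy then brings them below \<open>e1\<close> again.\<close>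
  define e1 where "e1 = min (\<delta>/2) (Min (ej ` J))"
  have e1: "e1 > 0" "e1 \<le> \<delta>/2" "\<And>j. j \<in> J \<Longrightarrow> e1 \<le> ej j"
    using J(1,2) ej(1) \<delta>_pos by (auto simp: e1_def min.coboundedI2)
  obtain r1 where r1: "r1 > 0"
    "\<And>x y. \<lbrakk>x \<in> M; y \<in> M; d x y \<le> \<delta>/2; norm (F x - F y) < r1\<rbrakk> \<Longrightarrow> d x y < e1"
    using locally_injective[OF e1(1)] by metis
  define e where "e = min e1 (r1 powr p)"
  show ?thesis
  proof (rule that[of e])
    show "e > 0" using e1 r1 by (simp add: e_def)
    fix T :: "'t topology" and V :: "'v set" and w B f h b v0 t0 and L :: nat
    assume part: "partition T V w" and B: "B \<subseteq> topspace T" and f: "continuous_map T mtopology f"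
      and mesh: "mesh_below T V w e h" and small: "energy T V w p h < e"
      and near: "\<And>t v. \<lbrakk>t \<in> topspace T; v \<in> V; w v t > 0\<rbrakk> \<Longrightarrow> d (f t) (h v) < \<delta>"
      and const: "\<And>t. t \<in> B \<Longrightarrow> f t = b" "\<And>t v. \<lbrakk>t \<in> B; v \<in> V; w v t > 0\<rbrakk> \<Longrightarrow> h v = b"
      and v0: "v0 \<in> V" "t0 \<in> B" "w v0 t0 > 0"
      and reach: "\<And>v. v \<in> V \<Longrightarrow> \<exists>n\<le>L. (v0, v) \<in> adjacent T V w ^^ n"
    have finV: "finite V" using part by (simp add: partition_def)
    let ?hom = "homotopic_with (const_on B) T mtopology" and ?E = "energy T V w p"
    let ?bl = "\<lambda>h t. blend V (\<lambda>v. w v t) h"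
    have mono: "mesh_below T V w e'' h" if "mesh_below T V w e' h" "e' \<le> e''" for e' e'' h
      using that by (force simp: mesh_below_def)
    have step: "\<exists>h b. mesh_below T V w e1 h \<and> ?E h \<le> c ^ n * ?E h0 \<and> ?E h < r1 powr p \<and>
        (\<forall>t\<in>B. \<forall>v\<in>V. w v t > 0 \<longrightarrow> h v = b) \<and> ?hom (?bl h0) (?bl h)"
      if h0: "mesh_below T V w e1 h0" "?E h0 < r1 powr p" "\<forall>t\<in>B. \<forall>v\<in>V. w v t > 0 \<longrightarrow> h0 v = b" for n h0 b
    proof (induction n)
      case 0
      have "?hom (?bl h0) (?bl h0)"
        using homotopic_blend_path[OF part B, of "\<lambda>_. h0" "\<lambda>_. b"] h0 mono[OF h0(1), of \<delta>] e1 \<delta>_pos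
        by (auto simp: mesh_below_def)
      then show ?case using h0 by (intro exI[of _ h0] exI[of _ b]) auto
    next
      case (Suc n)
      then obtain h b where h: "mesh_below T V w e1 h" "?E h \<le> c ^ n * ?E h0" "?E h < r1 powr p"
        "\<And>t v. t \<in> B \<Longrightarrow> v \<in> V \<Longrightarrow> w v t > 0 \<Longrightarrow> h v = b" "?hom (?bl h0) (?bl h)" by blast
      have hM: "h v \<in> M" if "v \<in> V" for v using h(1) that by (simp add: mesh_below_def)
      have h\<delta>: "mesh_below T V w \<delta> h" by (rule mono[OF h(1)]) (use e1 \<delta>_pos in auto)
      obtain j where j: "j \<in> J" "?E (\<lambda>v. move j (h v)) \<le> c * ?E h"
        using ex_energy_decreasing_move[OF contr h\<delta>] by auto
      define k where "k = (\<lambda>s v. move (s *\<^sub>R j) (h v))"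
      have k: "mesh_below T V w (\<delta>/2) (k s)" if "s \<in> {0..1}" for s
      proof -
        have "\<bar>s\<bar> * norm j \<le> 1 * norm j" using that by (intro mult_right_mono) auto
        then have "norm (s *\<^sub>R j) < \<eta>" using J(3)[OF j(1)] by simp
        then have "k s v \<in> M" if "v \<in> V" for v using hM[OF that] by (simp add: k_def move_in_M)
        moreover have "d (k s u) (k s v) < \<delta>/2" if "(u, v) \<in> adjacent T V w" for u v
        proof -
          have "u \<in> V" "v \<in> V" "d (h u) (h v) < e1" using h(1) that by (auto simp: mesh_below_def adjacent_def)
          then show ?thesis unfolding k_def
            using ej(2)[OF j(1) hM hM \<open>s \<in> {0..1}\<close>] e1(3)[OF j(1)] by simp
        qed
        ultimately show ?thesis by (auto simp: mesh_below_def)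
      qed
      have k0: "?bl (k 0) t = ?bl h t" if "t \<in> topspace T" for t
      proof -
        have eq: "k 0 v = h v" if "v \<in> V" for v using hM[OF that] by (simp add: k_def move_zero)
        have comp: "compatible V (\<lambda>v. w v t) h" by (rule compatible_if_mesh_below[OF part h\<delta> that])
        obtain v where v: "v \<in> V" "w v t > 0" using compatible_ex_pos[OF comp] by auto
        have "compatible V (\<lambda>v. w v t) (k 0)" using comp eq by (simp add: compatible_def)
        then show ?thesis using blend_eq[OF comp v] blend_eq[of V "\<lambda>v. w v t" "k 0" v] eq v by simp
      qed
      have "?hom (?bl (k 0)) (?bl (k 1))"
      proof (rule homotopic_blend_path[OF part B, where c = "\<lambda>s. move (s *\<^sub>R j) b"])
        show "mesh_below T V w \<delta> (k s)" if "s \<in> {0..1}" for s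
          by (rule mono[OF k[OF that]]) (use \<delta>_pos in simp)
        show "continuous_map (top_of_set {0..1}) mtopology (\<lambda>s. k s v)" if "v \<in> V" for v
          unfolding k_def by (rule move_continuous) (use hM[OF that] J(3)[OF j(1)] in auto)
        show "k s v = move (s *\<^sub>R j) b" if "t \<in> B" "v \<in> V" "w v t > 0" for s t v
          using h(4)[OF that] by (simp add: k_def)
      qed
      then have "?hom (?bl h) (?bl (k 1))"
        by (rule homotopic_with_eq) (use k0 B in \<open>auto simp: const_on_def subset_iff\<close>)
      with h(5) have hom: "?hom (?bl h0) (?bl (k 1))" by (rule homotopic_with_trans)
      have E: "?E (k 1) \<le> c * ?E h" using j by (simp add: k_def)
      also have "\<dots> \<le> 1 * ?E h" using c energy_nonneg by (intro mult_right_mono) auto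
      finally have "?E (k 1) < r1 powr p" using h(3) by simp
      moreover have "?E (k 1) \<le> c ^ Suc n * ?E h0"
        using E mult_left_mono[OF h(2) c(1)] by (simp add: mult_ac)
      moreover have "mesh_below T V w e1 (k 1)"
        unfolding mesh_below_def
      proof (intro conjI ballI, goal_cases)
        case (1 v) then show ?case using k[of 1] by (simp add: mesh_below_def)
      next
        case (2 uv)
        obtain u v where uv: "uv = (u, v)" by force
        have "norm (F (k 1 u) - F (k 1 v)) < r1"
          by (rule norm_edge_less[OF finV, of u v T w p]) (use 2 uv \<open>?E (k 1) < r1 powr p\<close> r1 p in auto)
        moreover have "k 1 u \<in> M" "k 1 v \<in> M" "d (k 1 u) (k 1 v) < \<delta>/2"
          using k[of 1] 2 uv by (auto simp: mesh_below_def adjacent_def)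
        ultimately show ?case using r1(2)[of "k 1 u" "k 1 v"] uv by simp
      qed
      moreover have "\<forall>t\<in>B. \<forall>v\<in>V. w v t > 0 \<longrightarrow> k 1 v = move j b" using h(4) by (auto simp: k_def)
      ultimately show ?case using hom by blast
    qed
    \<comment> \<open>A chain of at most \<open>L\<close> edges shorter than \<open>e2\<close> stays below \<open>\<delta>\<close>.\<close>
    define e2 where "e2 = \<delta> / (2 * (real L + 1))"
    have "e2 > 0" using \<delta>_pos by (simp add: e2_def)
    then obtain r2 where r2: "r2 > 0"
      "\<And>x y. \<lbrakk>x \<in> M; y \<in> M; d x y \<le> \<delta>/2; norm (F x - F y) < r2\<rbrakk> \<Longrightarrow> d x y < e2"
      using locally_injective by metis
    have "(\<lambda>n. c ^ n * ?E h) \<longlonglongrightarrow> 0 * ?E h"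
      using c by (intro tendsto_intros LIMSEQ_realpow_zero) auto
    then have "eventually (\<lambda>n. c ^ n * ?E h < r2 powr p) sequentially"
      using r2(1) by (intro order_tendstoD(2)) auto
    then obtain n where n: "c ^ n * ?E h < r2 powr p" by (auto simp: eventually_sequentially)
    obtain h' b' where h': "mesh_below T V w e1 h'" "?E h' \<le> c ^ n * ?E h"
      "\<And>t v. t \<in> B \<Longrightarrow> v \<in> V \<Longrightarrow> w v t > 0 \<Longrightarrow> h' v = b'" "?hom (?bl h) (?bl h')"
      using step[of h b n] mono[OF mesh, of e1] small const by (auto simp: e_def)
    have edge: "d (h' u) (h' v) < e2" if "(u, v) \<in> adjacent T V w" for u v
    proof -
      have "norm (F (h' u) - F (h' v)) < r2"
        by (rule norm_edge_less[OF finV that _ r2(1) p]) (use n h' in auto)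
      moreover have "h' u \<in> M" "h' v \<in> M" "d (h' u) (h' v) < e1"
        using h'(1) that by (auto simp: mesh_below_def adjacent_def)
      ultimately show ?thesis using r2(2)[of "h' u" "h' v"] e1 by simp
    qed
    have h'M: "h' v \<in> M" if "v \<in> V" for v using h'(1) that by (simp add: mesh_below_def)
    have path: "v \<in> V \<and> d (h' v0) (h' v) \<le> n * e2" if "(v0, v) \<in> adjacent T V w ^^ n" for n v
      using that
    proof (induction n arbitrary: v)
      case 0
      then show ?case using v0 h'M by simp
    next
      case (Suc n)
      then obtain u where u: "(v0, u) \<in> adjacent T V w ^^ n" "(u, v) \<in> adjacent T V w" by auto
      have "u \<in> V" "v \<in> V" using u by (auto simp: adjacent_def)
      then have "d (h' v0) (h' v) \<le> d (h' v0) (h' u) + d (h' u) (h' v)"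
        using h'M v0 by (intro triangle) auto
      then show ?case using Suc.IH[OF u(1)] edge[OF u(2)] \<open>v \<in> V\<close> by (simp add: algebra_simps)
    qed
    have close: "d (h' v0) (h' v) < \<delta>" if v: "v \<in> V" for v
    proof -
      obtain n where n: "n \<le> L" "(v0, v) \<in> adjacent T V w ^^ n" using reach[OF v] by auto
      have "d (h' v0) (h' v) \<le> n * e2" using path[OF n(2)] by simp
      also have "\<dots> \<le> (real L + 1) * e2" using n(1) \<open>e2 > 0\<close> by (intro mult_right_mono) auto
      also have "\<dots> = \<delta> / 2" by (simp add: e2_def field_simps)
      finally show ?thesis using \<delta>_pos by simp
    qed
    have 1: "?hom f (?bl h)"
      by (rule homotopic_blend[OF part f B _ near const]) (use mono[OF mesh, of \<delta>] e1 \<delta>_pos in \<open>auto simp: e_def\<close>)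
    have 2: "?hom (\<lambda>_. h' v0) (?bl h')"
    proof (rule homotopic_blend[OF part _ B, where c = "h' v0"])
      show "mesh_below T V w \<delta> h'" by (rule mono[OF h'(1)]) (use e1 \<delta>_pos in auto)
      show "h' v = h' v0" if "t \<in> B" "v \<in> V" "w v t > 0" for t v
        using h'(3)[OF that] h'(3)[OF v0(2,1,3)] by simp
    qed (use close h'M v0 in auto)
    show "\<exists>a\<in>M. ?hom f (\<lambda>_. a)"
      using homotopic_with_trans[OF 1 homotopic_with_trans[OF h'(4) homotopic_with_symD[OF 2]]] h'M v0
      by blast
  qed
qed

end

section \<open>Grids on the cube\<close>

lemma topspace_cube: "topspace (cube k) = (\<Pi>\<^sub>E i\<in>{..<k}. {0..1})"
  by (simp add: cube_def)

lemma compact_space_cube: "compact_space (cube k)"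
  by (simp add: cube_def compact_space_product_topology compact_space_subtopology)

lemma continuous_map_cube_coordinate: "i < k \<Longrightarrow> continuous_map (cube k) euclideanreal (\<lambda>t. t i)"
  using continuous_map_product_projection[of i "{..<k}" "\<lambda>_. top_of_set {0..1::real}"]
  by (simp add: cube_def continuous_map_in_subtopology)

lemma cube_coordinate: "t \<in> topspace (cube k) \<Longrightarrow> i < k \<Longrightarrow> 0 \<le> t i \<and> t i \<le> 1"
  by (auto simp: topspace_cube PiE_iff)

lemma continuous_map_into_cube:
  assumes "\<And>i. i < k \<Longrightarrow> continuous_map Z euclideanreal (\<lambda>z. f z i)"
    "\<And>z i. z \<in> topspace Z \<Longrightarrow> i < k \<Longrightarrow> 0 \<le> f z i \<and> f z i \<le> 1"
    "\<And>z. z \<in> topspace Z \<Longrightarrow> f z \<in> extensional {..<k}"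
  shows "continuous_map Z (cube k) f"
  unfolding cube_def continuous_map_componentwise
  using assms by (auto simp: continuous_map_in_subtopology)

definition dist1 :: "nat \<Rightarrow> (nat \<Rightarrow> real) \<Rightarrow> (nat \<Rightarrow> real) \<Rightarrow> real" where
  "dist1 k s t = (\<Sum>i<k. \<bar>s i - t i\<bar>)"

lemma dist1_nonneg: "0 \<le> dist1 k s t"
  by (simp add: dist1_def sum_nonneg)

lemma coordinate_le_dist1: "i < k \<Longrightarrow> \<bar>s i - t i\<bar> \<le> dist1 k s t"
  unfolding dist1_def using member_le_sum[of i "{..<k}" "\<lambda>i. \<bar>s i - t i\<bar>"] by simp

lemma dist1_le:
  assumes "\<And>i. i < k \<Longrightarrow> \<bar>s i - t i\<bar> \<le> e"
  shows "dist1 k s t \<le> k * e"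
  using sum_mono[of "{..<k}" "\<lambda>i. \<bar>s i - t i\<bar>" "\<lambda>_. e"] assms by (simp add: dist1_def)

definition grid :: "nat \<Rightarrow> nat \<Rightarrow> (nat \<Rightarrow> nat) set" where
  "grid k N = (\<Pi>\<^sub>E i\<in>{..<k}. {..N})"

definition grid_point :: "nat \<Rightarrow> nat \<Rightarrow> (nat \<Rightarrow> nat) \<Rightarrow> nat \<Rightarrow> real" where
  "grid_point k N v = (\<lambda>i\<in>{..<k}. real (v i) / real N)"

text \<open>
  The product of piecewise linear tent functions of half-width \<open>1 / N\<close> centred at the grid point of \<open>v\<close>.
\<close>

definition hat :: "nat \<Rightarrow> nat \<Rightarrow> (nat \<Rightarrow> nat) \<Rightarrow> (nat \<Rightarrow> real) \<Rightarrow> real" where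
  "hat k N v t = (\<Prod>i<k. max 0 (1 - \<bar>N * t i - v i\<bar>))"

lemma finite_grid: "finite (grid k N)"
  by (simp add: grid_def finite_PiE)

lemma grid_le: "v \<in> grid k N \<Longrightarrow> i < k \<Longrightarrow> v i \<le> N"
  by (auto simp: grid_def PiE_iff)

lemma grid_point_in_cube: "v \<in> grid k N \<Longrightarrow> N > 0 \<Longrightarrow> grid_point k N v \<in> topspace (cube k)"
  by (auto simp: topspace_cube grid_point_def grid_le divide_le_eq_1)

lemma sum_hat_1:
  assumes "0 \<le> x" "x \<le> real N"
  shows "(\<Sum>j\<le>N. max 0 (1 - \<bar>x - real j\<bar>)) = 1"
proof (cases "x = N")
  case True
  have "(\<Sum>j\<le>N. max 0 (1 - \<bar>x - real j\<bar>)) = (\<Sum>j\<le>N. if j = N then 1 else 0)"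
    using True by (intro sum.cong) auto
  then show ?thesis by simp
next
  case False
  define m where "m = nat \<lfloor>x\<rfloor>"
  have m: "real m \<le> x" "x < real m + 1" using assms(1) by (auto simp: m_def)
  then have "m < N" using False assms by linarith
  have "(\<Sum>j\<le>N. max 0 (1 - \<bar>x - real j\<bar>)) = (\<Sum>j\<in>{m, Suc m}. max 0 (1 - \<bar>x - real j\<bar>))"
  proof (rule sum.mono_neutral_right)
    show "\<forall>i\<in>{..N} - {m, Suc m}. max 0 (1 - \<bar>x - real i\<bar>) = 0"
    proof
      fix i assume i: "i \<in> {..N} - {m, Suc m}"
      then have "i < m \<or> i > Suc m" by auto
      then show "max 0 (1 - \<bar>x - real i\<bar>) = 0" using m by auto
    qed
  qed (use \<open>m < N\<close> in auto)
  also have "\<dots> = 1" using m by (simp add: abs_if)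
  finally show ?thesis .
qed

lemma hat_pos_iff: "hat k N v t > 0 \<longleftrightarrow> (\<forall>i<k. \<bar>N * t i - v i\<bar> < 1)"
proof
  assume pos: "hat k N v t > 0"
  show "\<forall>i<k. \<bar>N * t i - v i\<bar> < 1"
  proof (intro allI impI, rule ccontr)
    fix i assume "i < k" "\<not> \<bar>N * t i - v i\<bar> < 1"
    then have "hat k N v t = 0" unfolding hat_def by (intro prod_zero) (auto intro!: bexI[of _ i])
    then show False using pos by simp
  qed
qed (auto simp: hat_def intro!: prod_pos)

lemma hat_nonneg: "0 \<le> hat k N v t"
  unfolding hat_def by (intro prod_nonneg) auto

lemma partition_hat:
  shows "partition (cube k) (grid k N) (hat k N)"
  unfolding partition_def
proof (intro conjI ballI)
  show "finite (grid k N)" by (rule finite_grid)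
  show "continuous_map (cube k) euclideanreal (hat k N v)" for v
    unfolding hat_def
    by (intro continuous_map_prod continuous_intros continuous_map_cube_coordinate) auto
  show "0 \<le> hat k N v t" for v t by (rule hat_nonneg)
  fix t assume t: "t \<in> topspace (cube k)"
  have "(\<Sum>v\<in>grid k N. hat k N v t) = (\<Prod>i<k. \<Sum>j\<le>N. max 0 (1 - \<bar>N * t i - real j\<bar>))"
    unfolding hat_def grid_def by (subst prod_sum_PiE) auto
  also have "\<dots> = (\<Prod>i<k. 1)"
  proof (intro prod.cong refl sum_hat_1)
    fix i assume "i \<in> {..<k}"
    then have "0 \<le> t i" "t i \<le> 1" using cube_coordinate[OF t, of i] by auto
    then show "0 \<le> real N * t i" "real N * t i \<le> real N" using mult_left_le[of "t i" "real N"] by auto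
  qed
  finally show "(\<Sum>v\<in>grid k N. hat k N v t) = 1" by simp
qed

lemma hat_lipschitz: "\<bar>hat k N v s - hat k N v t\<bar> \<le> N * dist1 k s t"
proof -
  have "\<bar>hat k N v s - hat k N v t\<bar> \<le> (\<Sum>i<k. \<bar>max 0 (1 - \<bar>N * s i - v i\<bar>) - max 0 (1 - \<bar>N * t i - v i\<bar>)\<bar>)"
    unfolding hat_def
    using norm_prod_diff[of "{..<k}" "\<lambda>i. max 0 (1 - \<bar>N * s i - v i\<bar>)" "\<lambda>i. max 0 (1 - \<bar>N * t i - v i\<bar>)"]
    by auto
  also have "\<dots> \<le> (\<Sum>i<k. N * \<bar>s i - t i\<bar>)"
  proof (rule sum_mono)
    fix i
    have "\<bar>max 0 (1 - \<bar>N * s i - v i\<bar>) - max 0 (1 - \<bar>N * t i - v i\<bar>)\<bar> \<le> \<bar>N * s i - N * t i\<bar>"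
      by linarith
    also have "\<dots> = N * \<bar>s i - t i\<bar>" by (simp add: abs_mult flip: right_diff_distrib)
    finally show "\<bar>max 0 (1 - \<bar>N * s i - v i\<bar>) - max 0 (1 - \<bar>N * t i - v i\<bar>)\<bar> \<le> N * \<bar>s i - t i\<bar>" .
  qed
  finally show ?thesis by (simp add: dist1_def sum_distrib_left)
qed

lemma dist1_grid_point:
  assumes "hat k N v t > 0" "N > 0"
  shows "dist1 k t (grid_point k N v) \<le> k / N"
proof -
  have "dist1 k t (grid_point k N v) \<le> k * (1 / N)"
  proof (rule dist1_le)
    fix i assume i: "i < k"
    have "\<bar>t i - v i / N\<bar> = \<bar>N * t i - v i\<bar> / N"
      using assms(2) by (simp add: abs_if field_simps)
    also have "\<dots> \<le> 1 / N" using assms i by (intro divide_right_mono) (auto simp: hat_pos_iff less_imp_le)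
    finally show "\<bar>t i - grid_point k N v i\<bar> \<le> 1 / N" using i by (simp add: grid_point_def)
  qed
  then show ?thesis by simp
qed

lemma adjacent_grid:
  assumes "(u, v) \<in> adjacent (cube k) (grid k N) (hat k N)" "i < k"
  shows "\<bar>int (u i) - int (v i)\<bar> \<le> 1"
proof -
  obtain t where "hat k N u t > 0" "hat k N v t > 0" using assms by (auto simp: adjacent_def)
  then have "\<bar>N * t i - u i\<bar> < 1" "\<bar>N * t i - v i\<bar> < 1" using assms(2) by (auto simp: hat_pos_iff)
  then show ?thesis by linarith
qed

lemma dist1_adjacent:
  assumes "(u, v) \<in> adjacent (cube k) (grid k N) (hat k N)" "N > 0"
  shows "dist1 k (grid_point k N u) (grid_point k N v) \<le> k / N"
proof -
  have "dist1 k (grid_point k N u) (grid_point k N v) \<le> k * (1 / N)"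
  proof (rule dist1_le)
    fix i assume i: "i < k"
    have "\<bar>real (u i) - real (v i)\<bar> \<le> 1" using adjacent_grid[OF assms(1) i] by linarith
    then show "\<bar>grid_point k N u i - grid_point k N v i\<bar> \<le> 1 / N"
      using i assms(2) by (simp add: grid_point_def divide_right_mono flip: diff_divide_distrib)
  qed
  then show ?thesis by simp
qed

text \<open>
  Adjacent grid points differ by at most one in each coordinate.
\<close>

lemma card_adjacent_grid: "card (adjacent (cube k) (grid k N) (hat k N)) \<le> (N + 1) ^ k * 3 ^ k"
proof -
  let ?A = "adjacent (cube k) (grid k N) (hat k N)"
  let ?f = "\<lambda>(u, v). (u, \<lambda>i\<in>{..<k}. int (v i) - int (u i))"
  let ?B = "grid k N \<times> (\<Pi>\<^sub>E i\<in>{..<k}. {-1..1::int})"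
  have "inj_on ?f ?A"
  proof (rule inj_onI)
    fix x y assume "x \<in> ?A" "y \<in> ?A" "?f x = ?f y"
    then obtain u v v' where 1: "(u, v) \<in> ?A" "(u, v') \<in> ?A" and xy: "x = (u, v)" "y = (u, v')"
      and eq: "(\<lambda>i\<in>{..<k}. int (v i) - int (u i)) = (\<lambda>i\<in>{..<k}. int (v' i) - int (u i))"
      by (cases x; cases y) auto
    have vv: "v \<in> grid k N" "v' \<in> grid k N" using 1 by (auto simp: adjacent_def)
    have "v i = v' i" if "i < k" for i using fun_cong[OF eq, of i] that by simp
    then have "v = v'" by (intro PiE_ext[OF vv[unfolded grid_def]]) auto
    then show "x = y" by (simp add: xy)
  qed
  moreover have "?f ` ?A \<subseteq> ?B"
  proof
    fix x assume "x \<in> ?f ` ?A"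
    then obtain u v where uv: "(u, v) \<in> ?A" and x: "x = (u, \<lambda>i\<in>{..<k}. int (v i) - int (u i))" by auto
    have "-1 \<le> int (v i) - int (u i) \<and> int (v i) - int (u i) \<le> 1" if "i < k" for i
      using adjacent_grid[OF uv that] by auto
    then show "x \<in> ?B" using uv by (auto simp: x adjacent_def)
  qed
  ultimately have "card ?A \<le> card ?B"
    by (rule card_inj_on_le) (simp add: finite_grid finite_PiE)
  also have "\<dots> = (N + 1) ^ k * 3 ^ k"
    by (simp add: card_cartesian_product grid_def card_PiE)
  finally show ?thesis .
qed

text \<open>
  Walk diagonally: the \<open>j\<close>-th point of the chain cuts off the coordinates of \<open>v\<close> at \<open>j\<close>.
\<close>

lemma grid_reachable:
  assumes v: "v \<in> grid k N" and "N > 0"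
  shows "\<exists>n\<le>N. ((\<lambda>i\<in>{..<k}. 0), v) \<in> adjacent (cube k) (grid k N) (hat k N) ^^ n"
proof -
  define u where "u = (\<lambda>j. \<lambda>i\<in>{..<k}. min (v i) j)"
  have uN: "u j \<in> grid k N" for j using grid_le[OF v] by (auto simp: u_def grid_def min.coboundedI1)
  have step: "(u j, u (Suc j)) \<in> adjacent (cube k) (grid k N) (hat k N)" for j
  proof -
    \<comment> \<open>The midpoint has positive weight at both ends of the edge.\<close>
    define t where "t = (\<lambda>i\<in>{..<k}. (real (u j i) + real (u (Suc j) i)) / (2 * N))"
    have "real (u j i) + real (u (Suc j) i) \<le> 2 * real N" if "i < k" for i
      using grid_le[OF uN that, of j] grid_le[OF uN that, of "Suc j"] by linarith
    then have "t \<in> topspace (cube k)"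
      using \<open>N > 0\<close> by (auto simp: t_def topspace_cube divide_le_eq_1)
    moreover have "hat k N (u j) t > 0 \<and> hat k N (u (Suc j)) t > 0"
    proof -
      have "N * t i = (real (u j i) + real (u (Suc j) i)) / 2" if "i < k" for i
        using that \<open>N > 0\<close> by (simp add: t_def)
      moreover have "u j i \<le> u (Suc j) i" "u (Suc j) i \<le> u j i + 1" if "i < k" for i
        using that by (auto simp: u_def)
      ultimately show ?thesis unfolding hat_pos_iff by force
    qed
    ultimately show ?thesis using uN by (auto simp: adjacent_def)
  qed
  have "(u 0, u n) \<in> adjacent (cube k) (grid k N) (hat k N) ^^ n" for n
  proof (induction n)
    case (Suc n)
    then show ?case using step by (meson relpow_Suc_I)
  qed simp
  moreover have "u 0 = (\<lambda>i\<in>{..<k}. 0)" by (simp add: u_def fun_eq_iff)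
  moreover have "u N = v"
    using v grid_le[OF v] by (auto simp: u_def fun_eq_iff min_def grid_def PiE_iff extensional_def le_antisym)
  ultimately show ?thesis by auto
qed

text \<open>
  At a point with a coordinate \<open>0\<close> or \<open>1\<close>, a grid point of positive weight has the same coordinate.
\<close>

lemma hat_boundary:
  assumes "t \<in> cube_boundary k" "v \<in> grid k N" "hat k N v t > 0" "N > 0"
  shows "grid_point k N v \<in> cube_boundary k"
proof -
  obtain i where i: "i < k" "t i = 0 \<or> t i = 1" using assms by (auto simp: cube_boundary_def)
  have "\<bar>N * t i - v i\<bar> < 1" using assms i by (auto simp: hat_pos_iff)
  then have "v i = 0 \<or> v i = N" using i(2) by auto
  then have "grid_point k N v i = 0 \<or> grid_point k N v i = 1" using i assms by (auto simp: grid_point_def)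
  then show ?thesis using grid_point_in_cube[OF assms(2,4)] i by (auto simp: cube_boundary_def)
qed

context tubular_immersion
begin

lemma cube_map_uniformly_continuous:
  assumes f: "continuous_map (cube k) mtopology f" and "e > 0"
  obtains r where "r > 0"
    "\<And>s t. \<lbrakk>s \<in> topspace (cube k); t \<in> topspace (cube k); dist1 k s t < r\<rbrakk> \<Longrightarrow> d (f s) (f t) < e"
proof -
  let ?Z = "prod_topology (cube k) (cube k)"
  have f1: "continuous_map ?Z mtopology (\<lambda>z. f (fst z))" and f2: "continuous_map ?Z mtopology (\<lambda>z. f (snd z))"
    using continuous_map_compose[OF continuous_map_fst f] continuous_map_compose[OF continuous_map_snd f]
    by (auto simp: o_def)
  let ?C = "{z \<in> topspace ?Z. d (f (fst z)) (f (snd z)) \<in> {e..}}"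
  have 1: "compact_space ?Z" by (simp add: compact_space_prod_topology compact_space_cube)
  have 2: "closedin ?Z ?C" by (intro closedin_continuous_map_preimage[OF d_continuous] f1 f2) simp
  have c: "continuous_map ?Z euclideanreal (\<lambda>z. fst z i)" "continuous_map ?Z euclideanreal (\<lambda>z. snd z i)"
    if "i < k" for i
    using continuous_map_compose[OF continuous_map_fst continuous_map_cube_coordinate[OF that]]
      continuous_map_compose[OF continuous_map_snd continuous_map_cube_coordinate[OF that]]
    by (auto simp: o_def)
  have 3: "continuous_map ?Z euclideanreal (\<lambda>z. dist1 k (fst z) (snd z))"
    unfolding dist1_def by (intro continuous_intros c) auto
  have 4: "dist1 k (fst z) (snd z) > 0" if z: "z \<in> ?C" for z
  proof (rule ccontr)
    assume "\<not> ?thesis"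
    then have "dist1 k (fst z) (snd z) = 0" using dist1_nonneg[of k "fst z" "snd z"] by simp
    then have eq: "fst z i = snd z i" if "i < k" for i
      using coordinate_le_dist1[OF that, of "fst z" "snd z"] by simp
    have Z: "fst z \<in> topspace (cube k)" "snd z \<in> topspace (cube k)" using z by auto
    have "fst z = snd z"
      by (rule PiE_ext[OF Z[unfolded topspace_cube]]) (use eq in auto)
    moreover have "f (snd z) \<in> M" using z continuous_map_image_subset_topspace[OF f] by auto
    ultimately show False using z \<open>e > 0\<close> by auto
  qed
  obtain r where "r > 0" and r: "\<And>z. z \<in> ?C \<Longrightarrow> r \<le> dist1 k (fst z) (snd z)"
    using compact_space_positive_lower_bound[OF 1 2 3 4] by blast
  show ?thesis
  proof (rule that[OF \<open>r > 0\<close>])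
    show "d (f s) (f t) < e" if "s \<in> topspace (cube k)" "t \<in> topspace (cube k)" "dist1 k s t < r" for s t
      using r[of "(s, t)"] that by fastforce
  qed
qed

end

section \<open>Null-homotopies of cube maps\<close>

locale lipschitz_tubular_immersion = tubular_immersion +
  fixes C :: real
  assumes C_nonneg: "0 \<le> C"
    and \<rho>_lipschitz: "\<lbrakk>x \<in> M; norm (w - F x) < \<eta>; norm (w' - F x) < \<eta>\<rbrakk> \<Longrightarrow>
      norm (F (\<rho> x w) - F (\<rho> x w')) \<le> C * norm (w - w')"
begin

lemma sample_near:
  assumes "\<And>s t. \<lbrakk>s \<in> topspace (cube k); t \<in> topspace (cube k); dist1 k s t < r\<rbrakk> \<Longrightarrow> d (f s) (f t) < e"
    and "N > 0" "k / N < r"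
  shows "\<And>t v. \<lbrakk>t \<in> topspace (cube k); v \<in> grid k N; hat k N v t > 0\<rbrakk> \<Longrightarrow> d (f t) (f (grid_point k N v)) < e"
  using assms dist1_grid_point grid_point_in_cube by (meson le_less_trans)

lemma sample_mesh:
  assumes "\<And>s t. \<lbrakk>s \<in> topspace (cube k); t \<in> topspace (cube k); dist1 k s t < r\<rbrakk> \<Longrightarrow> d (f s) (f t) < e"
    and "N > 0" "k / N < r" "continuous_map (cube k) mtopology f"
  shows "mesh_below (cube k) (grid k N) (hat k N) e (\<lambda>v. f (grid_point k N v))"
  unfolding mesh_below_def
proof (intro conjI ballI, goal_cases)
  case (1 v)
  then show ?case using continuous_map_image_subset_topspace[OF assms(4)] grid_point_in_cube[OF 1 assms(2)] by auto
next
  case (2 uv)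
  obtain u v where uv: "uv = (u, v)" by force
  have "u \<in> grid k N" "v \<in> grid k N" using 2 uv by (auto simp: adjacent_def)
  then show ?case
    using assms(1)[of "grid_point k N u" "grid_point k N v"] dist1_adjacent[of u v k N] 2 uv assms(2,3)
      grid_point_in_cube[of _ k N] by auto
qed

text \<open>
  The blend of samples over a fine grid is homotopic to \<open>f\<close>. It is Lipschitz at small scale, because the
  weights are, and nearby points share a vertex of positive weight from which \<open>\<rho>\<close> is Lipschitz.
\<close>

lemma lipschitz_approximation:
  assumes f: "continuous_map (cube k) mtopology f" and b: "\<And>t. t \<in> cube_boundary k \<Longrightarrow> f t = b"
  obtains g L r where "continuous_map (cube k) mtopology g" "\<And>t. t \<in> cube_boundary k \<Longrightarrow> g t = b"
    "homotopic_with (const_on (cube_boundary k)) (cube k) mtopology f g" "r > 0"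
    "\<And>s t. \<lbrakk>s \<in> topspace (cube k); t \<in> topspace (cube k); dist1 k s t < r\<rbrakk> \<Longrightarrow>
      norm (F (g s) - F (g t)) \<le> L * dist1 k s t"
proof -
  obtain r where "r > 0" and r:
    "\<And>s t. \<lbrakk>s \<in> topspace (cube k); t \<in> topspace (cube k); dist1 k s t < r\<rbrakk> \<Longrightarrow> d (f s) (f t) < \<delta>"
    using cube_map_uniformly_continuous[OF f \<delta>_pos] by metis
  obtain N :: nat where N: "k / r < N" "N > 0" using reals_Archimedean2[of "k / r"]
    by (metis (no_types) gr0I le_less_trans less_irrefl of_nat_0 of_nat_0_le_iff divide_nonneg_pos \<open>r > 0\<close>)
  then have kN: "k / N < r" using \<open>r > 0\<close> by (simp add: field_simps)
  let ?V = "grid k N" and ?w = "hat k N" and ?B = "cube_boundary k"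
  define h where "h = (\<lambda>v. f (grid_point k N v))"
  define S where "S = (\<lambda>t. \<Sum>u\<in>?V. ?w u t *\<^sub>R F (h u))"
  define g where "g = (\<lambda>t. blend ?V (\<lambda>v. ?w v t) h)"
  have mesh: "mesh_below (cube k) ?V ?w \<delta> h" unfolding h_def by (rule sample_mesh[OF r N(2) kN f])
  have near: "d (f t) (h v) < \<delta>" if "t \<in> topspace (cube k)" "v \<in> ?V" "?w v t > 0" for t v
    unfolding h_def by (rule sample_near[OF r N(2) kN that])
  have B: "?B \<subseteq> topspace (cube k)" by (auto simp: cube_boundary_def)
  have hb: "h v = b" if "t \<in> ?B" "v \<in> ?V" "?w v t > 0" for t v
    unfolding h_def by (rule b[OF hat_boundary[OF that N(2)]])
  have comp: "compatible ?V (\<lambda>v. ?w v t) h" if "t \<in> topspace (cube k)" for t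
    by (rule compatible_if_mesh_below[OF partition_hat mesh that])
  have hom: "homotopic_with (const_on ?B) (cube k) mtopology f g"
    unfolding g_def by (rule homotopic_blend[OF partition_hat f B mesh near b hb])
  define L where "L = C * (\<Sum>u\<in>?V. N * norm (F (h u)))"
  show ?thesis
  proof (rule that[OF _ _ hom, of "1 / (2 * real N)" L])
    show "continuous_map (cube k) mtopology g" using homotopic_with_imp_continuous_maps[OF hom] by simp
    show "g t = b" if "t \<in> ?B" for t
      unfolding g_def using that B hb[OF that] by (intro blend_const comp) auto
    show "1 / (2 * real N) > 0" using N by simp
    fix s t assume s: "s \<in> topspace (cube k)" and t: "t \<in> topspace (cube k)" and st: "dist1 k s t < 1 / (2 * real N)"
    \<comment> \<open>The grid point nearest to \<open>s\<close> has positive weight at \<open>s\<close> and at \<open>t\<close>.\<close>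
    define v where "v = (\<lambda>i\<in>{..<k}. nat (round (N * s i)))"
    have vi: "\<bar>N * s i - real (v i)\<bar> \<le> 1/2 \<and> v i \<le> N" if "i < k" for i
    proof -
      have "0 \<le> N * s i" "N * s i \<le> N" using cube_coordinate[OF s that] mult_left_le[of "s i" "real N"] by auto
      then have "0 \<le> round (N * s i)" "round (N * s i) \<le> int N"
        using round_mono[of 0 "N * s i"] round_mono[of "N * s i" "real N"] by auto
      then show ?thesis using of_int_round_abs_le[of "N * s i"] that by (auto simp: v_def abs_minus_commute)
    qed
    have v: "v \<in> ?V" using vi by (auto simp: grid_def v_def)
    have ws: "?w v s > 0" unfolding hat_pos_iff using vi by fastforce
    have wt: "?w v t > 0" unfolding hat_pos_iff
    proof (intro allI impI)
      fix i assume i: "i < k"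
      have "\<bar>N * s i - N * t i\<bar> = N * \<bar>s i - t i\<bar>" by (simp add: abs_mult flip: right_diff_distrib)
      also have "\<dots> < N * (1 / (2 * real N))"
        using coordinate_le_dist1[OF i, of s t] st N by (intro mult_strict_left_mono) auto
      also have "\<dots> = 1/2" using N by simp
      finally show "\<bar>N * t i - v i\<bar> < 1" using vi[OF i] by linarith
    qed
    have gs: "g s = \<rho> (h v) (S s)" "g t = \<rho> (h v) (S t)"
      unfolding g_def S_def using blend_eq[OF comp v] s t ws wt by auto
    have "norm (S s - S t) \<le> (\<Sum>u\<in>?V. norm ((?w u s - ?w u t) *\<^sub>R F (h u)))"
      unfolding S_def by (simp add: scaleR_diff_left norm_sum flip: sum_subtractf)
    also have "\<dots> \<le> (\<Sum>u\<in>?V. (N * dist1 k s t) * norm (F (h u)))"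
      by (intro sum_mono) (auto intro!: mult_right_mono hat_lipschitz)
    finally have S: "norm (S s - S t) \<le> (\<Sum>u\<in>?V. N * dist1 k s t * norm (F (h u)))" .
    have "norm (F (g s) - F (g t)) \<le> C * norm (S s - S t)"
      unfolding gs using compatible_sum_near[OF comp v] s t ws wt mesh v
      by (intro \<rho>_lipschitz) (auto simp: S_def mesh_below_def)
    also have "\<dots> \<le> C * (\<Sum>u\<in>?V. N * dist1 k s t * norm (F (h u)))"
      by (rule mult_left_mono[OF S C_nonneg])
    also have "\<dots> = L * dist1 k s t" by (simp add: L_def sum_distrib_left sum_distrib_right mult_ac)
    finally show "norm (F (g s) - F (g t)) \<le> L * dist1 k s t" .
  qed
qed

text \<open>
  The number of edges is of order \<open>N ^ k\<close>, while each contributes at most a multiple of \<open>N powr (- p)\<close>.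
\<close>

lemma energy_of_samples_tendsto_0:
  assumes r: "r > 0" "\<And>s t. \<lbrakk>s \<in> topspace (cube k); t \<in> topspace (cube k); dist1 k s t < r\<rbrakk> \<Longrightarrow>
      norm (F (g s) - F (g t)) \<le> L * dist1 k s t" and p: "real k < p"
  shows "(\<lambda>N. energy (cube k) (grid k N) (hat k N) p (\<lambda>v. g (grid_point k N v))) \<longlonglongrightarrow> 0"
proof -
  \<comment> \<open>The factor \<open>6 ^ k\<close> comes from \<open>(N + 1) ^ k * 3 ^ k \<le> (2 * N) ^ k * 3 ^ k\<close>.\<close>
  define K where "K = 6 ^ k * (max L 0 * k) powr p"
  have "(\<lambda>N. K * real N powr (k - p)) \<longlonglongrightarrow> K * 0"
    using p by (intro tendsto_intros tendsto_neg_powr filterlim_real_sequentially) auto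
  then have lim: "(\<lambda>N. K * real N powr (k - p)) \<longlonglongrightarrow> 0" by simp
  obtain N0 :: nat where N0: "k / r < N0" using reals_Archimedean2 by blast
  have "energy (cube k) (grid k N) (hat k N) p (\<lambda>v. g (grid_point k N v)) \<le> K * real N powr (k - p)"
    if N: "N \<ge> Suc N0" for N
  proof -
    let ?A = "adjacent (cube k) (grid k N) (hat k N)" and ?h = "\<lambda>v. g (grid_point k N v)"
    have "N > 0" using N by simp
    have "k / r < N" using N N0 by linarith
    then have kN: "k / N < r" using \<open>N > 0\<close> r(1) by (simp add: field_simps)
    have edge: "norm (F (?h u) - F (?h v)) powr p \<le> (max L 0 * k) powr p * N powr (- p)" if "(u, v) \<in> ?A" for u v
    proof -
      let ?d = "dist1 k (grid_point k N u) (grid_point k N v)"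
      have "?d \<le> k / N" by (rule dist1_adjacent[OF that \<open>N > 0\<close>])
      moreover have "u \<in> grid k N" "v \<in> grid k N" using that by (auto simp: adjacent_def)
      ultimately have "norm (F (?h u) - F (?h v)) \<le> L * ?d"
        using grid_point_in_cube \<open>N > 0\<close> kN by (intro r(2)) auto
      also have "\<dots> \<le> max L 0 * ?d" using dist1_nonneg by (intro mult_right_mono) auto
      also have "\<dots> \<le> max L 0 * (k / N)" using \<open>?d \<le> k / N\<close> by (intro mult_left_mono) auto
      finally have "norm (F (?h u) - F (?h v)) powr p \<le> (max L 0 * (k / N)) powr p"
        using p by (intro powr_mono2) auto
      also have "\<dots> = (max L 0 * k) powr p * N powr (- p)"
        by (simp add: powr_mult powr_divide powr_minus field_simps)
      finally show ?thesis .
    qed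
    have "energy (cube k) (grid k N) (hat k N) p ?h \<le> (\<Sum>(u, v)\<in>?A. (max L 0 * k) powr p * N powr (- p))"
      unfolding energy_def by (intro sum_mono) (use edge in auto)
    also have "\<dots> = card ?A * ((max L 0 * k) powr p * N powr (- p))" by (simp add: case_prod_beta)
    also have "\<dots> \<le> (2 * real N) ^ k * 3 ^ k * ((max L 0 * k) powr p * N powr (- p))"
    proof (rule mult_right_mono)
      have "card ?A \<le> (N + 1) ^ k * 3 ^ k" by (rule card_adjacent_grid)
      also have "\<dots> \<le> (2 * N) ^ k * 3 ^ k" using \<open>N > 0\<close> by (intro mult_right_mono power_mono) auto
      finally have "real (card ?A) \<le> real ((2 * N) ^ k * 3 ^ k)" by (rule of_nat_mono)
      then show "real (card ?A) \<le> (2 * real N) ^ k * 3 ^ k" by simp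
    qed auto
    also have "\<dots> = K * (real N ^ k * N powr (- p))"
      by (simp add: K_def power_mult_distrib flip: power_mult_distrib[of 2 3])
    also have "real N ^ k * N powr (- p) = real N powr (k - p)"
      using \<open>N > 0\<close> by (simp add: powr_realpow[symmetric] flip: powr_add)
    finally show ?thesis .
  qed
  then have "eventually (\<lambda>N. energy (cube k) (grid k N) (hat k N) p (\<lambda>v. g (grid_point k N v))
      \<le> K * real N powr (k - p)) sequentially"
    unfolding eventually_sequentially by blast
  then show ?thesis
    by (rule tendsto_sandwich[OF _ _ tendsto_const lim, rotated]) (simp add: energy_nonneg)
qed

text \<open>
  A Lipschitz approximation has samples of arbitrarily small energy, which
  \<open>null_homotopic_if_small_energy\<close> contracts.
\<close>

lemma cube_map_null_homotopic:
  assumes contr: "contracting J p c" and k: "0 < k" "real k < p"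
    and f: "continuous_map (cube k) mtopology f" and b: "\<And>t. t \<in> cube_boundary k \<Longrightarrow> f t = b"
  shows "\<exists>a\<in>M. homotopic_with (const_on (cube_boundary k)) (cube k) mtopology f (\<lambda>_. a)"
proof (rule null_homotopic_if_small_energy[OF contr, where 't = "nat \<Rightarrow> real" and 'v = "nat \<Rightarrow> nat"])
  fix e :: real
  assume "e > 0" and e: "\<And>(T :: (nat \<Rightarrow> real) topology) (V :: (nat \<Rightarrow> nat) set) w B f h b v0 t0 L.
    \<lbrakk>partition T V w; B \<subseteq> topspace T; continuous_map T mtopology f;
     mesh_below T V w e h; energy T V w p h < e;
     \<And>t v. \<lbrakk>t \<in> topspace T; v \<in> V; w v t > 0\<rbrakk> \<Longrightarrow> d (f t) (h v) < \<delta>;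
     \<And>t. t \<in> B \<Longrightarrow> f t = b; \<And>t v. \<lbrakk>t \<in> B; v \<in> V; w v t > 0\<rbrakk> \<Longrightarrow> h v = b;
     v0 \<in> V; t0 \<in> B; w v0 t0 > 0; \<And>v. v \<in> V \<Longrightarrow> \<exists>n\<le>L. (v0, v) \<in> adjacent T V w ^^ n\<rbrakk>
    \<Longrightarrow> \<exists>a\<in>M. homotopic_with (const_on B) T mtopology f (\<lambda>_. a)"
  let ?B = "cube_boundary k"
  obtain g L r where g: "continuous_map (cube k) mtopology g" "\<And>t. t \<in> ?B \<Longrightarrow> g t = b"
    and hom: "homotopic_with (const_on ?B) (cube k) mtopology f g"
    and r: "r > 0" "\<And>s t. \<lbrakk>s \<in> topspace (cube k); t \<in> topspace (cube k); dist1 k s t < r\<rbrakk> \<Longrightarrow>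
      norm (F (g s) - F (g t)) \<le> L * dist1 k s t"
    using lipschitz_approximation[OF f b] by metis
  define e' where "e' = min e \<delta>"
  have "e' > 0" using \<open>e > 0\<close> \<delta>_pos by (simp add: e'_def)
  obtain q where "q > 0" and q:
    "\<And>s t. \<lbrakk>s \<in> topspace (cube k); t \<in> topspace (cube k); dist1 k s t < q\<rbrakk> \<Longrightarrow> d (g s) (g t) < e'"
    using cube_map_uniformly_continuous[OF g(1) \<open>e' > 0\<close>] by metis
  obtain N1 :: nat where N1: "\<And>N. N \<ge> N1 \<Longrightarrow>
      energy (cube k) (grid k N) (hat k N) p (\<lambda>v. g (grid_point k N v)) < e"
    using order_tendstoD(2)[OF energy_of_samples_tendsto_0[OF r k(2)] \<open>e > 0\<close>]
    by (auto simp: eventually_sequentially)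
  obtain N2 :: nat where N2: "k / q < N2" using reals_Archimedean2 by blast
  define N where "N = Suc (max N1 N2)"
  have "N > 0" "N \<ge> N1" by (auto simp: N_def)
  have "k / q < N" using N2 by (simp add: N_def)
  then have kN: "k / N < q" using \<open>N > 0\<close> \<open>q > 0\<close> by (simp add: field_simps)
  let ?h = "\<lambda>v. g (grid_point k N v)" and ?v0 = "\<lambda>i\<in>{..<k}. 0" and ?t0 = "\<lambda>i\<in>{..<k}. 0"
  have "\<exists>a\<in>M. homotopic_with (const_on ?B) (cube k) mtopology g (\<lambda>_. a)"
  proof (rule e[OF partition_hat[of k N] _ g(1)])
    show "?B \<subseteq> topspace (cube k)" by (auto simp: cube_boundary_def)
    have "mesh_below (cube k) (grid k N) (hat k N) e' ?h" by (rule sample_mesh[OF q \<open>N > 0\<close> kN g(1)])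
    then show "mesh_below (cube k) (grid k N) (hat k N) e ?h" by (force simp: mesh_below_def e'_def)
    show "energy (cube k) (grid k N) (hat k N) p ?h < e" by (rule N1[OF \<open>N \<ge> N1\<close>])
    show "d (g t) (?h v) < \<delta>" if "t \<in> topspace (cube k)" "v \<in> grid k N" "hat k N v t > 0" for t v
      using sample_near[where f = g and e = e', OF q \<open>N > 0\<close> kN that] by (simp add: e'_def)
    show "g t = b" if "t \<in> ?B" for t by (rule g(2)[OF that])
    show "?h v = b" if "t \<in> ?B" "v \<in> grid k N" "hat k N v t > 0" for t v
      by (rule g(2)[OF hat_boundary[OF that \<open>N > 0\<close>]])
    show "?v0 \<in> grid k N" by (simp add: grid_def)
    show "?t0 \<in> ?B" using k(1) by (auto simp: cube_boundary_def topspace_cube)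
    show "hat k N ?v0 ?t0 > 0" by (simp add: hat_pos_iff)
    show "\<exists>n\<le>N. (?v0, v) \<in> adjacent (cube k) (grid k N) (hat k N) ^^ n" if "v \<in> grid k N" for v
      by (rule grid_reachable[OF that \<open>N > 0\<close>])
  qed
  with hom show ?thesis using homotopic_with_trans by blast
qed

end

section \<open>From free to based homotopies\<close>

lemma cube_boundary_subset: "cube_boundary k \<subseteq> topspace (cube k)"
  by (auto simp: cube_boundary_def)

text \<open>
  A free homotopy \<open>H\<close> moves the boundary along a path \<open>s \<mapsto> H (s, b0)\<close>. Stop it at a time \<open>\<tau> x\<close> that tends
  to \<open>0\<close> at the boundary, and enlarge the cube about its centre, so that the region where \<open>\<tau>\<close> drops
  is pushed to the boundary. Then \<open>f\<close> is deformed, relative to the boundary, to a map that factors through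
  that path, and the path retracts to its starting point.
\<close>

lemma based_homotopic_const_if_free:
  fixes X :: "'a topology"
  assumes k: "0 < k" and b: "\<And>t. t \<in> cube_boundary k \<Longrightarrow> f t = b"
    and hom: "homotopic_with (const_on (cube_boundary k)) (cube k) X f (\<lambda>_. a)"
  shows "homotopic_with (\<lambda>f. \<forall>t\<in>cube_boundary k. f t = b) (cube k) X f (\<lambda>_. b)"
proof -
  let ?B = "cube_boundary k" and ?I = "top_of_set {0..1::real}" and ?P = "\<lambda>f. \<forall>t\<in>cube_boundary k. f t = b"
  let ?Z = "prod_topology ?I (cube k)"
  obtain H where H: "continuous_map ?Z X H" "\<And>x. H (0, x) = f x" "\<And>x. H (1, x) = a"
    "\<And>s. s \<in> {0..1} \<Longrightarrow> const_on ?B (\<lambda>x. H (s, x))"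
    using hom unfolding homotopic_with_def by blast
  define b0 :: "nat \<Rightarrow> real" where "b0 = (\<lambda>i\<in>{..<k}. 0)"
  have b0: "b0 \<in> ?B" using k by (auto simp: b0_def cube_boundary_def topspace_cube)
  have HB: "H (s, x) = H (s, b0)" if "s \<in> {0..1}" "x \<in> ?B" for s x
    using H(4)[OF that(1)] that b0 by (auto simp: const_on_def)
  \<comment> \<open>\<open>\<tau>\<close> is \<open>1\<close> on the concentric cube of half the size and \<open>0\<close> on the boundary; \<open>\<sigma> 1\<close> sends the complement of the half-size cube to the boundary.\<close>
  define \<tau> where "\<tau> x = (\<Prod>i<k. max 0 (min 1 (2 - 4 * \<bar>x i - 1/2\<bar>)))" for x :: "nat \<Rightarrow> real"
  define \<sigma> where "\<sigma> s x = (\<lambda>i\<in>{..<k}. max 0 (min 1 ((1 + s) * (x i - 1/2) + 1/2)))" for s :: real and x :: "nat \<Rightarrow> real"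
  have \<tau>01: "0 \<le> \<tau> x" "\<tau> x \<le> 1" for x
    unfolding \<tau>_def by (auto intro!: prod_nonneg prod_le_1)
  have \<tau>B: "\<tau> x = 0" if "x \<in> ?B" for x
  proof -
    obtain i where "i < k" "x i = 0 \<or> x i = 1" using \<open>x \<in> ?B\<close> by (auto simp: cube_boundary_def)
    then show ?thesis unfolding \<tau>_def by (intro prod_zero bexI[of _ i]) auto
  qed
  have \<sigma>cube: "\<sigma> s x \<in> topspace (cube k)" for s x
    by (auto simp: \<sigma>_def topspace_cube)
  have \<sigma>B: "\<sigma> s x \<in> ?B" if x: "x \<in> ?B" "0 \<le> s" for s x
  proof -
    obtain i where i: "i < k" "x i = 0 \<or> x i = 1" using x by (auto simp: cube_boundary_def)
    then have "\<sigma> s x i = 0 \<or> \<sigma> s x i = 1" using x(2) by (auto simp: \<sigma>_def min_def field_simps)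
    then show ?thesis using i \<sigma>cube by (auto simp: cube_boundary_def)
  qed
  have \<sigma>0: "\<sigma> 0 x = x" if "x \<in> topspace (cube k)" for x
    using cube_coordinate[OF that] that by (auto simp: \<sigma>_def topspace_cube PiE_iff extensional_def fun_eq_iff)
  have \<sigma>1: "\<sigma> 1 x \<in> ?B" if "\<tau> x \<noteq> 1" for x
  proof -
    have "\<exists>i<k. \<bar>x i - 1/2\<bar> > 1/4"
    proof (rule ccontr)
      assume "\<not> ?thesis"
      then have le: "\<bar>x i - 1/2\<bar> \<le> 1/4" if "i < k" for i using that by (meson not_le)
      have "max 0 (min 1 (2 - 4 * \<bar>x i - 1/2\<bar>)) = 1" if "i < k" for i
        using le[OF that] by (simp add: min_def)
      then have "\<tau> x = (\<Prod>i<k. 1)" unfolding \<tau>_def by (intro prod.cong) auto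
      then show False using that by simp
    qed
    then obtain i where i: "i < k" "\<bar>x i - 1/2\<bar> > 1/4" by auto
    then have "\<sigma> 1 x i = 0 \<or> \<sigma> 1 x i = 1" by (auto simp: \<sigma>_def abs_if split: if_splits)
    then show ?thesis using i \<sigma>cube by (auto simp: cube_boundary_def)
  qed
  have fstc: "continuous_map ?Z euclideanreal fst"
    using continuous_map_fst[of ?I "cube k"] by (simp add: continuous_map_in_subtopology)
  have coord: "continuous_map ?Z euclideanreal (\<lambda>z. snd z i)" if "i < k" for i
    using continuous_map_compose[OF continuous_map_snd continuous_map_cube_coordinate[OF that]] by (simp add: o_def)
  have \<tau>c: "continuous_map ?Z euclideanreal (\<lambda>z. \<tau> (snd z))"
    unfolding \<tau>_def by (intro continuous_map_prod continuous_intros coord) auto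
  have \<sigma>c: "continuous_map ?Z (cube k) (\<lambda>z. \<sigma> (fst z) (snd z))"
    by (intro continuous_map_into_cube) (auto simp: \<sigma>_def intro!: continuous_intros coord fstc)
  have cong: "?P h = ?P g" if "\<And>x. x \<in> topspace (cube k) \<Longrightarrow> h x = g x" for h g
    using that cube_boundary_subset[of k] by (auto simp: subset_iff)
  have I: "fst z \<in> {0..1}" if "z \<in> topspace ?Z" for z using that by auto
  \<comment> \<open>Enlarge the cube about its centre, and let the homotopy time decrease to \<open>0\<close> towards the boundary.\<close>
  have 1: "homotopic_with ?P (cube k) X f (\<lambda>x. H (\<tau> x, b0))"
  proof (subst homotopic_with[OF cong], assumption)
    let ?K = "\<lambda>z. H (fst z * \<tau> (snd z), \<sigma> (fst z) (snd z))"
    have "continuous_map ?Z ?Z (\<lambda>z. (fst z * \<tau> (snd z), \<sigma> (fst z) (snd z)))"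
      using \<tau>01 I
      by (intro continuous_map_pairedI \<sigma>c continuous_map_into_subtopology continuous_intros fstc \<tau>c)
        (auto intro!: mult_le_one)
    from continuous_map_compose[OF this H(1)] have "continuous_map ?Z X ?K" by (simp add: o_def)
    moreover have "?K (0, x) = f x" if "x \<in> topspace (cube k)" for x using \<sigma>0[OF that] H(2) by simp
    moreover have "?K (1, x) = H (\<tau> x, b0)" for x
      using HB[OF _ \<sigma>1, of "\<tau> x" x] \<tau>01 H(3) by (cases "\<tau> x = 1") auto
    moreover have "?K (s, x) = b" if "s \<in> {0..1}" "x \<in> ?B" for s x
      using \<tau>B[OF that(2)] \<sigma>B[OF that(2)] that(1) H(2) b by auto
    ultimately show "\<exists>h. continuous_map ?Z X h \<and> (\<forall>x\<in>topspace (cube k). h (0, x) = f x) \<and>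
        (\<forall>x\<in>topspace (cube k). h (1, x) = H (\<tau> x, b0)) \<and> (\<forall>t\<in>{0..1}. \<forall>x\<in>?B. h (t, x) = b)"
      by (intro exI[of _ ?K]) auto
  qed
  have 2: "homotopic_with ?P (cube k) X (\<lambda>x. H (\<tau> x, b0)) (\<lambda>_. b)"
  proof (subst homotopic_with[OF cong], assumption)
    let ?K = "\<lambda>z. H ((1 - fst z) * \<tau> (snd z), b0)"
    have "continuous_map ?Z ?Z (\<lambda>z. ((1 - fst z) * \<tau> (snd z), b0))"
      using \<tau>01 I b0 cube_boundary_subset[of k]
      by (intro continuous_map_pairedI continuous_map_into_subtopology continuous_intros fstc \<tau>c)
        (auto intro!: mult_le_one)
    from continuous_map_compose[OF this H(1)] have "continuous_map ?Z X ?K" by (simp add: o_def)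
    moreover have "?K (1, x) = b" for x using H(2) b[OF b0] by simp
    moreover have "?K (s, x) = b" if "x \<in> ?B" for s x using \<tau>B[OF that] H(2) b[OF b0] by simp
    ultimately show "\<exists>h. continuous_map ?Z X h \<and> (\<forall>x\<in>topspace (cube k). h (0, x) = H (\<tau> x, b0)) \<and>
        (\<forall>x\<in>topspace (cube k). h (1, x) = b) \<and> (\<forall>t\<in>{0..1}. \<forall>x\<in>?B. h (t, x) = b)"
      by (intro exI[of _ ?K]) auto
  qed
  show ?thesis by (rule homotopic_with_trans[OF 1 2])
qed

lemma cube_concat_in_cube_map:
  assumes k: "0 < k" and f: "f \<in> cube_map k X b" and h: "h \<in> cube_map k X b"
  shows "cube_concat f h \<in> cube_map k X b"
proof -
  let ?l = "\<lambda>t::nat \<Rightarrow> real. t(0 := 2 * t 0)" and ?r = "\<lambda>t::nat \<Rightarrow> real. t(0 := 2 * t 0 - 1)"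
  have ext: "t(0 := a) \<in> extensional {..<k}" if "t \<in> topspace (cube k)" for t a
    using that k by (auto simp: topspace_cube PiE_iff extensional_def)
  have coord0: "continuous_map (cube k) euclideanreal (\<lambda>t. 2 * t 0)"
    "continuous_map (cube k) euclideanreal (\<lambda>t. 2 * t 0 - 1)"
    by (intro continuous_intros continuous_map_cube_coordinate k)+
  note coord = continuous_map_from_subtopology[OF coord0(1)] continuous_map_from_subtopology[OF coord0(2)]
    continuous_map_from_subtopology[OF continuous_map_cube_coordinate]
  have "continuous_map (subtopology (cube k) {t \<in> topspace (cube k). t 0 \<le> 1/2}) (cube k) ?l"
    using k cube_coordinate[of _ k] ext
    by (intro continuous_map_into_cube) (auto simp: fun_upd_def coord)
  moreover have "continuous_map (subtopology (cube k) {t \<in> topspace (cube k). 1/2 \<le> t 0}) (cube k) ?r"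
    using k cube_coordinate[of _ k] ext
    by (intro continuous_map_into_cube) (auto simp: fun_upd_def coord)
  moreover have fc: "continuous_map (cube k) X f" "continuous_map (cube k) X h"
    and fb: "\<And>t. t \<in> cube_boundary k \<Longrightarrow> f t = b" "\<And>t. t \<in> cube_boundary k \<Longrightarrow> h t = b"
    using f h by (auto simp: cube_map_def)
  ultimately have "continuous_map (subtopology (cube k) {t \<in> topspace (cube k). t 0 \<le> 1/2}) X (\<lambda>t. f (?l t))"
    "continuous_map (subtopology (cube k) {t \<in> topspace (cube k). 1/2 \<le> t 0}) X (\<lambda>t. h (?r t))"
    using continuous_map_compose[of _ "cube k" ?l X f] continuous_map_compose[of _ "cube k" ?r X h]
    by (auto simp: o_def)
  then have "continuous_map (cube k) X (\<lambda>t. if t 0 \<le> 1/2 then f (?l t) else h (?r t))"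
  proof (rule continuous_map_cases_le[rotated 2])
    show "continuous_map (cube k) euclideanreal (\<lambda>t. t 0)" by (rule continuous_map_cube_coordinate[OF k])
    fix t assume t: "t \<in> topspace (cube k)" "t 0 = 1/2"
    have "t(0 := a) \<in> cube_boundary k" if "a = 0 \<or> a = 1" for a :: real
      using t(1) ext[OF t(1)] that k
      by (auto simp: cube_boundary_def topspace_cube PiE_iff intro!: exI[of _ 0])
    then show "f (?l t) = h (?r t)" using t(2) fb by simp
  qed simp
  moreover have "cube_concat f h t = b" if t: "t \<in> cube_boundary k" for t
  proof -
    have tc: "t \<in> topspace (cube k)" using t cube_boundary_subset by auto
    obtain i where i: "i < k" "t i = 0 \<or> t i = 1" using t by (auto simp: cube_boundary_def)
    have bd: "t(0 := a) \<in> cube_boundary k" if "0 \<le> a" "a \<le> 1" "i = 0 \<Longrightarrow> a = 0 \<or> a = 1" for a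
      using tc ext[OF tc] that i
      by (cases "i = 0") (auto simp: cube_boundary_def topspace_cube PiE_iff intro: exI[of _ i])
    show ?thesis
      using bd[of "2 * t 0"] bd[of "2 * t 0 - 1"] fb cube_coordinate[OF tc k] i(2)
      by (cases "i = 0") (auto simp: cube_concat_def)
  qed
  ultimately show ?thesis by (simp add: cube_map_def cube_concat_def[abs_def])
qed

lemma trivial_homotopy_group_if_null_homotopic:
  assumes k: "0 < k" and b: "b \<in> topspace X"
    and null: "\<And>f. f \<in> cube_map k X b \<Longrightarrow>
      homotopic_with (\<lambda>f. \<forall>t\<in>cube_boundary k. f t = b) (cube k) X f (\<lambda>_. b)"
  shows "trivial_group (homotopy_group k X b)"
proof -
  let ?R = "cube_homotopic k X b"
  let ?O = "?R `` {\<lambda>_. b}"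
  have const: "(\<lambda>_. b) \<in> cube_map k X b" using b by (simp add: cube_map_def)
  have eq: "?R `` {f} = ?O" if "f \<in> cube_map k X b" for f
    using homotopic_with_trans[OF null[OF that]] homotopic_with_trans[OF homotopic_with_symD[OF null[OF that]]]
    by (auto simp: cube_homotopic_def)
  have O_sub: "?O \<subseteq> cube_map k X b"
    unfolding cube_homotopic_def cube_map_def
    by (auto dest: homotopic_with_imp_continuous_maps homotopic_with_imp_property)
  have O_const: "(\<lambda>_. b) \<in> ?O" using b by (auto simp: cube_homotopic_def)
  have "carrier (homotopy_group k X b) = (\<lambda>f. ?R `` {f}) ` cube_map k X b"
    unfolding homotopy_group_def quotient_def by (simp add: image_def) blast
  also have "\<dots> = (\<lambda>_. ?O) ` cube_map k X b" by (rule image_cong[OF refl eq])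
  also have "\<dots> = {?O}" using const by blast
  finally have carrier: "carrier (homotopy_group k X b) = {?O}" .
  have concat: "?R `` {cube_concat f h} = ?O" if "f \<in> ?O" "h \<in> ?O" for f h
    by (rule eq[OF cube_concat_in_cube_map[OF k subsetD[OF O_sub that(1)] subsetD[OF O_sub that(2)]]])
  have "?R `` {cube_concat f h |f h. f \<in> ?O \<and> h \<in> ?O} = ?O"
  proof (intro equalityI subsetI)
    fix g assume "g \<in> ?R `` {cube_concat f h |f h. f \<in> ?O \<and> h \<in> ?O}"
    then obtain f h where fh: "f \<in> ?O" "h \<in> ?O" "g \<in> ?R `` {cube_concat f h}" by blast
    from fh(3) show "g \<in> ?O" unfolding concat[OF fh(1,2)] .
  next
    fix g assume "g \<in> ?O"
    then have "g \<in> ?R `` {cube_concat (\<lambda>_. b) (\<lambda>_. b)}" unfolding concat[OF O_const O_const] .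
    then show "g \<in> ?R `` {cube_concat f h |f h. f \<in> ?O \<and> h \<in> ?O}" using O_const by blast
  qed
  then have mult: "?O \<otimes>\<^bsub>homotopy_group k X b\<^esub> ?O = ?O" by (simp add: homotopy_group_def)
  have one: "\<one>\<^bsub>homotopy_group k X b\<^esub> = ?O" by (simp add: homotopy_group_def)
  have "group (homotopy_group k X b)" by (rule groupI) (auto simp: carrier mult one)
  then show ?thesis by (simp add: trivial_group_def carrier one)
qed

section \<open>Metrization, strict differentiability and uniform radii\<close>

text \<open>
  Urysohn's argument: countably many continuous functions separating pairs of basic open sets with disjoint
  closures embed \<open>X\<close> into a countable power of the real line.
\<close>

lemma compact_Hausdorff_second_countable_metrizable:
  assumes "compact_space X" "Hausdorff_space X" "second_countable X"
  shows "metrizable_space X"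
proof -
  obtain \<B> where \<B>: "countable \<B>" "\<And>V. V \<in> \<B> \<Longrightarrow> openin X V"
    "\<And>U x. openin X U \<Longrightarrow> x \<in> U \<Longrightarrow> \<exists>V\<in>\<B>. x \<in> V \<and> V \<subseteq> U"
    using assms(3) unfolding second_countable_def by metis
  have normal: "normal_space X" using assms compact_Hausdorff_or_regular_imp_normal_space by blast
  define I where "I = {(U, V). U \<in> \<B> \<and> V \<in> \<B> \<and> disjnt (X closure_of U) (X closure_of V)}"
  have "countable I" unfolding I_def
    by (rule countable_subset[OF _ countable_SIGMA[OF \<B>(1) \<B>(1)]]) auto
  have "\<exists>f. continuous_map X euclideanreal f \<and> f ` (X closure_of U) \<subseteq> {0} \<and> f ` (X closure_of V) \<subseteq> {1}"
    if "(U, V) \<in> I" for U V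
  proof -
    have "disjnt (X closure_of U) (X closure_of V)" using that by (simp add: I_def)
    then obtain f :: "'a \<Rightarrow> real" where "continuous_map X euclideanreal f"
      "f ` (X closure_of U) \<subseteq> {0}" "f ` (X closure_of V) \<subseteq> {1}"
      by (rule Urysohn_lemma_alt[OF normal closedin_closure_of closedin_closure_of])
    then show ?thesis by blast
  qed
  then have "\<forall>i\<in>I. \<exists>f. continuous_map X euclideanreal f \<and> f ` (X closure_of fst i) \<subseteq> {0} \<and> f ` (X closure_of snd i) \<subseteq> {1}"
    by auto
  then obtain g where g: "\<And>i. i \<in> I \<Longrightarrow> continuous_map X euclideanreal (g i)"
    "\<And>i. i \<in> I \<Longrightarrow> g i ` (X closure_of fst i) \<subseteq> {0} \<and> g i ` (X closure_of snd i) \<subseteq> {1}"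
    by metis
  define e where "e x = (\<lambda>i\<in>I. g i x)" for x
  let ?Y = "product_topology (\<lambda>_. euclideanreal) I"
  have cont: "continuous_map X ?Y e"
    unfolding continuous_map_componentwise e_def using g(1) by auto
  have inj: "inj_on e (topspace X)"
  proof (rule inj_onI, rule ccontr)
    fix x y assume xy: "x \<in> topspace X" "y \<in> topspace X" "e x = e y" "x \<noteq> y"
    have t1: "closedin X {x}" "closedin X {y}" using Hausdorff_imp_t1_space[OF assms(2)] xy(1,2)
      by (auto simp: t1_space_closedin_singleton)
    obtain h :: "'a \<Rightarrow> real" where hc: "continuous_map X euclideanreal h" and h: "h ` {x} \<subseteq> {0}" "h ` {y} \<subseteq> {1}"
      using Urysohn_lemma_alt[OF normal t1, of 0 1] xy(4) by auto
    obtain U where U: "U \<in> \<B>" "x \<in> U" "U \<subseteq> {z \<in> topspace X. h z \<in> {..<1/3}}"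
      using \<B>(3)[OF openin_continuous_map_preimage[OF hc, of "{..<1/3}"], of x] xy h by auto
    obtain V where V: "V \<in> \<B>" "y \<in> V" "V \<subseteq> {z \<in> topspace X. h z \<in> {2/3<..}}"
      using \<B>(3)[OF openin_continuous_map_preimage[OF hc, of "{2/3<..}"], of y] xy h by auto
    have "X closure_of U \<subseteq> {z \<in> topspace X. h z \<in> {..1/3}}"
      using U(3) by (intro closure_of_minimal closedin_continuous_map_preimage[OF hc]) auto
    moreover have "X closure_of V \<subseteq> {z \<in> topspace X. h z \<in> {2/3..}}"
      using V(3) by (intro closure_of_minimal closedin_continuous_map_preimage[OF hc]) auto
    ultimately have "disjnt (X closure_of U) (X closure_of V)" by (fastforce simp: disjnt_def)
    then have UV: "(U, V) \<in> I" using U V by (simp add: I_def)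
    have "x \<in> X closure_of U" "y \<in> X closure_of V"
      using closure_of_subset[OF openin_subset[OF \<B>(2)]] U V by blast+
    then have "g (U, V) x = 0" "g (U, V) y = 1" using g(2)[OF UV] by auto
    moreover have "g (U, V) x = g (U, V) y" using fun_cong[OF xy(3), of "(U, V)"] UV by (simp add: e_def)
    ultimately show False by simp
  qed
  have "Hausdorff_space ?Y" by (simp add: Hausdorff_space_product_topology)
  then have "closed_map X ?Y e"
    by (intro continuous_imp_closed_map_gen assms(1) cont Hausdorff_imp_kc_space)
  from injective_closed_imp_embedding_map[OF cont this inj]
  have hom: "X homeomorphic_space (subtopology ?Y (e ` topspace X))" by (rule embedding_map_imp_homeomorphic_space)
  have "metrizable_space ?Y"
    unfolding metrizable_space_product_topology
    using countable_subset[OF _ \<open>countable I\<close>] by (auto simp: metrizable_space_euclidean)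
  then show ?thesis using homeomorphic_metrizable_space[OF hom] metrizable_space_subtopology by blast
qed

text \<open>
  Near \<open>x\<close> the derivative of \<open>f\<close> minus its linearisation at \<open>x\<close> is small, so the mean value inequality
  applies on a ball.
\<close>

lemma strictly_differentiable:
  fixes f :: "'a::euclidean_space \<Rightarrow> 'b::euclidean_space"
  assumes "open S" "Ck_on (Suc 0) S f" "x \<in> S" "e > 0"
  obtains r where "r > 0" "ball x r \<subseteq> S"
    "\<And>a b. a \<in> ball x r \<Longrightarrow> b \<in> ball x r \<Longrightarrow>
       norm (f a - f b - frechet_derivative f (at x) (a - b)) \<le> e * norm (a - b)"
proof -
  let ?D = "\<lambda>z. frechet_derivative f (at z)"
  have der: "(f has_derivative ?D z) (at z)" if "z \<in> S" for z by (rule Ck_on_has_derivative[OF assms(2) that])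
  have lin: "linear (?D z)" if "z \<in> S" for z by (rule has_derivative_linear[OF der[OF that]])
  have cont: "continuous_on S (\<lambda>z. \<Sum>b\<in>Basis. norm (?D z b - ?D x b))"
    using assms(2) by (intro continuous_intros) auto
  then have "isCont (\<lambda>z. \<Sum>b\<in>Basis. norm (?D z b - ?D x b)) x"
    using assms(1,3) continuous_on_eq_continuous_at by blast
  then have "((\<lambda>z. \<Sum>b\<in>Basis. norm (?D z b - ?D x b)) \<longlongrightarrow> (\<Sum>b\<in>Basis. norm (?D x b - ?D x b))) (nhds x)"
    using tendsto_at_iff_tendsto_nhds[of "\<lambda>z. \<Sum>b\<in>Basis. norm (?D z b - ?D x b)" x] by (simp add: isCont_def)
  from order_tendstoD(2)[OF this, of e]
  have "eventually (\<lambda>z. (\<Sum>b\<in>Basis. norm (?D z b - ?D x b)) < e) (nhds x)" using \<open>e > 0\<close> by simp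
  then obtain r0 where r0: "r0 > 0" "\<And>z. dist z x < r0 \<Longrightarrow> (\<Sum>b\<in>Basis. norm (?D z b - ?D x b)) < e"
    by (auto simp: eventually_nhds_metric)
  obtain r1 where r1: "r1 > 0" "ball x r1 \<subseteq> S" using assms(1,3) open_contains_ball by metis
  define r where "r = min r0 r1"
  have sub: "ball x r \<subseteq> S" using r1 by (auto simp: r_def)
  show ?thesis
  proof (rule that[OF _ sub])
    show "r > 0" using r0 r1 by (simp add: r_def)
    fix a b assume ab: "a \<in> ball x r" "b \<in> ball x r"
    let ?g = "\<lambda>z. f z - ?D x z"
    have gd: "(?g has_derivative (\<lambda>h. ?D z h - ?D x h)) (at z within ball x r)" if "z \<in> ball x r" for z
      using that sub lin[OF assms(3)]
      by (intro has_derivative_diff has_derivative_at_withinI[OF der] linear_imp_has_derivative) auto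
    have bound: "onorm (\<lambda>h. ?D z h - ?D x h) \<le> e" if z: "z \<in> ball x r" for z
    proof (rule onorm_le)
      fix h
      have zS: "z \<in> S" using z sub by auto
      have "?D z h - ?D x h = (\<Sum>b\<in>Basis. (h \<bullet> b) *\<^sub>R (?D z b - ?D x b))"
        by (subst linear_expand_Basis[OF lin[OF zS], of h], subst linear_expand_Basis[OF lin[OF assms(3)], of h])
          (simp add: scaleR_diff_right sum_subtractf)
      also have "norm \<dots> \<le> (\<Sum>b\<in>Basis. norm h * norm (?D z b - ?D x b))"
        by (rule order_trans[OF norm_sum sum_mono]) (auto intro!: mult_right_mono Basis_le_norm)
      also have "\<dots> = norm h * (\<Sum>b\<in>Basis. norm (?D z b - ?D x b))" by (simp add: sum_distrib_left)
      also have "\<dots> \<le> norm h * e"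
        using r0(2)[of z] z by (intro mult_left_mono) (auto simp: r_def dist_commute)
      finally show "norm (?D z h - ?D x h) \<le> e * norm h" by (simp add: mult.commute)
    qed
    have "norm (?g a - ?g b) \<le> e * norm (a - b)"
      by (rule differentiable_bound[OF convex_ball gd bound ab])
    then show "norm (f a - f b - ?D x (a - b)) \<le> e * norm (a - b)"
      by (simp add: linear_diff[OF lin[OF assms(3)]] algebra_simps)
  qed
qed

text \<open>
  Passes from derivatives to differences. The strict inequality between the derivatives at \<open>x\<close> leaves room,
  uniformly over unit vectors, for an error \<open>e\<close> in each term, and strict differentiability bounds the
  errors of the difference quotients by \<open>e\<close> near \<open>x\<close>.
\<close>

lemma difference_contraction:
  fixes L :: "'a::euclidean_space \<Rightarrow> 'b::euclidean_space" and \<psi> :: "'j \<Rightarrow> 'a \<Rightarrow> 'c::euclidean_space"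
  assumes J: "finite J" and p: "p > 0" and linL: "linear L" and linA: "\<And>j. j \<in> J \<Longrightarrow> linear (A j)"
    and contr: "\<And>u. u \<noteq> 0 \<Longrightarrow> (\<Sum>j\<in>J. norm (A j u) powr p) < K * norm (L u) powr p"
    and f: "\<And>e. e > 0 \<Longrightarrow> \<exists>r>0. \<forall>a\<in>ball x r. \<forall>b\<in>ball x r. norm (f a - f b - L (a - b)) \<le> e * norm (a - b)"
    and \<psi>: "\<And>j e. j \<in> J \<Longrightarrow> e > 0 \<Longrightarrow> \<exists>r>0. \<forall>a\<in>ball x r. \<forall>b\<in>ball x r. norm (\<psi> j a - \<psi> j b - A j (a - b)) \<le> e * norm (a - b)"
  shows "\<exists>e>0. e \<le> 1 \<and> (\<forall>a\<in>ball x e. \<forall>b\<in>ball x e.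
    (\<Sum>j\<in>J. norm (\<psi> j a - \<psi> j b) powr p) \<le> (1 - e) * (K * norm (f a - f b) powr p))"
proof -
  \<comment> \<open>The second component of \<open>z\<close> is the error allowed in every term; at \<open>0\<close> positivity of \<open>h\<close> is \<open>contr\<close>.\<close>
  define h where "h z = (1 - snd z) * (K * (max 0 (norm (L (fst z)) - snd z)) powr p)
    - (\<Sum>j\<in>J. (norm (A j (fst z)) + snd z) powr p)" for z :: "'a \<times> real"
  have cL: "continuous_on T (\<lambda>z. L (fst z))" for T :: "('a \<times> real) set"
    by (rule continuous_on_compose2[OF linear_continuous_on[OF linear_conv_bounded_linear[THEN iffD1, OF linL]]])
      (auto intro: continuous_intros)
  have cA: "continuous_on T (\<lambda>z. A j (fst z))" if "j \<in> J" for j and T :: "('a \<times> real) set"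
    by (rule continuous_on_compose2[OF linear_continuous_on[OF linear_conv_bounded_linear[THEN iffD1, OF linA[OF that]]]])
      (auto intro: continuous_intros)
  let ?T = "sphere (0::'a) 1 \<times> {0..1::real}"
  have ch: "continuous_on ?T h"
    unfolding h_def using p
    by (intro continuous_intros continuous_on_powr' cL cA) auto
  have compT: "compact ?T" by (intro compact_Times compact_sphere compact_Icc)
  have "closed (?T \<inter> h -` {..0})"
    by (rule continuous_closed_preimage[OF ch compact_imp_closed[OF compT]]) simp
  from compact_Int_closed[OF compT this] have comp: "compact (?T \<inter> h -` {..0})" by (simp add: Int_assoc[symmetric])
  have "\<exists>e>0. e \<le> 1 \<and> (\<forall>u\<in>sphere 0 1. h (u, e) > 0)"
  proof (cases "?T \<inter> h -` {..0} = {}")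
    case True
    then show ?thesis by (intro exI[of _ 1]) (auto simp: disjoint_iff not_le)
  next
    case False
    have "continuous_on (?T \<inter> h -` {..0}) snd" by (intro continuous_intros)
    from continuous_attains_inf[OF comp False this] obtain z0 where
      z0: "z0 \<in> ?T \<inter> h -` {..0}" "\<And>z. z \<in> ?T \<inter> h -` {..0} \<Longrightarrow> snd z0 \<le> snd z" by blast
    have "snd z0 \<noteq> 0"
    proof
      assume 0: "snd z0 = 0"
      have "fst z0 \<noteq> 0" using z0(1) by auto
      from contr[OF this] have "h z0 > 0" by (simp add: h_def 0)
      then show False using z0(1) by auto
    qed
    then have pos: "snd z0 > 0" "snd z0 \<le> 1" using z0(1) by auto
    show ?thesis
    proof (intro exI[of _ "snd z0 / 2"] conjI ballI)
      fix u :: 'a assume "u \<in> sphere 0 1"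
      then show "h (u, snd z0 / 2) > 0" using z0(2)[of "(u, snd z0 / 2)"] pos by (cases "h (u, snd z0 / 2) > 0") auto
    qed (use pos in auto)
  qed
  then obtain e where e: "e > 0" "e \<le> 1" "\<And>u. u \<in> sphere 0 1 \<Longrightarrow> h (u, e) > 0" by blast
  obtain r0 where r0: "r0 > 0" "\<And>a b. a \<in> ball x r0 \<Longrightarrow> b \<in> ball x r0 \<Longrightarrow> norm (f a - f b - L (a - b)) \<le> e * norm (a - b)"
    using f[OF e(1)] by blast
  have "\<forall>j\<in>J. \<exists>r>0. \<forall>a\<in>ball x r. \<forall>b\<in>ball x r. norm (\<psi> j a - \<psi> j b - A j (a - b)) \<le> e * norm (a - b)"
    using \<psi> e(1) by blast
  then obtain r where r: "\<And>j. j \<in> J \<Longrightarrow> r j > 0"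
    "\<And>j a b. j \<in> J \<Longrightarrow> a \<in> ball x (r j) \<Longrightarrow> b \<in> ball x (r j) \<Longrightarrow> norm (\<psi> j a - \<psi> j b - A j (a - b)) \<le> e * norm (a - b)"
    by metis
  define \<rho> where "\<rho> = Min (insert r0 (insert e (r ` J)))"
  have \<rho>: "\<rho> > 0" "\<rho> \<le> e" "\<rho> \<le> r0" "\<And>j. j \<in> J \<Longrightarrow> \<rho> \<le> r j"
  proof -
    have fin: "finite (insert r0 (insert e (r ` J)))" using J by simp
    show "\<rho> > 0" unfolding \<rho>_def using e(1) r0(1) r(1) by (subst Min_gr_iff[OF fin]) auto
    show "\<rho> \<le> e" "\<rho> \<le> r0" "\<And>j. j \<in> J \<Longrightarrow> \<rho> \<le> r j"
      unfolding \<rho>_def by (rule Min_le[OF fin], simp)+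
  qed
  show ?thesis
  proof (intro exI[of _ \<rho>] conjI ballI)
    show "\<rho> > 0" "\<rho> \<le> 1" using \<rho> e by auto
    fix a b assume ab: "a \<in> ball x \<rho>" "b \<in> ball x \<rho>"
    show "(\<Sum>j\<in>J. norm (\<psi> j a - \<psi> j b) powr p) \<le> (1 - \<rho>) * (K * norm (f a - f b) powr p)"
    proof (cases "a = b")
      case False
      define c where "c = norm (a - b)"
      define u where "u = (1 / c) *\<^sub>R (a - b)"
      have c: "c > 0" and u: "norm u = 1" "a - b = c *\<^sub>R u" using False by (auto simp: c_def u_def)
      have \<psi>le: "norm (\<psi> j a - \<psi> j b) \<le> c * (norm (A j u) + e)" if "j \<in> J" for j
      proof -
        have "norm (\<psi> j a - \<psi> j b - A j (a - b)) \<le> e * c" unfolding c_def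
          using ab \<rho>(4)[OF that] by (intro r(2)[OF that]) auto
        moreover have "norm (A j (a - b)) = c * norm (A j u)"
          using c by (simp add: u(2) linear_cmul[OF linA[OF that]])
        ultimately show ?thesis
          using norm_triangle_sub[of "\<psi> j a - \<psi> j b" "A j (a - b)"] by (simp add: algebra_simps)
      qed
      have fge: "c * max 0 (norm (L u) - e) \<le> norm (f a - f b)"
      proof -
        have "norm (f a - f b - L (a - b)) \<le> e * c" unfolding c_def
          using ab \<rho>(3) by (intro r0(2)) auto
        moreover have "norm (L (a - b)) = c * norm (L u)" using c by (simp add: u(2) linear_cmul[OF linL])
        moreover have "norm (L (a - b)) \<le> norm (f a - f b) + norm (f a - f b - L (a - b))"
          using norm_triangle_sub[of "L (a - b)" "f a - f b"] by (simp add: norm_minus_commute)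
        ultimately have "c * (norm (L u) - e) \<le> norm (f a - f b)" by (simp add: algebra_simps)
        then show ?thesis using c by (simp add: max_def)
      qed
      have K: "K \<ge> 0"
      proof -
        have "u \<noteq> 0" using u by auto
        have "0 \<le> (\<Sum>j\<in>J. norm (A j u) powr p)" by (intro sum_nonneg) auto
        also have "\<dots> < K * norm (L u) powr p" by (rule contr[OF \<open>u \<noteq> 0\<close>])
        finally show ?thesis by (simp add: zero_less_mult_iff)
      qed
      have "(\<Sum>j\<in>J. norm (\<psi> j a - \<psi> j b) powr p) \<le> (\<Sum>j\<in>J. (c * (norm (A j u) + e)) powr p)"
        using p by (intro sum_mono powr_mono2 \<psi>le) auto
      also have "\<dots> = c powr p * (\<Sum>j\<in>J. (norm (A j u) + e) powr p)"
        using c e(1) by (simp add: powr_mult sum_distrib_left)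
      also have "\<dots> \<le> c powr p * ((1 - e) * (K * (max 0 (norm (L u) - e)) powr p))"
        using e(3)[of u] u(1) by (intro mult_left_mono) (auto simp: h_def)
      also have "\<dots> = (1 - e) * (K * (c * max 0 (norm (L u) - e)) powr p)"
        using c by (simp add: powr_mult)
      also have "\<dots> \<le> (1 - e) * (K * norm (f a - f b) powr p)"
        using e(2) K p c by (intro mult_left_mono powr_mono2 fge) auto
      also have "\<dots> \<le> (1 - \<rho>) * (K * norm (f a - f b) powr p)"
        using \<rho>(2) K by (intro mult_right_mono) auto
      finally show ?thesis .
    qed (use p in simp)
  qed
qed

text \<open>
  A finite subcover has a smallest radius, and \<open>Q\<close> passes to smaller radii.
\<close>

lemma (in Metric_space) uniform_radius:
  assumes "compact_space mtopology"
    and mono: "\<And>x e e'. \<lbrakk>x \<in> M; Q x e; 0 < e'; e' \<le> e\<rbrakk> \<Longrightarrow> Q x e'"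
    and loc: "\<And>x. x \<in> M \<Longrightarrow> \<exists>e>0. \<forall>y\<in>mball x e. Q y e"
  shows "\<exists>e>0. \<forall>x\<in>M. Q x (e::real)"
proof -
  obtain e where e: "\<And>x. x \<in> M \<Longrightarrow> e x > 0" "\<And>x y. x \<in> M \<Longrightarrow> y \<in> mball x (e x) \<Longrightarrow> Q y (e x)"
    using loc by metis
  have "compactin mtopology M" using assms(1) by (simp add: compact_space_def)
  moreover have "\<forall>U\<in>(\<lambda>x. mball x (e x)) ` M. openin mtopology U" by auto
  moreover have "M \<subseteq> \<Union>((\<lambda>x. mball x (e x)) ` M)" using e(1) by auto
  ultimately obtain \<F> where \<F>: "finite \<F>" "\<F> \<subseteq> (\<lambda>x. mball x (e x)) ` M" "M \<subseteq> \<Union>\<F>"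
    unfolding compactin_def by metis
  obtain D where D: "D \<subseteq> M" "finite D" "\<F> = (\<lambda>x. mball x (e x)) ` D"
    using finite_subset_image[OF \<F>(1,2)] by blast
  with \<F>(3) have cover: "M \<subseteq> (\<Union>x\<in>D. mball x (e x))" by simp
  define e0 where "e0 = Min (insert 1 (e ` D))"
  have e0: "e0 > 0" "\<And>x. x \<in> D \<Longrightarrow> e0 \<le> e x" using D e(1) by (auto simp: e0_def)
  show ?thesis
  proof (intro exI[of _ e0] conjI ballI)
    fix y assume "y \<in> M"
    then obtain x where x: "x \<in> D" "y \<in> mball x (e x)" using cover by blast
    show "Q y e0" using mono[OF \<open>y \<in> M\<close> e(2) e0(1) e0(2)[OF x(1)]] x D(1) by blast
  qed (rule e0)
qed

context tubular_immersion
begin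

text \<open>
  Project the segment from \<open>F x\<close> to \<open>F y\<close> to \<open>M\<close>.
\<close>

lemma path_component_if_near:
  assumes "x \<in> M" "y \<in> M" "d x y < \<delta>"
  shows "path_component_of mtopology x y"
proof -
  have "continuous_map (top_of_set {0..1}) mtopology (\<lambda>t. \<rho> x (F x + t *\<^sub>R (F y - F x)))"
  proof (rule \<rho>_continuous_compose)
    show "norm (F x + t *\<^sub>R (F y - F x) - F x) < \<eta>" if "t \<in> topspace (top_of_set {0..1})" for t
      using that F_near[OF assms] mult_left_le_one_le[of "norm (F y - F x)" t] by simp
  qed (use assms(1) in \<open>auto intro!: continuous_intros simp: continuous_map_iff_continuous\<close>)
  moreover have "\<rho> x (F x) = x" using \<rho>_F[of x x] assms(1) \<delta>_pos by simp
  ultimately show ?thesis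
    unfolding path_component_of_def pathin_def
    using \<rho>_F[OF assms] by (intro exI[of _ "\<lambda>t. \<rho> x (F x + t *\<^sub>R (F y - F x))"]) auto
qed

lemma path_connected_if_connected:
  assumes "connected_space mtopology"
  shows "path_connected_space mtopology"
  unfolding path_connected_space_iff_path_component topspace_mtopology
proof (intro ballI)
  fix x y assume xy: "x \<in> M" "y \<in> M"
  let ?P = "\<lambda>z. path_component_of mtopology x z"
  have near: "?P z \<longleftrightarrow> ?P z'" if "z \<in> M" "z' \<in> M" "d z z' < \<delta>" for z z'
    using path_component_if_near[OF that] path_component_of_trans path_component_of_sym by metis
  have op: "openin mtopology {z \<in> M. R z}"
    if R: "\<And>z z'. z \<in> M \<Longrightarrow> z' \<in> M \<Longrightarrow> d z z' < \<delta> \<Longrightarrow> R z \<Longrightarrow> R z'" for R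
    unfolding openin_mtopology
  proof (intro conjI allI impI)
    fix z assume z: "z \<in> {z \<in> M. R z}"
    have "mball z \<delta> \<subseteq> {z \<in> M. R z}" using R[of z] z by auto
    then show "\<exists>r>0. mball z r \<subseteq> {z \<in> M. R z}" using \<delta>_pos by blast
  qed auto
  have "openin mtopology {z \<in> M. ?P z}" by (rule op) (use near in blast)
  moreover have "openin mtopology {z \<in> M. \<not> ?P z}" by (rule op) (use near in blast)
  moreover have "M - {z \<in> M. ?P z} = {z \<in> M. \<not> ?P z}" by auto
  ultimately have "openin mtopology {z \<in> M. ?P z} \<and> closedin mtopology {z \<in> M. ?P z}"
    by (simp add: closedin_def)
  then have "{z \<in> M. ?P z} = {} \<or> {z \<in> M. ?P z} = M"
    using assms unfolding connected_space_clopen_in topspace_mtopology by blast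
  moreover have "?P x" using xy by (simp add: path_component_of_refl)
  ultimately show "?P y" using xy by blast
qed

end

section \<open>A tube around a compact immersed space\<close>

text \<open>
  A compact manifold with an unstable immersion, stripped to a metric space covered by patches. The metric
  measures closeness. The type argument records the dimension of the
  charts.
\<close>

locale patched_immersion = Metric_space M d for M :: "'a set" and d +
  fixes F :: "'a \<Rightarrow> real^'q" and chart_dimension :: "'m::finite itself"
  assumes compact_M: "compact_space mtopology"
    and F_continuous: "continuous_map mtopology euclidean F"
    and charts: "x \<in> M \<Longrightarrow> \<exists>(S :: (real^'m) set) f ch \<psi> B. x \<in> B \<and> openin mtopology B \<and> local_immersion S f \<and>
       (\<forall>\<xi>\<in>S. local_immersion.unstable_at f \<xi>) \<and> (\<forall>y\<in>B. ch y \<in> S \<and> \<psi> (ch y) = y) \<and>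
       (\<forall>\<xi>\<in>S. \<psi> \<xi> \<in> B \<and> F (\<psi> \<xi>) = f \<xi> \<and> ch (\<psi> \<xi>) = \<xi>) \<and>
       continuous_map (subtopology mtopology B) euclidean ch \<and> continuous_map (top_of_set S) mtopology \<psi>"
begin

text \<open>
  On \<open>B\<close> the values of \<open>F\<close> stay in the inner half of the ball around \<open>f \<xi>0\<close> in which foot points are
  unique; points displaced by less than \<open>k / 2\<close> remain in that ball.
\<close>

definition good_patch where
  "good_patch (S :: (real^'m) set) f \<xi>0 s k W y ch \<psi> B \<longleftrightarrow>
     foot_patch S f \<xi>0 s k W y \<and> openin mtopology B \<and> (\<forall>\<xi>\<in>S. local_immersion.unstable_at f \<xi>) \<and>
     continuous_map (subtopology mtopology B) euclidean ch \<and> continuous_map (top_of_set S) mtopology \<psi> \<and>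
     (\<forall>x\<in>B. ch x \<in> ball \<xi>0 s \<and> \<psi> (ch x) = x \<and> norm (F x - f \<xi>0) < k / 2) \<and>
     (\<forall>\<xi>\<in>S. \<psi> \<xi> \<in> M \<and> F (\<psi> \<xi>) = f \<xi>)"

definition has_patch :: "'a \<Rightarrow> real \<Rightarrow> bool" where
  "has_patch x e \<longleftrightarrow> (\<exists>S f s k W y ch \<psi> B. good_patch S f (ch x) s k W y ch \<psi> B \<and> mball x e \<subseteq> B \<and> e \<le> k / 2)"

lemma F_near:
  assumes "x \<in> M" "e > 0"
  obtains r where "r > 0" "\<And>y. y \<in> mball x r \<Longrightarrow> norm (F y - F x) < e"
proof -
  have "openin mtopology {y \<in> topspace mtopology. F y \<in> ball (F x) e}"
    by (rule openin_continuous_map_preimage[OF F_continuous]) simp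
  moreover have "x \<in> {y \<in> topspace mtopology. F y \<in> ball (F x) e}" using assms by simp
  ultimately obtain r where "r > 0" "mball x r \<subseteq> {y \<in> topspace mtopology. F y \<in> ball (F x) e}"
    unfolding openin_mtopology by blast
  then show ?thesis by (intro that[of r]) (auto simp: dist_norm norm_minus_commute)
qed

lemma ex_has_patch:
  assumes x: "x \<in> M"
  shows "\<exists>e>0. has_patch x e"
proof -
  obtain S :: "(real^'m) set" and f ch \<psi> B where B: "x \<in> B" "openin mtopology B" and imm: "local_immersion S f"
    and un: "\<forall>\<xi>\<in>S. local_immersion.unstable_at f \<xi>" and ch: "\<forall>y\<in>B. ch y \<in> S \<and> \<psi> (ch y) = y"
    and \<psi>: "\<forall>\<xi>\<in>S. \<psi> \<xi> \<in> B \<and> F (\<psi> \<xi>) = f \<xi> \<and> ch (\<psi> \<xi>) = \<xi>"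
    and c: "continuous_map (subtopology mtopology B) euclidean ch" "continuous_map (top_of_set S) mtopology \<psi>"
    using charts[OF x] by metis
  interpret local_immersion S f by (rule imm)
  have "ch x \<in> S" using ch B by blast
  then obtain s k W y where foot: "s > 0" "k > 0" "ball (ch x) s \<subseteq> S"
    "\<And>w z z'. \<lbrakk>w \<in> ball (f (ch x)) k; z \<in> ball (ch x) s; z' \<in> ball (ch x) s; foot_defect z w = 0; foot_defect z' w = 0\<rbrakk> \<Longrightarrow> z = z'"
    "open W" "W = {w \<in> ball (f (ch x)) k. \<exists>z\<in>ball (ch x) s. foot_defect z w = 0}"
    "\<And>w. w \<in> W \<Longrightarrow> y w \<in> ball (ch x) s \<and> foot_defect (y w) w = 0"
    "\<And>j. Ck_on j W y"
    by (rule smooth_foot_point) blast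
  have patch: "foot_patch S f (ch x) s k W y"
    by unfold_locales (use foot in blast)+
  obtain r where r: "r > 0" "\<And>y. y \<in> mball x r \<Longrightarrow> norm (F y - F x) < k / 2"
    using F_near[OF x, of "k / 2"] foot(2) by auto
  define B' where "B' = {z \<in> B. ch z \<in> ball (ch x) s} \<inter> mball x r"
  have fx: "f (ch x) = F x" using ch \<psi> B by metis
  have "openin (subtopology mtopology B) {z \<in> topspace (subtopology mtopology B). ch z \<in> ball (ch x) s}"
    by (rule openin_continuous_map_preimage[OF c(1)]) simp
  moreover have tB: "topspace (subtopology mtopology B) = B" using openin_subset[OF B(2)] by auto
  ultimately have "openin (subtopology mtopology B) {z \<in> B. ch z \<in> ball (ch x) s}" unfolding tB by simp
  then have "openin mtopology {z \<in> B. ch z \<in> ball (ch x) s}"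
    using B(2) by (rule openin_trans_full)
  then have B': "openin mtopology B'" unfolding B'_def by (intro openin_Int) auto
  have "x \<in> B'" using B x foot(1) r(1) by (simp add: B'_def)
  then obtain e where e: "e > 0" "mball x e \<subseteq> B'" using B' unfolding openin_mtopology by blast
  have "good_patch S f (ch x) s k W y ch \<psi> B'"
    unfolding good_patch_def
  proof (intro conjI)
    show "continuous_map (subtopology mtopology B') euclidean ch"
      by (rule continuous_map_from_subtopology_mono[OF c(1)]) (auto simp: B'_def)
    show "\<forall>x'\<in>B'. ch x' \<in> ball (ch x) s \<and> \<psi> (ch x') = x' \<and> norm (F x' - f (ch x)) < k / 2"
      using ch r(2) by (auto simp: B'_def fx)
    show "\<forall>\<xi>\<in>S. \<psi> \<xi> \<in> M \<and> F (\<psi> \<xi>) = f \<xi>" using \<psi> openin_subset[OF B(2)] by auto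
  qed (use patch B' un c in auto)
  moreover have "mball x (min e (k / 2)) \<subseteq> B'" using e(2) by auto
  ultimately have "has_patch x (min e (k / 2))" unfolding has_patch_def by (meson min.cobounded2)
  then show ?thesis using e(1) foot(2) by (intro exI[of _ "min e (k / 2)"]) auto
qed

definition near_patch where
  "near_patch x r S f \<xi>0 s k W y ch \<psi> B \<longleftrightarrow> good_patch S f \<xi>0 s k W y ch \<psi> B \<and> mball x r \<subseteq> B \<and> r \<le> k / 2"

lemma uniform_near_patch:
  obtains e where "e > 0" "\<And>x. x \<in> M \<Longrightarrow> \<exists>S f \<xi>0 s k W y ch \<psi> B. near_patch x e S f \<xi>0 s k W y ch \<psi> B"
proof -
  have "\<exists>e>0. \<forall>x\<in>M. \<exists>S f \<xi>0 s k W y ch \<psi> B. near_patch x e S f \<xi>0 s k W y ch \<psi> B"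
  proof (rule uniform_radius[OF compact_M])
    fix x e e'
    assume "\<exists>S f \<xi>0 s k W y ch \<psi> B. near_patch x e S f \<xi>0 s k W y ch \<psi> B" and e: "0 < e'" "e' \<le> e"
    then obtain S f \<xi>0 s k W y ch \<psi> B where "near_patch x e S f \<xi>0 s k W y ch \<psi> B" by blast
    moreover have "mball x e' \<subseteq> mball x e" using e by auto
    ultimately have "near_patch x e' S f \<xi>0 s k W y ch \<psi> B" using e by (auto simp: near_patch_def)
    then show "\<exists>S f \<xi>0 s k W y ch \<psi> B. near_patch x e' S f \<xi>0 s k W y ch \<psi> B" by blast
  next
    fix x assume "x \<in> M"
    then obtain e where e: "e > 0" "has_patch x e" using ex_has_patch by blast
    then obtain S f s k W y ch \<psi> B where p: "good_patch S f (ch x) s k W y ch \<psi> B" "mball x e \<subseteq> B" "e \<le> k / 2"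
      unfolding has_patch_def by blast
    have near: "near_patch x' (e/2) S f (ch x) s k W y ch \<psi> B" if "x' \<in> mball x (e/2)" for x'
    proof -
      have "mball x' (e/2) \<subseteq> mball x e" using that triangle by (smt (verit) field_sum_of_halves in_mball subsetI)
      then show ?thesis using p e(1) by (auto simp: near_patch_def)
    qed
    have "\<forall>x'\<in>mball x (e/2). \<exists>S f \<xi>0 s k W y ch \<psi> B. near_patch x' (e/2) S f \<xi>0 s k W y ch \<psi> B"
      by (intro ballI exI) (rule near)
    then show "\<exists>e>0. \<forall>x'\<in>mball x e. \<exists>S f \<xi>0 s k W y ch \<psi> B. near_patch x' e S f \<xi>0 s k W y ch \<psi> B"
      using e(1) half_gt_zero by blast
  qed
  then show ?thesis using that by blast
qed

end

text \<open>
  Balls of radius \<open>2 * R\<close> lie in single patches. By the last assumption, points at a distance between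
  \<open>R / 8\<close> and \<open>R / 2\<close> have images at least \<open>\<theta>\<close> apart. Hence for \<open>w\<close> near \<open>F x\<close> a minimiser of the distance
  to \<open>w\<close> over the ball of radius \<open>R / 2\<close> lies well inside this ball.
\<close>

locale tube_radii = patched_immersion M d F chart_dimension for M :: "'a set" and d and F :: "'a \<Rightarrow> real^'q" and chart_dimension :: "'m::finite itself" +
  fixes R \<theta> :: real
  assumes R_pos: "R > 0" and \<theta>_pos: "\<theta> > 0"
    and near_patches: "x \<in> M \<Longrightarrow> \<exists>(S :: (real^'m) set) f \<xi>0 s k W y ch \<psi> B. near_patch x (2 * R) S f \<xi>0 s k W y ch \<psi> B"
    and F_expanding: "\<lbrakk>x \<in> M; y \<in> M; d x y \<le> R / 2; norm (F x - F y) < \<theta>\<rbrakk> \<Longrightarrow> d x y < R / 8"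
begin

definition \<eta>0 where "\<eta>0 = min R (\<theta> / 2)"

lemma \<eta>0_pos: "\<eta>0 > 0" using R_pos \<theta>_pos by (simp add: \<eta>0_def)

definition nearest :: "'a \<Rightarrow> real^'q \<Rightarrow> 'a \<Rightarrow> bool" where
  "nearest x w y \<longleftrightarrow> y \<in> M \<and> d x y \<le> R / 2 \<and> (\<forall>z\<in>M. d x z \<le> R / 2 \<longrightarrow> norm (F y - w) \<le> norm (F z - w))"

definition \<rho> :: "'a \<Rightarrow> real^'q \<Rightarrow> 'a" where "\<rho> x w = (SOME y. nearest x w y)"

lemma ex_nearest:
  assumes "x \<in> M"
  shows "\<exists>y. nearest x w y"
proof -
  have "compactin mtopology (mcball x (R / 2))"
    using closedin_compact_space[OF compact_M closedin_mcball] .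
  moreover have "continuous_map mtopology euclideanreal (\<lambda>y. norm (F y - w))"
    by (intro continuous_intros F_continuous) simp
  ultimately have "compact ((\<lambda>y. norm (F y - w)) ` mcball x (R / 2))"
    using image_compactin by fastforce
  moreover have "x \<in> mcball x (R / 2)" using assms R_pos by simp
  ultimately obtain m where "m \<in> (\<lambda>y. norm (F y - w)) ` mcball x (R / 2)"
    "\<forall>t\<in>(\<lambda>y. norm (F y - w)) ` mcball x (R / 2). m \<le> t"
    using compact_attains_inf[of "(\<lambda>y. norm (F y - w)) ` mcball x (R / 2)"] by blast
  then obtain y where "y \<in> mcball x (R / 2)" "\<forall>z\<in>mcball x (R / 2). norm (F y - w) \<le> norm (F z - w)" by blast
  then have "nearest x w y" using assms by (auto simp: nearest_def)
  then show ?thesis by blast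
qed

lemma nearest_near:
  assumes "x \<in> M" "norm (w - F x) < \<eta>0" "nearest x w y"
  shows "d x y < R / 8"
proof -
  have "norm (F y - w) \<le> norm (F x - w)" using assms R_pos by (simp add: nearest_def)
  then have "norm (F x - F y) < \<theta>"
    using assms(2) norm_triangle_ineq4[of "F x - w" "F y - w"] by (simp add: \<eta>0_def norm_minus_commute)
  then show ?thesis using assms by (intro F_expanding) (auto simp: nearest_def)
qed

text \<open>
  An interior minimum of the squared distance is a critical point, and the only critical point in the patch
  is the foot point.
\<close>

lemma nearest_eq_foot_point:
  assumes x: "x \<in> M" "norm (w - F x) < \<eta>0" "nearest x w y"
    and P: "near_patch x R S f \<xi>0 s k W yy ch \<psi> B"
  shows "w \<in> W \<and> y = \<psi> (yy w)"
proof -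
  have g: "good_patch S f \<xi>0 s k W yy ch \<psi> B" and B: "mball x R \<subseteq> B" "R \<le> k / 2"
    using P by (auto simp: near_patch_def)
  interpret foot_patch S f \<xi>0 s k W yy using g by (simp add: good_patch_def)
  have yM: "y \<in> M" and y8: "d x y < R / 8" using x nearest_near by (auto simp: nearest_def)
  have "y \<in> mball x R" using x(1) yM y8 R_pos by simp
  then have yB: "y \<in> B" using B by blast
  have xB: "x \<in> B" using B(1) x(1) R_pos by (meson centre_in_mball_iff subsetD)
  define \<xi> where "\<xi> = ch y"
  have \<xi>: "\<xi> \<in> ball \<xi>0 s" "\<psi> \<xi> = y" using g yB by (auto simp: good_patch_def \<xi>_def)
  have \<xi>S: "\<xi> \<in> S" using \<xi>(1) ball_S by blast
  have F\<psi>: "F (\<psi> \<zeta>) = f \<zeta>" "\<psi> \<zeta> \<in> M" if "\<zeta> \<in> S" for \<zeta> using g that by (auto simp: good_patch_def)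
  have \<psi>c: "continuous_map (top_of_set S) mtopology \<psi>" using g by (simp add: good_patch_def)
  have "openin (top_of_set S) {\<zeta> \<in> topspace (top_of_set S). \<psi> \<zeta> \<in> mball x (R / 2)}"
    by (rule openin_continuous_map_preimage[OF \<psi>c]) simp
  then have op: "open {\<zeta> \<in> S. \<psi> \<zeta> \<in> mball x (R / 2)}" using open_S by (simp add: openin_open_eq)
  have der: "((\<lambda>\<zeta>. (f \<zeta> - w) \<bullet> (f \<zeta> - w)) has_derivative (\<lambda>u. (f \<xi> - w) \<bullet> Df \<xi> u + Df \<xi> u \<bullet> (f \<xi> - w))) (at \<xi>)"
    using f_has_derivative[OF \<xi>S] by (auto intro!: derivative_eq_intros)
  have "(\<lambda>u. (f \<xi> - w) \<bullet> Df \<xi> u + Df \<xi> u \<bullet> (f \<xi> - w)) = (\<lambda>u. 0)"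
  proof (rule differential_zero_maxmin[OF _ op der])
    show "\<xi> \<in> {\<zeta> \<in> S. \<psi> \<zeta> \<in> mball x (R / 2)}" using \<xi>S \<xi>(2) yM x(1) y8 R_pos by simp
    have "norm (f \<xi> - w) \<le> norm (f \<zeta> - w)" if "\<zeta> \<in> S" "\<psi> \<zeta> \<in> mball x (R / 2)" for \<zeta>
    proof -
      have "norm (F y - w) \<le> norm (F (\<psi> \<zeta>) - w)" using x(3) that by (auto simp: nearest_def)
      then show ?thesis using F\<psi>[OF that(1)] F\<psi>[OF \<xi>S] \<xi>(2) by simp
    qed
    then show "(\<forall>\<zeta>\<in>{\<zeta> \<in> S. \<psi> \<zeta> \<in> mball x (R / 2)}. (f \<zeta> - w) \<bullet> (f \<zeta> - w) \<le> (f \<xi> - w) \<bullet> (f \<xi> - w)) \<or>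
        (\<forall>\<zeta>\<in>{\<zeta> \<in> S. \<psi> \<zeta> \<in> mball x (R / 2)}. (f \<xi> - w) \<bullet> (f \<xi> - w) \<le> (f \<zeta> - w) \<bullet> (f \<zeta> - w))"
      by (simp add: norm_le)
  qed
  from fun_cong[OF this] have "Df \<xi> u \<bullet> (f \<xi> - w) = 0" for u by (simp add: inner_commute)
  then have 0: "foot_defect \<xi> w = 0" using foot_defect_eq_0_iff[OF \<xi>S] by blast
  have "norm (F x - f \<xi>0) < k / 2" using g xB by (simp add: good_patch_def)
  then have wk: "w \<in> ball (f \<xi>0) k"
    using x(2) B(2) norm_triangle_ineq[of "w - F x" "F x - f \<xi>0"] by (simp add: \<eta>0_def dist_norm norm_minus_commute)
  have "w \<in> W" unfolding W_eq using wk \<xi>(1) 0 by blast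
  then have "yy w = \<xi>" using foot[OF \<open>w \<in> W\<close>] foot_unique[OF wk _ \<xi>(1) _ 0] by blast
  then show ?thesis using \<xi>(2) \<open>w \<in> W\<close> by simp
qed

lemma near_patch_R:
  assumes "near_patch x (2 * R) S f \<xi>0 s k W y ch \<psi> B" "x' \<in> mball x R"
  shows "near_patch x' R S f \<xi>0 s k W y ch \<psi> B"
proof -
  have "mball x' R \<subseteq> mball x (2 * R)" using assms(2) triangle by (smt (verit) in_mball subsetI)
  then show ?thesis using assms(1) R_pos by (auto simp: near_patch_def)
qed

lemma ex_near_patch_R:
  assumes "x \<in> M"
  shows "\<exists>(S :: (real^'m) set) f \<xi>0 s k W y ch \<psi> B. near_patch x R S f \<xi>0 s k W y ch \<psi> B"
proof -
  obtain S :: "(real^'m) set" and f \<xi>0 s k W y ch \<psi> B where P: "near_patch x (2 * R) S f \<xi>0 s k W y ch \<psi> B"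
    using near_patches[OF assms] by blast
  have "x \<in> mball x R" using assms R_pos by simp
  from near_patch_R[OF P this] show ?thesis by blast
qed

lemma \<rho>_eqI:
  assumes "x \<in> M" "norm (w - F x) < \<eta>0" "nearest x w y"
  shows "\<rho> x w = y"
proof -
  obtain S :: "(real^'m) set" and f \<xi>0 s k W yy ch \<psi> B where P: "near_patch x R S f \<xi>0 s k W yy ch \<psi> B"
    using ex_near_patch_R[OF assms(1)] by blast
  have "nearest x w (\<rho> x w)" unfolding \<rho>_def using someI_ex[OF ex_nearest[OF assms(1)]] .
  then show ?thesis using nearest_eq_foot_point[OF assms(1,2) _ P] assms(3) by metis
qed

lemma nearest_\<rho>: "x \<in> M \<Longrightarrow> nearest x w (\<rho> x w)"
  unfolding \<rho>_def using someI_ex[OF ex_nearest] .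

lemma \<rho>_patch:
  assumes "x \<in> M" "norm (w - F x) < \<eta>0" and P: "near_patch x R S f \<xi>0 s k W y ch \<psi> B"
  shows "w \<in> W" "\<rho> x w = \<psi> (y w)" "F (\<rho> x w) = f (y w)"
proof -
  have *: "w \<in> W \<and> \<rho> x w = \<psi> (y w)" by (rule nearest_eq_foot_point[OF assms(1,2) nearest_\<rho>[OF assms(1)] P])
  then show "w \<in> W" "\<rho> x w = \<psi> (y w)" by auto
  have g: "good_patch S f \<xi>0 s k W y ch \<psi> B" using P by (simp add: near_patch_def)
  interpret foot_patch S f \<xi>0 s k W y using g by (simp add: good_patch_def)
  have "y w \<in> S" using foot * ball_S by blast
  then show "F (\<rho> x w) = f (y w)" using * g by (simp add: good_patch_def)
qed

text \<open>
  Locally \<open>\<rho>\<close> is the smooth foot-point map. If \<open>x\<close> and \<open>y\<close> are close, the nearest points seen from \<open>x\<close> and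
  from \<open>y\<close> lie in both balls of radius \<open>R / 2\<close>, so each of them minimises over both balls.
\<close>

lemma \<rho>_tubular:
  assumes "0 < \<delta>" "\<delta> \<le> R / 8" "0 < \<eta>" "\<eta> \<le> \<eta>0"
    and near: "\<And>x y. x \<in> M \<Longrightarrow> y \<in> M \<Longrightarrow> d x y < \<delta> \<Longrightarrow> norm (F y - F x) < \<eta>"
  shows "tubular_immersion M d F \<rho> \<delta> \<eta>"
proof unfold_locales
  show "\<rho> x (F y) = y" if "x \<in> M" "y \<in> M" "d x y < \<delta>" for x y
  proof (rule \<rho>_eqI[OF that(1)])
    show "norm (F y - F x) < \<eta>0" using near[OF that] assms(4) by simp
    show "nearest x (F y) y" using that assms(2) R_pos by (auto simp: nearest_def)
  qed
  show "\<rho> x w = \<rho> y w" if xy: "x \<in> M" "y \<in> M" "d x y < \<delta>" and w: "norm (w - F x) < \<eta>" "norm (w - F y) < \<eta>" for x y w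
  proof (rule \<rho>_eqI[OF xy(1)])
    show w0: "norm (w - F x) < \<eta>0" using w assms(4) by simp
    have wy: "norm (w - F y) < \<eta>0" using w assms(4) by simp
    have nx: "nearest x w (\<rho> x w)" and ny: "nearest y w (\<rho> y w)" using nearest_\<rho> xy by auto
    have 1: "d x (\<rho> x w) < R / 8" "d y (\<rho> y w) < R / 8"
      using nearest_near[OF xy(1) w0 nx] nearest_near[OF xy(2) wy ny] by auto
    have M: "\<rho> x w \<in> M" "\<rho> y w \<in> M" using nx ny by (auto simp: nearest_def)
    have a: "d y (\<rho> x w) \<le> R / 2" and b: "d x (\<rho> y w) \<le> R / 2"
      using triangle[OF xy(2,1) M(1)] triangle[OF xy(1,2) M(2)] 1 xy(3) assms(2) commute[of x y] R_pos by linarith+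
    have "norm (F (\<rho> y w) - w) \<le> norm (F (\<rho> x w) - w)" using ny a M by (auto simp: nearest_def)
    then show "nearest x w (\<rho> y w)" using nx b M unfolding nearest_def by force
  qed
  show "continuous_map (subtopology (prod_topology mtopology euclidean) {(x, w). norm (w - F x) < \<eta>}) mtopology (\<lambda>(x, w). \<rho> x w)"
    (is "continuous_map ?Z _ _")
  proof -
    have "\<forall>x\<in>M. \<exists>g. continuous_map (subtopology ?Z {z \<in> topspace ?Z. fst z \<in> mball x R}) mtopology g \<and>
        (\<forall>z\<in>topspace ?Z. fst z \<in> mball x R \<longrightarrow> (case z of (x, w) \<Rightarrow> \<rho> x w) = g z)"
    proof
      fix x assume x: "x \<in> M"
      obtain S :: "(real^'m) set" and f \<xi>0 s k W y ch \<psi> B where P: "near_patch x (2 * R) S f \<xi>0 s k W y ch \<psi> B"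
        using near_patches[OF x] by blast
      have g: "good_patch S f \<xi>0 s k W y ch \<psi> B" using P by (simp add: near_patch_def)
      interpret foot_patch S f \<xi>0 s k W y using g by (simp add: good_patch_def)
      have eq: "snd z \<in> W \<and> (case z of (x, w) \<Rightarrow> \<rho> x w) = \<psi> (y (snd z))"
        if z: "z \<in> topspace ?Z" "fst z \<in> mball x R" for z
      proof -
        have "fst z \<in> M" "norm (snd z - F (fst z)) < \<eta>0" using z assms(4) by auto
        from \<rho>_patch[OF this near_patch_R[OF P z(2)]] show ?thesis by (auto simp: case_prod_beta)
      qed
      let ?T = "subtopology ?Z {z \<in> topspace ?Z. fst z \<in> mball x R}"
      have sndc: "continuous_map ?Z euclidean snd"
        by (intro continuous_map_from_subtopology continuous_map_snd)
      have "continuous_map ?T (top_of_set W) snd"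
        by (rule continuous_map_into_subtopology[OF continuous_map_from_subtopology[OF sndc]]) (use eq in auto)
      moreover have "continuous_map (top_of_set W) (top_of_set S) y"
        using Ck_on_imp_continuous_on[OF y_Ck] foot ball_S by auto
      moreover have "continuous_map (top_of_set S) mtopology \<psi>" using g by (simp add: good_patch_def)
      ultimately have "continuous_map ?T mtopology (\<psi> \<circ> (y \<circ> snd))" by (meson continuous_map_compose)
      then show "\<exists>g. continuous_map ?T mtopology g \<and>
          (\<forall>z\<in>topspace ?Z. fst z \<in> mball x R \<longrightarrow> (case z of (x, w) \<Rightarrow> \<rho> x w) = g z)"
        using eq by (intro exI[of _ "\<psi> \<circ> (y \<circ> snd)"]) auto
    qed
    from bchoice[OF this] obtain G where G': "\<forall>x\<in>M. continuous_map (subtopology ?Z {z \<in> topspace ?Z. fst z \<in> mball x R}) mtopology (G x) \<and>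
        (\<forall>z\<in>topspace ?Z. fst z \<in> mball x R \<longrightarrow> (case z of (x, w) \<Rightarrow> \<rho> x w) = G x z)" ..
    have G: "continuous_map (subtopology ?Z {z \<in> topspace ?Z. fst z \<in> mball x R}) mtopology (G x)" if "x \<in> M" for x
      using bspec[OF G' that] by (rule conjunct1)
    have G2: "(case z of (x, w) \<Rightarrow> \<rho> x w) = G x z" if "x \<in> M" "z \<in> topspace ?Z" "fst z \<in> mball x R" for x z
      using bspec[OF G' that(1), THEN conjunct2, rule_format, OF that(2,3)] .
    show ?thesis
    proof (rule pasting_lemma[where I = M and T = "\<lambda>x. {z \<in> topspace ?Z. fst z \<in> mball x R}" and f = G])
      show "openin ?Z {z \<in> topspace ?Z. fst z \<in> mball x R}" for x
        by (rule openin_continuous_map_preimage[of _ mtopology])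
          (auto intro!: continuous_map_from_subtopology continuous_map_fst)
      show "G x z = G y z" if "x \<in> M" "y \<in> M" "z \<in> topspace ?Z \<inter> {z \<in> topspace ?Z. fst z \<in> mball x R} \<inter> {z \<in> topspace ?Z. fst z \<in> mball y R}" for x y z
        using G2[OF that(1), of z] G2[OF that(2), of z] that(3) by simp
      show "\<exists>x. x \<in> M \<and> z \<in> {z \<in> topspace ?Z. fst z \<in> mball x R} \<and> (case z of (x, w) \<Rightarrow> \<rho> x w) = G x z"
        if "z \<in> topspace ?Z" for z
        using that R_pos G2[of "fst z" z] by (intro exI[of _ "fst z"]) auto
    qed (rule G)
  qed
qed (use assms compact_M F_continuous near in auto)

end

section \<open>Uniform contraction\<close>

definition axis_steps :: "real \<Rightarrow> 'w::euclidean_space set" where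
  "axis_steps t = (\<lambda>b. t *\<^sub>R b) ` Basis \<union> (\<lambda>b. - (t *\<^sub>R b)) ` Basis"

lemma axis_steps:
  assumes "t > 0"
  shows "finite (axis_steps t :: 'w::euclidean_space set)" "axis_steps t \<noteq> ({} :: 'w set)"
    "card (axis_steps t :: 'w set) = 2 * DIM('w)"
    "(j :: 'w) \<in> axis_steps t \<Longrightarrow> norm j = t"
    "(\<Sum>j\<in>axis_steps t. g j) = (\<Sum>b\<in>Basis. g (t *\<^sub>R b) + g (- (t *\<^sub>R b :: 'w)) :: real)"
proof -
  have inj: "inj_on (\<lambda>b. t *\<^sub>R b) (Basis :: 'w set)" "inj_on (\<lambda>b. - (t *\<^sub>R b)) (Basis :: 'w set)"
    using assms by (auto simp: inj_on_def)
  have disj: "(\<lambda>b. t *\<^sub>R b) ` Basis \<inter> (\<lambda>b. - (t *\<^sub>R b)) ` Basis = ({} :: 'w set)"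
  proof (rule ccontr)
    assume "(\<lambda>b. t *\<^sub>R b) ` Basis \<inter> (\<lambda>b. - (t *\<^sub>R b)) ` Basis \<noteq> ({} :: 'w set)"
    then obtain b c :: 'w where bc: "b \<in> Basis" "c \<in> Basis" "t *\<^sub>R b = - (t *\<^sub>R c)" by auto
    then have "t *\<^sub>R (b + c) = 0" by (simp add: scaleR_add_right)
    then have "b + c = 0" using assms by simp
    then have "(b + c) \<bullet> b = 0" by simp
    then show False using bc(1,2) by (auto simp: inner_add_left inner_Basis split: if_splits)
  qed
  show "finite (axis_steps t :: 'w set)" "axis_steps t \<noteq> ({} :: 'w set)"
    by (auto simp: axis_steps_def nonempty_Basis)
  show "card (axis_steps t :: 'w set) = 2 * DIM('w)"
    unfolding axis_steps_def using inj disj by (subst card_Un_disjoint) (auto simp: card_image)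
  show "(j :: 'w) \<in> axis_steps t \<Longrightarrow> norm j = t" using assms by (auto simp: axis_steps_def)
  show "(\<Sum>j\<in>axis_steps t. g j) = (\<Sum>b\<in>Basis. g (t *\<^sub>R b) + g (- (t *\<^sub>R b :: 'w)) :: real)"
    unfolding axis_steps_def using inj disj
    by (subst sum.union_disjoint) (auto simp: sum.reindex sum.distrib)
qed

context patched_immersion
begin

lemma chart_near:
  assumes "good_patch S f \<xi>0 s k W y ch \<psi> B" "x \<in> B" "e > 0"
  shows "\<exists>r>0. mball x r \<subseteq> B \<and> (\<forall>z\<in>mball x r. dist (ch z) (ch x) < e)"
proof -
  have B: "openin mtopology B" and c: "continuous_map (subtopology mtopology B) euclidean ch"
    using assms(1) by (auto simp: good_patch_def)
  have tB: "topspace (subtopology mtopology B) = B" using openin_subset[OF B] by auto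
  have "openin (subtopology mtopology B) {z \<in> topspace (subtopology mtopology B). ch z \<in> ball (ch x) e}"
    by (rule openin_continuous_map_preimage[OF c]) simp
  then have "openin mtopology {z \<in> B. ch z \<in> ball (ch x) e}" unfolding tB using B by (rule openin_trans_full)
  moreover have "x \<in> {z \<in> B. ch z \<in> ball (ch x) e}" using assms by simp
  ultimately obtain r where "r > 0" "mball x r \<subseteq> {z \<in> B. ch z \<in> ball (ch x) e}"
    unfolding openin_mtopology by blast
  then show ?thesis by (intro exI[of _ r]) (auto simp: dist_commute)
qed

text \<open>
  \<open>F\<close> is injective on small balls, since a point of a patch is determined by its image as the unique foot
  point. Compactness then yields \<open>\<theta>\<close>.
\<close>

lemma ex_tube_radii: "\<exists>R \<theta>. tube_radii TYPE('m) M d F R \<theta>"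
proof -
  obtain e where "e > 0" and e: "\<And>x. x \<in> M \<Longrightarrow> \<exists>(S :: (real^'m) set) f \<xi>0 s k W y ch \<psi> B. near_patch x e S f \<xi>0 s k W y ch \<psi> B"
    using uniform_near_patch by blast
  define R where "R = e / 2"
  have R: "R > 0" "2 * R = e" using \<open>e > 0\<close> by (auto simp: R_def)
  have inj: "x = y" if xy: "x \<in> M" "y \<in> M" "d x y \<le> R / 2" "F x = F y" for x y
  proof -
    obtain S :: "(real^'m) set" and f \<xi>0 s k W yy ch \<psi> B where P: "near_patch x e S f \<xi>0 s k W yy ch \<psi> B"
      using e[OF xy(1)] by blast
    then have g: "good_patch S f \<xi>0 s k W yy ch \<psi> B" and "mball x e \<subseteq> B" by (auto simp: near_patch_def)
    moreover have "x \<in> mball x e" "y \<in> mball x e" using xy R by auto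
    ultimately have B: "x \<in> B" "y \<in> B" by auto
    interpret foot_patch S f \<xi>0 s k W yy using g by (simp add: good_patch_def)
    have in_ball: "ch x \<in> ball \<xi>0 s" "ch y \<in> ball \<xi>0 s" using g B by (auto simp: good_patch_def)
    then have S: "ch x \<in> S" "ch y \<in> S" using ball_S by auto
    have f: "f (ch x) = F x" "f (ch y) = F y" using g B S by (auto simp: good_patch_def)
    have "norm (F x - f \<xi>0) < k / 2" using g B by (simp add: good_patch_def)
    then have "F x \<in> ball (f \<xi>0) k" using k_pos by (simp add: dist_norm norm_minus_commute)
    then have "ch x = ch y"
      by (rule foot_unique[OF _ in_ball]) (use f xy(4) in \<open>simp_all add: foot_defect_eq_0_iff[OF S(1)] foot_defect_eq_0_iff[OF S(2)]\<close>)
    moreover have "\<psi> (ch x) = x" "\<psi> (ch y) = y" using g B by (auto simp: good_patch_def)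
    ultimately show ?thesis by metis
  qed
  let ?Z = "prod_topology mtopology mtopology"
  let ?C = "{z \<in> topspace ?Z. d (fst z) (snd z) \<in> {R/8..R/2}}"
  have dc: "continuous_map ?Z euclideanreal (\<lambda>z. d (fst z) (snd z))"
    using continuous_map_mdist[of ?Z Self fst snd]
    by (simp add: mtopology_of_def continuous_map_fst continuous_map_snd)
  have 1: "compact_space ?Z" using compact_M by (simp add: compact_space_prod_topology)
  have 2: "closedin ?Z ?C" by (rule closedin_continuous_map_preimage[OF dc]) simp
  have 3: "continuous_map ?Z euclideanreal (\<lambda>z. norm (F (fst z) - F (snd z)))"
    using continuous_map_compose[OF continuous_map_fst F_continuous]
      continuous_map_compose[OF continuous_map_snd F_continuous]
    by (intro continuous_intros) (auto simp: o_def)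
  have 4: "norm (F (fst z) - F (snd z)) > 0" if z: "z \<in> ?C" for z
  proof (rule ccontr)
    assume "\<not> ?thesis"
    then have "fst z = snd z" using z by (intro inj) auto
    then show False using z R(1) by auto
  qed
  obtain \<theta> where \<theta>: "\<theta> > 0" "\<And>z. z \<in> ?C \<Longrightarrow> \<theta> \<le> norm (F (fst z) - F (snd z))"
    using compact_space_positive_lower_bound[OF 1 2 3 4] by blast
  have "tube_radii TYPE('m) M d F R \<theta>"
  proof unfold_locales
    show "\<exists>(S :: (real^'m) set) f \<xi>0 s k W y ch \<psi> B. near_patch x (2 * R) S f \<xi>0 s k W y ch \<psi> B" if "x \<in> M" for x
      using e[OF that] by (simp only: R(2))
    show "d x y < R / 8" if "x \<in> M" "y \<in> M" "d x y \<le> R / 2" "norm (F x - F y) < \<theta>" for x y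
      using \<theta>(2)[of "(x, y)"] that by fastforce
  qed (use R \<theta> in auto)
  then show ?thesis by blast
qed

lemma uniform_F_near:
  assumes "e > 0"
  obtains r where "r > 0" "\<And>x y. \<lbrakk>x \<in> M; y \<in> M; d x y < r\<rbrakk> \<Longrightarrow> norm (F y - F x) < e"
proof -
  have "\<exists>r>0. \<forall>x\<in>M. \<forall>y\<in>M. d x y < r \<longrightarrow> norm (F y - F x) < e"
  proof (rule uniform_radius[OF compact_M])
    fix x assume x: "x \<in> M"
    obtain r where r: "r > 0" "\<And>y. y \<in> mball x r \<Longrightarrow> norm (F y - F x) < e / 2"
      using F_near[OF x, of "e / 2"] assms by auto
    have "norm (F z - F y) < e" if "y \<in> mball x (r / 2)" "z \<in> M" "d y z < r / 2" for y z
    proof -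
      have "d x z \<le> d x y + d y z" using that x by (intro triangle) auto
      then have "z \<in> mball x r" "y \<in> mball x r" using that x r(1) by auto
      then show ?thesis
        using r(2)[of y] r(2)[of z] norm_triangle_ineq4[of "F z - F x" "F y - F x"] by simp
    qed
    then show "\<exists>r>0. \<forall>y\<in>mball x r. \<forall>z\<in>M. d y z < r \<longrightarrow> norm (F z - F y) < e"
      using r(1) by (intro exI[of _ "r / 2"]) auto
  qed auto
  then show ?thesis using that by blast
qed

end

context tube_radii
begin

text \<open>
  In a patch \<open>F \<circ> \<rho> x\<close> is the differentiable retraction. The same number serves as radius and as inverse
  Lipschitz constant, so that the property passes to smaller radii and \<open>uniform_radius\<close> applies.
\<close>

lemma uniformly_lipschitz:
  obtains e where "e > 0" "e \<le> \<eta>0"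
    "\<And>x w w'. \<lbrakk>x \<in> M; norm (w - F x) < e; norm (w' - F x) < e\<rbrakk> \<Longrightarrow> norm (F (\<rho> x w) - F (\<rho> x w')) \<le> 1 / e * norm (w - w')"
proof -
  let ?Q = "\<lambda>x e. e \<le> \<eta>0 \<and> (\<forall>w w'. norm (w - F x) < e \<longrightarrow> norm (w' - F x) < e \<longrightarrow>
     norm (F (\<rho> x w) - F (\<rho> x w')) \<le> 1 / e * norm (w - w'))"
  have "\<exists>e>0. \<forall>x\<in>M. ?Q x e"
  proof (rule uniform_radius[OF compact_M])
    fix x e e' assume Q: "?Q x e" and e: "0 < e'" "e' \<le> e"
    have "norm (F (\<rho> x w) - F (\<rho> x w')) \<le> 1 / e' * norm (w - w')" if "norm (w - F x) < e'" "norm (w' - F x) < e'" for w w'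
    proof -
      have "norm (F (\<rho> x w) - F (\<rho> x w')) \<le> 1 / e * norm (w - w')" using Q that e by auto
      also have "\<dots> \<le> 1 / e' * norm (w - w')" using e by (intro mult_right_mono frac_le) auto
      finally show ?thesis .
    qed
    then show "?Q x e'" using Q e by auto
  next
    fix x assume x: "x \<in> M"
    obtain S :: "(real^'m) set" and f \<xi>0 s k W y ch \<psi> B where P: "near_patch x (2 * R) S f \<xi>0 s k W y ch \<psi> B"
      using near_patches[OF x] by blast
    have g: "good_patch S f \<xi>0 s k W y ch \<psi> B" using P by (simp add: near_patch_def)
    interpret foot_patch S f \<xi>0 s k W y using g by (simp add: good_patch_def)
    have xR: "x \<in> mball x R" using x R_pos by simp
    then have W: "F x \<in> W" using \<rho>_patch(1)[OF x _ near_patch_R[OF P xR], of "F x"] \<eta>0_pos by simp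
    obtain q where q: "q > 0" "ball (F x) q \<subseteq> W"
      "\<And>a b. a \<in> ball (F x) q \<Longrightarrow> b \<in> ball (F x) q \<Longrightarrow> norm (r a - r b - frechet_derivative r (at (F x)) (a - b)) \<le> 1 * norm (a - b)"
      using strictly_differentiable[OF open_W r_Ck W, of 1] by auto
    have "linear (frechet_derivative r (at (F x)))" using Dr_linear[OF W] by (simp add: Dr_def[abs_def])
    then obtain K where K: "K > 0" "\<And>v. norm (frechet_derivative r (at (F x)) v) \<le> K * norm v"
      using linear_bounded_pos by blast
    have lip: "norm (r a - r b) \<le> (K + 1) * norm (a - b)" if "a \<in> ball (F x) q" "b \<in> ball (F x) q" for a b
      using q(3)[OF that] K(2)[of "a - b"] norm_triangle_sub[of "r a - r b" "frechet_derivative r (at (F x)) (a - b)"]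
      by (simp add: algebra_simps)
    obtain u where u: "u > 0" "\<And>z. z \<in> mball x u \<Longrightarrow> norm (F z - F x) < q / 2"
      using F_near[OF x, of "q / 2"] q(1) by auto
    define e where "e = Min {u, q / 2, R, \<eta>0, 1 / (K + 1)}"
    have e: "e > 0" "e \<le> u" "e \<le> q / 2" "e \<le> R" "e \<le> \<eta>0" "e \<le> 1 / (K + 1)"
      using u q R_pos \<eta>0_pos K(1) by (auto simp: e_def)
    have Ke: "K + 1 \<le> 1 / e" using e K(1) by (simp add: field_simps)
    have "?Q z e" if z: "z \<in> mball x e" for z
    proof (intro conjI allI impI e(5))
      fix w w' assume w: "norm (w - F z) < e" "norm (w' - F z) < e"
      have zM: "z \<in> M" and zR: "z \<in> mball x R" and zu: "z \<in> mball x u" using z e x by auto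
      have ball: "w \<in> ball (F x) q" "w' \<in> ball (F x) q"
        using w u(2)[OF zu] e(3) norm_triangle_ineq[of "w - F z" "F z - F x"] norm_triangle_ineq[of "w' - F z" "F z - F x"]
        by (auto simp: dist_norm norm_minus_commute)
      have "F (\<rho> z w) = r w" "F (\<rho> z w') = r w'"
        using \<rho>_patch(3)[OF zM _ near_patch_R[OF P zR]] w e(5) by (auto simp: r_def)
      then have "norm (F (\<rho> z w) - F (\<rho> z w')) \<le> (K + 1) * norm (w - w')" using lip[OF ball] by simp
      also have "\<dots> \<le> 1 / e * norm (w - w')" by (rule mult_right_mono[OF Ke]) simp
      finally show "norm (F (\<rho> z w) - F (\<rho> z w')) \<le> 1 / e * norm (w - w')" .
    qed
    then show "\<exists>e>0. \<forall>z\<in>mball x e. ?Q z e" using e(1) by blast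
  qed
  then obtain e where "e > 0" "\<forall>x\<in>M. ?Q x e" by blast
  then show ?thesis
  proof (cases "M = {}")
    case True
    then show ?thesis using that[of \<eta>0] \<eta>0_pos by auto
  qed (use that[of e] in blast)
qed

definition contracts_near :: "'a \<Rightarrow> real \<Rightarrow> real \<Rightarrow> real \<Rightarrow> bool" where
  "contracts_near x t p e \<longleftrightarrow> e \<le> 1 \<and> (\<forall>y\<in>mball x e. \<forall>z\<in>mball x e.
     (\<Sum>j\<in>axis_steps t. norm (F (\<rho> y (F y + j)) - F (\<rho> z (F z + j))) powr p)
       \<le> (1 - e) * (card (axis_steps t :: (real^'q) set) * norm (F y - F z) powr p))"

text \<open>
  In the chart the move by \<open>j\<close> followed by \<open>F\<close> is \<open>\<xi> \<mapsto> r (f \<xi> + j)\<close>, so \<open>difference_contraction\<close> applies to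
  \<open>moves_contract_infinitesimally\<close>. The admissible range of \<open>t\<close> and \<open>p\<close> is uniform near \<open>x1\<close>; the radius \<open>e'\<close>
  depends on them.
\<close>

lemma ex_contracts_near:
  assumes x1: "x1 \<in> M"
  shows "\<exists>e>0. \<forall>x\<in>mball x1 e. \<forall>t p. 0 < t \<and> t < e \<and> 6 < p \<and> p < 6 + e \<longrightarrow> (\<exists>e'>0. contracts_near x t p e')"
proof -
  obtain S :: "(real^'m) set" and f \<xi>0 s k W yy ch \<psi> B where P: "near_patch x1 (2 * R) S f \<xi>0 s k W yy ch \<psi> B"
    using near_patches[OF x1] by blast
  have g: "good_patch S f \<xi>0 s k W yy ch \<psi> B" and BR: "mball x1 (2 * R) \<subseteq> B" using P by (auto simp: near_patch_def)
  interpret foot_patch S f \<xi>0 s k W yy using g by (simp add: good_patch_def)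
  have chU: "ch x \<in> U" and fch: "f (ch x) = F x" if "x \<in> B" for x
  proof -
    have b: "ch x \<in> ball \<xi>0 s" "\<psi> (ch x) = x" "norm (F x - f \<xi>0) < k / 2" using g that by (auto simp: good_patch_def)
    then have "ch x \<in> S" using ball_S by blast
    then have "F (\<psi> (ch x)) = f (ch x)" using g by (auto simp: good_patch_def)
    then show eq: "f (ch x) = F x" using b(2) by simp
    show "ch x \<in> U" using b eq k_pos by (simp add: U_def dist_norm norm_minus_commute)
  qed
  have x1B: "x1 \<in> B" using BR x1 R_pos by (meson centre_in_mball_iff subsetD mult_pos_pos zero_less_numeral)
  have "unstable_at (ch x1)" using g U_subset_S[OF chU[OF x1B]] by (auto simp: good_patch_def)
  from moves_contract_infinitesimally[OF chU[OF x1B] this]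
  obtain \<epsilon> where "\<epsilon> > 0" and \<epsilon>: "\<And>x' u t p. \<lbrakk>dist x' (ch x1) < \<epsilon>; u \<noteq> 0; 0 < t; t < \<epsilon>; \<bar>p - 6\<bar> < \<epsilon>\<rbrakk> \<Longrightarrow> x' \<in> U \<and>
      (\<forall>b\<in>Basis. f x' + t *\<^sub>R b \<in> W \<and> f x' - t *\<^sub>R b \<in> W) \<and>
      (\<Sum>b\<in>Basis. norm (Dr (f x' + t *\<^sub>R b) (Df x' u)) powr p + norm (Dr (f x' - t *\<^sub>R b) (Df x' u)) powr p)
        < 2 * DIM(real^'q) * norm (Df x' u) powr p"
    by blast
  obtain r1 where r1: "r1 > 0" "mball x1 r1 \<subseteq> B" "\<And>z. z \<in> mball x1 r1 \<Longrightarrow> dist (ch z) (ch x1) < \<epsilon>"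
    using chart_near[OF g x1B \<open>\<epsilon> > 0\<close>] by blast
  define e where "e = Min {r1, R, \<epsilon>, \<eta>0}"
  have e: "e > 0" "e \<le> r1" "e \<le> R" "e \<le> \<epsilon>" "e \<le> \<eta>0" using r1 R_pos \<open>\<epsilon> > 0\<close> \<eta>0_pos by (auto simp: e_def)
  have "\<exists>e'>0. contracts_near x t p e'" if x: "x \<in> mball x1 e" and tp: "0 < t" "t < e" "6 < p" "p < 6 + e" for x t p
  proof -
    let ?J = "axis_steps t :: (real^'q) set"
    note J = axis_steps[where 'w = "real^'q", OF tp(1)]
    have xB: "x \<in> B" using x r1(2) e(2) by auto
    define \<zeta> where "\<zeta> = ch x"
    have \<zeta>\<epsilon>: "dist \<zeta> (ch x1) < \<epsilon>" using r1(3)[of x] x e(2) by (simp add: \<zeta>_def)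
    have \<zeta>U: "\<zeta> \<in> U" using chU[OF xB] by (simp add: \<zeta>_def)
    have tp': "t < \<epsilon>" "\<bar>p - 6\<bar> < \<epsilon>" using tp e by auto
    obtain u0 :: "real^'m" where "u0 \<noteq> 0" using nonempty_Basis nonzero_Basis by blast
    have W: "f \<zeta> + j \<in> W" if "j \<in> ?J" for j
      using \<epsilon>[OF \<zeta>\<epsilon> \<open>u0 \<noteq> 0\<close> tp(1) tp'] that by (auto simp: axis_steps_def)
    have "\<exists>e0>0. e0 \<le> 1 \<and> (\<forall>a\<in>ball \<zeta> e0. \<forall>b\<in>ball \<zeta> e0.
      (\<Sum>j\<in>?J. norm (r (f a + j) - r (f b + j)) powr p) \<le> (1 - e0) * (card ?J * norm (f a - f b) powr p))"
    proof (rule difference_contraction[where L = "Df \<zeta>" and A = "\<lambda>j u. Dr (f \<zeta> + j) (Df \<zeta> u)"])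
      show "linear (Df \<zeta>)" by (rule Df_linear[OF U_subset_S[OF \<zeta>U]])
      then show "linear (\<lambda>u. Dr (f \<zeta> + j) (Df \<zeta> u))" if "j \<in> ?J" for j
        using linear_compose[OF _ Dr_linear[OF W[OF that]]] by (simp add: o_def)
      show "(\<Sum>j\<in>?J. norm (Dr (f \<zeta> + j) (Df \<zeta> u)) powr p) < card ?J * norm (Df \<zeta> u) powr p" if "u \<noteq> 0" for u
        using \<epsilon>[OF \<zeta>\<epsilon> that tp(1) tp'] by (simp add: J(3,5))
      show "\<exists>q>0. \<forall>a\<in>ball \<zeta> q. \<forall>b\<in>ball \<zeta> q. norm (f a - f b - Df \<zeta> (a - b)) \<le> c * norm (a - b)" if c: "c > 0" for c
        using strictly_differentiable[OF open_S smooth U_subset_S[OF \<zeta>U] c] unfolding Df_def by metis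
      show "\<exists>q>0. \<forall>a\<in>ball \<zeta> q. \<forall>b\<in>ball \<zeta> q. norm (r (f a + j) - r (f b + j) - Dr (f \<zeta> + j) (Df \<zeta> (a - b))) \<le> c * norm (a - b)"
        if j: "j \<in> ?J" and c: "c > 0" for j c
      proof -
        define N where "N = {a \<in> U. f a + j \<in> W}"
        have "continuous_on U (\<lambda>a. f a + j)"
          using Ck_on_imp_continuous_on[OF smooth] continuous_on_subset[of S f U] U_subset_S by (auto intro!: continuous_intros)
        then have "open (U \<inter> (\<lambda>a. f a + j) -` W)" by (rule continuous_open_preimage[OF _ open_U open_W])
        then have N: "open N" by (simp add: N_def vimage_def Int_def)
        have \<zeta>N: "\<zeta> \<in> N" using \<zeta>U W[OF j] by (simp add: N_def)
        have fO: "Ck_on i N f" for i by (rule Ck_on_subset[OF smooth]) (auto simp: N_def U_subset_S)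
        have C: "Ck_on (Suc 0) N (\<lambda>a. r (f a + j))"
          by (rule Ck_on_compose[OF N open_W _ Ck_on_add[OF N fO Ck_on_const[OF N]] r_Ck]) (auto simp: N_def)
        have "((\<lambda>a. r (f a + j)) has_derivative (\<lambda>u. Dr (f \<zeta> + j) (Df \<zeta> u))) (at \<zeta>)"
          by (rule has_derivative_compose[OF has_derivative_add_const[OF f_has_derivative[OF U_subset_S[OF \<zeta>U]]]
                r_has_derivative[OF W[OF j]]])
        from frechet_derivative_at[OF this]
        show ?thesis using strictly_differentiable[OF N C \<zeta>N c] by metis
      qed
    qed (use J(1) tp in auto)
    then obtain e0 where e0: "e0 > 0" "e0 \<le> 1" "\<And>a b. a \<in> ball \<zeta> e0 \<Longrightarrow> b \<in> ball \<zeta> e0 \<Longrightarrow>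
      (\<Sum>j\<in>?J. norm (r (f a + j) - r (f b + j)) powr p) \<le> (1 - e0) * (card ?J * norm (f a - f b) powr p)"
      by blast
    obtain r2 where r2: "r2 > 0" "mball x r2 \<subseteq> B" "\<And>z. z \<in> mball x r2 \<Longrightarrow> dist (ch z) \<zeta> < e0"
      using chart_near[OF g xB e0(1)] unfolding \<zeta>_def by blast
    define e' where "e' = Min {e0, r2, R - d x1 x}"
    have e': "e' > 0" "e' \<le> e0" "e' \<le> r2" "e' \<le> R - d x1 x" using e0 r2 x e(3) by (auto simp: e'_def)
    have pt: "y \<in> B \<and> ch y \<in> ball \<zeta> e0 \<and> (\<forall>j\<in>?J. F (\<rho> y (F y + j)) = r (f (ch y) + j))" if y: "y \<in> mball x e'" for y
    proof (intro conjI ballI)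
      have y2: "y \<in> mball x r2" using y e'(3) by auto
      show yB: "y \<in> B" using y2 r2(2) by blast
      show "ch y \<in> ball \<zeta> e0" using r2(3)[OF y2] by (simp add: dist_commute)
      fix j assume j: "j \<in> ?J"
      have "d x1 y \<le> d x1 x + d x y" using x y by (intro triangle) auto
      then have "y \<in> mball x1 R" using x y e'(4) by auto
      then have "F (\<rho> y (F y + j)) = f (yy (F y + j))"
        using \<rho>_patch(3)[OF _ _ near_patch_R[OF P]] y J(4)[OF j] tp e(5) by simp
      then show "F (\<rho> y (F y + j)) = r (f (ch y) + j)" by (simp add: r_def fch[OF yB])
    qed
    have "contracts_near x t p e'"
      unfolding contracts_near_def
    proof (intro conjI ballI)
      show "e' \<le> 1" using e' e0 by simp
      fix y z assume y: "y \<in> mball x e'" and z: "z \<in> mball x e'"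
      have "(\<Sum>j\<in>?J. norm (F (\<rho> y (F y + j)) - F (\<rho> z (F z + j))) powr p)
          = (\<Sum>j\<in>?J. norm (r (f (ch y) + j) - r (f (ch z) + j)) powr p)"
        using pt[OF y] pt[OF z] by (intro sum.cong) auto
      also have "\<dots> \<le> (1 - e0) * (card ?J * norm (f (ch y) - f (ch z)) powr p)"
        using pt[OF y] pt[OF z] by (intro e0(3)) auto
      also have "\<dots> \<le> (1 - e') * (card ?J * norm (F y - F z) powr p)"
        using pt[OF y] pt[OF z] e'(2) by (auto simp: fch intro!: mult_right_mono)
      finally show "(\<Sum>j\<in>?J. norm (F (\<rho> y (F y + j)) - F (\<rho> z (F z + j))) powr p)
        \<le> (1 - e') * (card ?J * norm (F y - F z) powr p)" .
    qed
    then show ?thesis using e'(1) by blast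
  qed
  then show ?thesis using e(1) by blast
qed

text \<open>
  Compactness is used twice: first to choose a step \<open>t\<close> and an exponent \<open>p > 6\<close> that serve all points, then
  to choose a radius and a contraction factor for these.
\<close>

theorem ex_contracting_tube:
  "\<exists>\<delta> \<eta> C J p c. lipschitz_tubular_immersion M d F \<rho> \<delta> \<eta> C \<and> 6 < p \<and>
     tubular_immersion.contracting M d F \<rho> \<delta> \<eta> J p c"
proof -
  obtain \<eta> where \<eta>: "\<eta> > 0" "\<eta> \<le> \<eta>0" and lip: "\<And>x w w'. \<lbrakk>x \<in> M; norm (w - F x) < \<eta>; norm (w' - F x) < \<eta>\<rbrakk> \<Longrightarrow>
      norm (F (\<rho> x w) - F (\<rho> x w')) \<le> 1 / \<eta> * norm (w - w')"
    using uniformly_lipschitz by metis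
  have "\<exists>e>0. \<forall>x\<in>M. \<forall>t p. 0 < t \<and> t < e \<and> 6 < p \<and> p < 6 + e \<longrightarrow> (\<exists>e'>0. contracts_near x t p e')"
    by (rule uniform_radius[OF compact_M _ ex_contracts_near]) auto
  then obtain e where e: "e > 0" "\<And>x t p. x \<in> M \<Longrightarrow> 0 < t \<Longrightarrow> t < e \<Longrightarrow> 6 < p \<Longrightarrow> p < 6 + e \<Longrightarrow> \<exists>e'>0. contracts_near x t p e'"
    by blast
  define t where "t = min e \<eta> / 2"
  define p where "p = 6 + e / 2"
  have t: "0 < t" "t < e" "t < \<eta>" and p: "6 < p" "p < 6 + e" using e(1) \<eta>(1) by (auto simp: t_def p_def)
  let ?J = "axis_steps t :: (real^'q) set"
  note J = axis_steps[where 'w = "real^'q", OF t(1)]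
  have "\<exists>c>0. \<forall>x\<in>M. contracts_near x t p c"
  proof (rule uniform_radius[OF compact_M])
    fix x c c' assume Q: "contracts_near x t p c" and c: "0 < c'" "c' \<le> c"
    have "(1 - c) * (card ?J * norm (F y - F z) powr p) \<le> (1 - c') * (card ?J * norm (F y - F z) powr p)" for y z
      using c by (intro mult_right_mono) auto
    moreover have "mball x c' \<subseteq> mball x c" using c by auto
    ultimately show "contracts_near x t p c'" using Q c unfolding contracts_near_def by (meson order_trans subsetD)
  next
    fix x assume x: "x \<in> M"
    obtain c where c: "c > 0" "contracts_near x t p c" using e(2)[OF x t(1,2) p] by blast
    have "contracts_near y t p (c / 2)" if y: "y \<in> mball x (c / 2)" for y
    proof -
      have sub: "mball y (c / 2) \<subseteq> mball x c"
      proof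
        fix z assume z: "z \<in> mball y (c / 2)"
        have "d x z \<le> d x y + d y z" using x y z by (intro triangle) auto
        then show "z \<in> mball x c" using x y z by auto
      qed
      have "(1 - c) * (card ?J * norm (F y - F z) powr p) \<le> (1 - c / 2) * (card ?J * norm (F y - F z) powr p)" for y z
        using c by (intro mult_right_mono) auto
      moreover have "c / 2 \<le> 1" using c by (simp add: contracts_near_def)
      ultimately show ?thesis using c sub unfolding contracts_near_def by (meson order_trans subsetD)
    qed
    then show "\<exists>c>0. \<forall>y\<in>mball x c. contracts_near y t p c" using c(1) half_gt_zero by blast
  qed
  then obtain c where c: "c > 0" "\<And>x. x \<in> M \<Longrightarrow> contracts_near x t p c" by blast
  obtain r where r: "r > 0" "\<And>x y. \<lbrakk>x \<in> M; y \<in> M; d x y < r\<rbrakk> \<Longrightarrow> norm (F y - F x) < \<eta>"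
    using uniform_F_near[OF \<eta>(1)] by metis
  define \<delta> where "\<delta> = Min {r, R / 8, c}"
  have \<delta>: "\<delta> > 0" "\<delta> \<le> r" "\<delta> \<le> R / 8" "\<delta> \<le> c" using r R_pos c by (auto simp: \<delta>_def)
  have tube: "tubular_immersion M d F \<rho> \<delta> \<eta>"
    using \<delta> \<eta> r by (intro \<rho>_tubular) auto
  interpret T: tubular_immersion M d F \<rho> \<delta> \<eta> by (rule tube)
  have lt: "lipschitz_tubular_immersion M d F \<rho> \<delta> \<eta> (1 / \<eta>)"
    by unfold_locales (use \<eta> lip in auto)
  have ineq: "(\<Sum>j\<in>?J. norm (F (\<rho> x (F x + j)) - F (\<rho> y (F y + j))) powr p)
      \<le> (1 - min c 1) * card ?J * norm (F x - F y) powr p" if xy: "x \<in> M" "y \<in> M" "d x y < \<delta>" for x y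
  proof -
    have "x \<in> mball x c" "y \<in> mball x c" using xy c \<delta> by auto
    then have "(\<Sum>j\<in>?J. norm (F (\<rho> x (F x + j)) - F (\<rho> y (F y + j))) powr p)
      \<le> (1 - c) * (card ?J * norm (F x - F y) powr p)" using c(2)[OF xy(1)] unfolding contracts_near_def by blast
    also have "\<dots> \<le> (1 - min c 1) * (card ?J * norm (F x - F y) powr p)" by (intro mult_right_mono) auto
    finally show ?thesis by (simp add: mult.assoc)
  qed
  have "T.contracting ?J p (1 - min c 1)"
    unfolding T.contracting_def T.move_def using J t p c ineq by auto
  then show ?thesis using lt p(1) by blast
qed

end

section \<open>Charts and connectedness\<close>

lemma chart_inverse:
  assumes "is_chart X c"
  shows "\<And>y. y \<in> chart_dom c \<Longrightarrow> chart_map c y \<in> chart_image c \<and> chart_inv c (chart_map c y) = y"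
    and "\<And>\<xi>. \<xi> \<in> chart_image c \<Longrightarrow> chart_inv c \<xi> \<in> chart_dom c \<and> chart_map c (chart_inv c \<xi>) = \<xi>"
    and "continuous_map (subtopology X (chart_dom c)) euclidean (chart_map c)"
    and "continuous_map (top_of_set (chart_image c)) X (chart_inv c)"
proof -
  have hom: "homeomorphic_map (subtopology X (chart_dom c)) (top_of_set (chart_image c)) (chart_map c)"
    and op: "openin X (chart_dom c)"
    using assms by (auto simp: is_chart_def)
  have top: "topspace (subtopology X (chart_dom c)) = chart_dom c" using openin_subset[OF op] by auto
  have inj: "inj_on (chart_map c) (chart_dom c)" using homeomorphic_imp_injective_map[OF hom] top by simp
  show 1: "chart_map c y \<in> chart_image c \<and> chart_inv c (chart_map c y) = y" if "y \<in> chart_dom c" for y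
    using that inj by (simp add: chart_image_def chart_inv_def)
  show "chart_inv c \<xi> \<in> chart_dom c \<and> chart_map c (chart_inv c \<xi>) = \<xi>" if "\<xi> \<in> chart_image c" for \<xi>
    using that 1 by (auto simp: chart_image_def)
  show "continuous_map (subtopology X (chart_dom c)) euclidean (chart_map c)"
    using homeomorphic_imp_continuous_map[OF hom] by (simp add: continuous_map_in_subtopology)
  obtain h where h: "homeomorphic_maps (subtopology X (chart_dom c)) (top_of_set (chart_image c)) (chart_map c) h"
    using hom unfolding homeomorphic_map_maps by blast
  have "h \<xi> = chart_inv c \<xi>" if "\<xi> \<in> topspace (top_of_set (chart_image c))" for \<xi>
  proof -
    have "\<xi> \<in> chart_map c ` chart_dom c" using that by (simp add: chart_image_def)
    then obtain y where y: "y \<in> chart_dom c" "\<xi> = chart_map c y" by blast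
    then have "h \<xi> = y" using h openin_subset[OF op] by (auto simp: homeomorphic_maps_def)
    then show ?thesis using 1[OF y(1)] y(2) by simp
  qed
  moreover have "continuous_map (top_of_set (chart_image c)) X h"
    using h by (simp add: homeomorphic_maps_def continuous_map_in_subtopology)
  ultimately show "continuous_map (top_of_set (chart_image c)) X (chart_inv c)"
    by (rule continuous_map_eq[rotated])
qed

lemma local_immersion_chart:
  fixes F :: "'a \<Rightarrow> real^'q::finite" and c :: "('a, 'm::finite) chart"
  assumes "is_chart X c" "smooth_on (chart_image c) (F \<circ> chart_inv c)"
    and "\<And>x. x \<in> chart_dom c \<Longrightarrow> inj (chart_diff F c x)"
  shows "local_immersion (chart_image c) (F \<circ> chart_inv c)"
proof
  show "open (chart_image c)" using assms(1) by (simp add: is_chart_def)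
  show "Ck_on k (chart_image c) (F \<circ> chart_inv c)" for k using assms(2) by (simp add: smooth_on_def)
  show "inj (frechet_derivative (F \<circ> chart_inv c) (at \<xi>))" if "\<xi> \<in> chart_image c" for \<xi>
    using assms(3)[of "chart_inv c \<xi>"] chart_inverse(2)[OF assms(1) that] by (simp add: chart_diff_def[abs_def])
qed

lemma unstable_at_chart:
  fixes F :: "'a \<Rightarrow> real^'q::finite" and c :: "('a, 'm::finite) chart"
  assumes c: "is_chart X c" and imm: "local_immersion (chart_image c) (F \<circ> chart_inv c)"
    and g: "\<And>x u v. x \<in> chart_dom c \<Longrightarrow> chart_diff F c x u \<bullet> chart_diff F c x v = g c x u v"
    and neg: "\<And>x e v. \<lbrakk>x \<in> chart_dom c; orthonormal_frame_at g c x e; g c x v v = 1\<rbrakk> \<Longrightarrow> F_Phi3 F c x e v < 0"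
    and \<xi>: "\<xi> \<in> chart_image c"
  shows "local_immersion.unstable_at (F \<circ> chart_inv c) \<xi>"
proof -
  interpret local_immersion "chart_image c" "F \<circ> chart_inv c" by (rule imm)
  define x where "x = chart_inv c \<xi>"
  have x: "x \<in> chart_dom c" "chart_map c x = \<xi>" using chart_inverse(2)[OF c \<xi>] by (auto simp: x_def)
  have diff: "chart_diff F c y = Df (chart_map c y)" for y
    by (simp add: fun_eq_iff chart_diff_def Df_def)
  have "second_fundamental_form F c x u v = II \<xi> u v" for u v
  proof -
    have "((\<lambda>y. chart_diff F c y v) \<circ> chart_inv c has_derivative D2f \<xi> v) (at \<xi>)"
      by (rule has_derivative_transform_within_open[OF Df_has_derivative[OF \<xi>] open_S \<xi>])
        (simp add: diff chart_inverse(2)[OF c])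
    from frechet_derivative_at[OF this] show ?thesis
      by (simp add: second_fundamental_form_def II_def chart_diff_def[of "\<lambda>y. chart_diff F c y v"] x(2))
        (simp add: diff x(2))
  qed
  then have B: "second_fundamental_form F c x = II \<xi>" by (simp add: fun_eq_iff)
  show ?thesis
    unfolding unstable_at_def
  proof (intro allI impI, elim conjE)
    fix e u assume e: "orthonormal_frame \<xi> e" "norm (Df \<xi> u) = 1"
    have "orthonormal_frame_at g c x e"
      using e(1) by (simp add: orthonormal_frame_at_def orthonormal_frame_def g[OF x(1), symmetric] diff x(2))
    moreover have "g c x u u = 1"
      using e(2) by (simp add: g[OF x(1), symmetric] diff x(2) flip: power2_norm_eq_inner)
    ultimately show "(\<Sum>i\<in>UNIV. 6 * (II \<xi> u (e i) \<bullet> II \<xi> u (e i)) - II \<xi> u u \<bullet> II \<xi> (e i) (e i)) < 0"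
      using neg[OF x(1), of e u] by (simp add: F_Phi3_def B Let_def)
  qed
qed

lemma continuous_map_if_continuous_in_charts:
  assumes "\<And>c. c \<in> \<A> \<Longrightarrow> is_chart X c" "(\<Union>c\<in>\<A>. chart_dom c) = topspace X"
    and "\<And>c. c \<in> \<A> \<Longrightarrow> continuous_on (chart_image c) (F \<circ> chart_inv c)"
  shows "continuous_map X euclidean F"
proof (rule pasting_lemma[where I = \<A> and T = chart_dom and f = "\<lambda>_. F"])
  show "openin X (chart_dom c)" if "c \<in> \<A>" for c using assms(1)[OF that] by (simp add: is_chart_def)
  show "continuous_map (subtopology X (chart_dom c)) euclidean F" if "c \<in> \<A>" for c
  proof (rule continuous_map_eq)
    note ch = chart_inverse[OF assms(1)[OF that]]
    have "continuous_map (subtopology X (chart_dom c)) (top_of_set (chart_image c)) (chart_map c)"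
      by (rule continuous_map_into_subtopology[OF ch(3)]) (use ch(1) in auto)
    moreover have "continuous_map (top_of_set (chart_image c)) euclidean (F \<circ> chart_inv c)"
      using assms(3)[OF that] by simp
    ultimately show "continuous_map (subtopology X (chart_dom c)) euclidean ((F \<circ> chart_inv c) \<circ> chart_map c)"
      by (rule continuous_map_compose)
    show "((F \<circ> chart_inv c) \<circ> chart_map c) x = F x" if "x \<in> topspace (subtopology X (chart_dom c))" for x
      using ch(1)[of x] that by simp
  qed
  show "\<exists>c. c \<in> \<A> \<and> x \<in> chart_dom c \<and> F x = F x" if "x \<in> topspace X" for x
    using that assms(2) by blast
qed simp

text \<open>
  The metric \<open>d\<close> is an arbitrary one inducing the topology, unrelated to the Riemannian distance.
\<close>

lemma patched_immersion_if_Phi3_SSU: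
  fixes X :: "'a topology" and \<A> :: "('a, 'm::finite) chart set"
  assumes compact: "compact_space X" and ssu: "Phi3_SSU TYPE('q::finite) X \<A> g"
  obtains M d and F :: "'a \<Rightarrow> real^'q" where "X = Metric_space.mtopology M d" "patched_immersion TYPE('m) M d F"
proof -
  obtain F :: "'a \<Rightarrow> real^'q" where iso: "isometric_immersion \<A> g F" and
    neg: "\<forall>c\<in>\<A>. \<forall>x\<in>chart_dom c. \<forall>e v. orthonormal_frame_at g c x e \<and> g c x v v = 1 \<longrightarrow> F_Phi3 F c x e v < 0"
    and "smooth_manifold X \<A>"
    using ssu unfolding Phi3_SSU_def riemannian_manifold_def by blast
  then have X: "Hausdorff_space X" "second_countable X" and chart: "\<And>c. c \<in> \<A> \<Longrightarrow> is_chart X c"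
    and cover: "(\<Union>c\<in>\<A>. chart_dom c) = topspace X"
    by (auto simp: smooth_manifold_def)
  obtain M d where "Metric_space M d" and Xd: "X = Metric_space.mtopology M d"
    using compact_Hausdorff_second_countable_metrizable[OF compact X] unfolding metrizable_space_def by blast
  then interpret Metric_space M d by blast
  have smooth: "smooth_on (chart_image c) (F \<circ> chart_inv c)" if "c \<in> \<A>" for c
    using iso that by (simp add: isometric_immersion_def)
  have imm: "local_immersion (chart_image c) (F \<circ> chart_inv c)" if "c \<in> \<A>" for c
    using iso that by (intro local_immersion_chart[OF chart[OF that] smooth[OF that]]) (simp add: isometric_immersion_def)
  have "patched_immersion TYPE('m) M d F"
  proof
    show "compact_space mtopology" using compact Xd by simp
    have "continuous_on (chart_image c) (F \<circ> chart_inv c)" if "c \<in> \<A>" for c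
      using smooth[OF that] Ck_on_imp_continuous_on unfolding smooth_on_def by blast
    from continuous_map_if_continuous_in_charts[OF chart cover this]
    show "continuous_map mtopology euclidean F" by (simp flip: Xd)
    fix x assume "x \<in> M"
    then have "x \<in> topspace X" by (simp add: Xd)
    then obtain c where c: "c \<in> \<A>" "x \<in> chart_dom c" using cover by blast
    note inv = chart_inverse[OF chart[OF c(1)]]
    have un: "local_immersion.unstable_at (F \<circ> chart_inv c) \<xi>" if "\<xi> \<in> chart_image c" for \<xi>
      using iso neg c(1)
      by (intro unstable_at_chart[OF chart[OF c(1)] imm[OF c(1)] _ _ that, of g]) (auto simp: isometric_immersion_def)
    have op: "openin mtopology (chart_dom c)" using chart[OF c(1)] by (simp add: is_chart_def Xd)
    show "\<exists>(S :: (real^'m) set) f ch \<psi> B. x \<in> B \<and> openin mtopology B \<and> local_immersion S f \<and>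
       (\<forall>\<xi>\<in>S. local_immersion.unstable_at f \<xi>) \<and> (\<forall>y\<in>B. ch y \<in> S \<and> \<psi> (ch y) = y) \<and>
       (\<forall>\<xi>\<in>S. \<psi> \<xi> \<in> B \<and> F (\<psi> \<xi>) = f \<xi> \<and> ch (\<psi> \<xi>) = \<xi>) \<and>
       continuous_map (subtopology mtopology B) euclidean ch \<and> continuous_map (top_of_set S) mtopology \<psi>"
      by (rule exI[of _ "chart_image c"], rule exI[of _ "F \<circ> chart_inv c"], rule exI[of _ "chart_map c"],
          rule exI[of _ "chart_inv c"], rule exI[of _ "chart_dom c"])
        (use c(2) op imm[OF c(1)] un inv in \<open>auto simp: Xd\<close>)
  qed
  with Xd that show ?thesis by blast
qed

lemma (in lipschitz_tubular_immersion) n_connected_if_contracting: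
  assumes "M \<noteq> {}" "connected_space mtopology" "contracting J p c" "real n < p"
  shows "n_connected n mtopology"
  unfolding n_connected_def topspace_mtopology
proof (intro conjI ballI)
  show "path_connected_space mtopology" by (rule path_connected_if_connected[OF assms(2)])
  fix x k assume x: "x \<in> M" and "k \<in> {1..n}"
  then have k: "0 < k" "real k < p" using assms(4) by auto
  show "trivial_group (homotopy_group k mtopology x)"
  proof (rule trivial_homotopy_group_if_null_homotopic[OF k(1)])
    fix f assume "f \<in> cube_map k mtopology x"
    then have f: "continuous_map (cube k) mtopology f" "\<And>t. t \<in> cube_boundary k \<Longrightarrow> f t = x"
      by (auto simp: cube_map_def)
    obtain a where hom: "homotopic_with (const_on (cube_boundary k)) (cube k) mtopology f (\<lambda>_. a)"
      using cube_map_null_homotopic[OF assms(3) k f] by blast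
    show "homotopic_with (\<lambda>f. \<forall>t\<in>cube_boundary k. f t = x) (cube k) mtopology f (\<lambda>_. x)"
      by (rule based_homotopic_const_if_free[OF k(1) _ hom]) (rule f(2))
  qed (use x in simp)
qed (use assms(1) in simp)

theorem theorem5p6:
  fixes X :: "'a topology"
    and \<A> :: "('a, 'm::finite) chart set"
    and g :: "('a, 'm) metric_field"
  assumes "compact_space X"
    and "Phi3_SSU TYPE('q::finite) X \<A> g"
  shows "n_connected 6 X"
proof -
  obtain M d and F :: "'a \<Rightarrow> real^'q" where X: "X = Metric_space.mtopology M d"
    and "patched_immersion TYPE('m) M d F"
    using patched_immersion_if_Phi3_SSU[OF assms] by blast
  then interpret patched_immersion M d F "TYPE('m)" by blast
  obtain R \<theta> where "tube_radii TYPE('m) M d F R \<theta>" using ex_tube_radii by blast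
  then interpret tube_radii M d F "TYPE('m)" R \<theta> .
  obtain \<delta> \<eta> C J p c where lip: "lipschitz_tubular_immersion M d F \<rho> \<delta> \<eta> C" and p: "6 < p"
    and contr: "tubular_immersion.contracting M d F \<rho> \<delta> \<eta> J p c"
    using ex_contracting_tube by blast
  have "M \<noteq> {}" "connected_space mtopology"
    using assms(2) by (auto simp: Phi3_SSU_def riemannian_manifold_def X)
  from lipschitz_tubular_immersion.n_connected_if_contracting[OF lip this contr, of 6] p
  show ?thesis by (simp add: X)
qed

end
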